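(* Let $R\subset S$ be an FCP extension of commutative rings. There exists a least $T\in[R,S]$ such that $T\subseteq S$ is integral. This least element is called the co-integral closure of $R\subset S$ and is denoted by $\underline R$. Moreover, $\underline R=\bigcap\{U\in[R,S]\mid U\subseteq S \text{ is integral}\}$, and $\widetilde R\subseteq\underline R$, where $\widetilde R$ is the Prüfer hull of $R$ in $S$.
   Context: All rings are commutative and unital; a ring extension $R\subseteq S$ means $R$ is a unital subring of $S$. $\subset$ denotes proper inclusion. $[R,S]$ is the set of all $R$-subalgebras of $S$, ordered by inclusion. The extension $R\subseteq S$ has FCP (is an FCP extension) if each chain in $[R,S]$ is finite. An extension $R\subseteq S$ is called Prüfer if $R\subseteq T$ is a flat epimorphism (of commutative rings) for each $T\in[R,S]$. The Prüfer hull $\widetilde R$ of $R\subseteq S$ is the greatest $T\in[R,S]$ such that $R\subseteq T$ is Prüfer (it always exists). *)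

theory Defs
  imports "HOL-Algebra.Algebra"
begin

text \<open>
  An extension of commutative rings is given by a \<^const>\<open>cring\<close> \<open>S\<close> and a set \<open>R\<close> with
  \<^term>\<open>subring R S\<close>; a subring \<open>T\<close> of \<open>S\<close>, regarded as a ring, is \<open>S\<lparr>carrier := T\<rparr>\<close>.
\<close>

definition intermediate_rings :: "'a set \<Rightarrow> ('a, 'b) ring_scheme \<Rightarrow> 'a set set"
  where "intermediate_rings R S = {T. subring T S \<and> R \<subseteq> T}"

definition FCP :: "'a set \<Rightarrow> ('a, 'b) ring_scheme \<Rightarrow> bool"
  where "FCP R S \<longleftrightarrow> (\<forall>C. subset.chain (intermediate_rings R S) C \<longrightarrow> finite C)"

text \<open>
  \<^const>\<open>ring.eval\<close> takes the coefficient list with the leading coefficient first, so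
  \<open>\<one> # p\<close> is an arbitrary monic polynomial over \<open>R\<close>.
\<close>

definition integral_over :: "'a set \<Rightarrow> ('a, 'b) ring_scheme \<Rightarrow> 'a \<Rightarrow> bool"
  where "integral_over R S x \<longleftrightarrow>
    (\<exists>p. set p \<subseteq> R \<and> ring.eval S (\<one>\<^bsub>S\<^esub> # p) x = \<zero>\<^bsub>S\<^esub>)"

definition integral_ext :: "'a set \<Rightarrow> ('a, 'b) ring_scheme \<Rightarrow> bool"
  where "integral_ext R S \<longleftrightarrow> (\<forall>x \<in> carrier S. integral_over R S x)"


subsection \<open>Tensor products and flatness\<close>

definition tensor_relators ::
    "('r, 'c) ring_scheme \<Rightarrow> ('r, 'm, 'd) module_scheme \<Rightarrow> ('r, 'n, 'e) module_scheme
      \<Rightarrow> ('m \<times> 'n \<Rightarrow>\<^sub>0 int) set"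
  where "tensor_relators R M N =
    {frag_of (x \<oplus>\<^bsub>M\<^esub> x', y) - frag_of (x, y) - frag_of (x', y) |x x' y.
       x \<in> carrier M \<and> x' \<in> carrier M \<and> y \<in> carrier N} \<union>
    {frag_of (x, y \<oplus>\<^bsub>N\<^esub> y') - frag_of (x, y) - frag_of (x, y') |x y y'.
       x \<in> carrier M \<and> y \<in> carrier N \<and> y' \<in> carrier N} \<union>
    {frag_of (a \<odot>\<^bsub>M\<^esub> x, y) - frag_of (x, a \<odot>\<^bsub>N\<^esub> y) |a x y.
       a \<in> carrier R \<and> x \<in> carrier M \<and> y \<in> carrier N}"

definition tensor_kernel ::
    "('r, 'c) ring_scheme \<Rightarrow> ('r, 'm, 'd) module_scheme \<Rightarrow> ('r, 'n, 'e) module_scheme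
      \<Rightarrow> ('m \<times> 'n \<Rightarrow>\<^sub>0 int) set"
  where "tensor_kernel R M N =
    generate (free_Abelian_group (carrier M \<times> carrier N)) (tensor_relators R M N)"

text \<open>The underlying abelian group of \<open>M \<otimes>\<^sub>R N\<close>; this is all that flatness refers to.\<close>

definition tensor_product ::
    "('r, 'c) ring_scheme \<Rightarrow> ('r, 'm, 'd) module_scheme \<Rightarrow> ('r, 'n, 'e) module_scheme
      \<Rightarrow> ('m \<times> 'n \<Rightarrow>\<^sub>0 int) set monoid"
  where "tensor_product R M N =
    free_Abelian_group (carrier M \<times> carrier N) Mod tensor_kernel R M N"

definition module_homs ::
    "('r, 'c) ring_scheme \<Rightarrow> ('r, 'm, 'd) module_scheme \<Rightarrow> ('r, 'n, 'e) module_scheme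
      \<Rightarrow> ('m \<Rightarrow> 'n) set"
  where "module_homs R M N = {f \<in> carrier M \<rightarrow> carrier N.
    (\<forall>x \<in> carrier M. \<forall>y \<in> carrier M. f (x \<oplus>\<^bsub>M\<^esub> y) = f x \<oplus>\<^bsub>N\<^esub> f y) \<and>
    (\<forall>a \<in> carrier R. \<forall>x \<in> carrier M. f (a \<odot>\<^bsub>M\<^esub> x) = a \<odot>\<^bsub>N\<^esub> f x)}"

text \<open>
  \<open>tensor_map R N T f\<close> is the map \<open>f \<otimes> id : M \<otimes>\<^sub>R T \<rightarrow> N \<otimes>\<^sub>R T\<close> induced by \<open>f : M \<rightarrow> N\<close>.
  It acts on classes modulo \<^const>\<open>tensor_kernel\<close>; if \<open>f\<close> is linear, all the cosets in the union
  coincide (\<open>tensor_map_coset\<close> below).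
\<close>

definition frag_map_left :: "('m \<Rightarrow> 'n) \<Rightarrow> ('m \<times> 't \<Rightarrow>\<^sub>0 int) \<Rightarrow> ('n \<times> 't \<Rightarrow>\<^sub>0 int)"
  where "frag_map_left f = frag_extend (\<lambda>(x, t). frag_of (f x, t))"

definition tensor_map ::
    "('r, 'c) ring_scheme \<Rightarrow> ('r, 'n, 'd) module_scheme \<Rightarrow> ('r, 't, 'e) module_scheme
      \<Rightarrow> ('m \<Rightarrow> 'n) \<Rightarrow> ('m \<times> 't \<Rightarrow>\<^sub>0 int) set \<Rightarrow> ('n \<times> 't \<Rightarrow>\<^sub>0 int) set"
  where "tensor_map R N T f Z =
    (\<Union>x \<in> Z. r_coset (free_Abelian_group (carrier N \<times> carrier T))
       (tensor_kernel R N T) (frag_map_left f x))"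

text \<open>
  \<open>T\<close> is flat over \<open>R\<close> if tensoring with \<open>T\<close> preserves injectivity of linear maps. A definition
  cannot quantify over all types of module elements, so the test modules have elements in
  \<open>'r list\<close>. Up to isomorphism these include all submodules of finitely generated \<open>R\<close>-modules,
  and this implies the condition for modules over an arbitrary type: see \<open>flat_module_inj\<close>.
\<close>

definition flat_module :: "('r, 'c) ring_scheme \<Rightarrow> ('r, 't, 'e) module_scheme \<Rightarrow> bool"
  where "flat_module R T \<longleftrightarrow> module R T \<and>
    (\<forall>(M :: ('r, 'r list) module) (N :: ('r, 'r list) module) f.
       module R M \<longrightarrow> module R N \<longrightarrow> f \<in> module_homs R M N \<longrightarrow> inj_on f (carrier M) \<longrightarrow>
       inj_on (tensor_map R N T f) (carrier (tensor_product R M T)))"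


subsection \<open>Flat epimorphisms, Pruefer extensions, hull and co-integral closure\<close>

text \<open>
  Epimorphism in the category of commutative rings, for an inclusion \<open>R \<subseteq> S\<close>. The subring of
  \<open>C\<close> generated by the images of two homomorphisms \<open>f\<close>, \<open>g\<close> on \<open>S\<close> consists of the finite
  sums of products \<open>f x * g y\<close>, so it is no larger than \<open>('a \<times> 'a) list\<close>; hence targets \<open>C\<close> of
  this type suffice to test against targets of arbitrary type: see \<open>epi_ext_eq\<close>.
\<close>

definition epi_ext :: "'a set \<Rightarrow> ('a, 'b) ring_scheme \<Rightarrow> bool"
  where "epi_ext R S \<longleftrightarrow>
    (\<forall>(C :: ('a \<times> 'a) list ring) f g.
       cring C \<longrightarrow> f \<in> ring_hom S C \<longrightarrow> g \<in> ring_hom S C \<longrightarrow>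
       (\<forall>x \<in> R. f x = g x) \<longrightarrow> (\<forall>x \<in> carrier S. f x = g x))"

definition ring_module :: "('a, 'b) ring_scheme \<Rightarrow> ('a, 'a) module"
  where "ring_module S =
    \<lparr>carrier = carrier S, monoid.mult = monoid.mult S, one = \<one>\<^bsub>S\<^esub>,
     ring.zero = \<zero>\<^bsub>S\<^esub>, add = add S, smult = monoid.mult S\<rparr>"

definition flat_epi_ext :: "'a set \<Rightarrow> ('a, 'b) ring_scheme \<Rightarrow> bool"
  where "flat_epi_ext R S \<longleftrightarrow> flat_module (S\<lparr>carrier := R\<rparr>) (ring_module S) \<and> epi_ext R S"

definition pruefer_ext :: "'a set \<Rightarrow> ('a, 'b) ring_scheme \<Rightarrow> bool"
  where "pruefer_ext R S \<longleftrightarrow>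
    (\<forall>T \<in> intermediate_rings R S. flat_epi_ext R (S\<lparr>carrier := T\<rparr>))"

definition pruefer_hull :: "'a set \<Rightarrow> ('a, 'b) ring_scheme \<Rightarrow> 'a set"
  where "pruefer_hull R S =
    (GREATEST T. T \<in> intermediate_rings R S \<and> pruefer_ext R (S\<lparr>carrier := T\<rparr>))"

definition co_integral_closure :: "'a set \<Rightarrow> ('a, 'b) ring_scheme \<Rightarrow> 'a set"
  where "co_integral_closure R S =
    (LEAST T. T \<in> intermediate_rings R S \<and> integral_ext T S)"


subsection \<open>Independence of the type of the test objects\<close>

lemma tensor_relators_cases [consumes 1, case_names add_left add_right smult]:
  assumes "h \<in> tensor_relators R M N"
  obtains x x' y where "h = frag_of (x \<oplus>\<^bsub>M\<^esub> x', y) - frag_of (x, y) - frag_of (x', y)"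
      "x \<in> carrier M" "x' \<in> carrier M" "y \<in> carrier N"
    | x y y' where "h = frag_of (x, y \<oplus>\<^bsub>N\<^esub> y') - frag_of (x, y) - frag_of (x, y')"
      "x \<in> carrier M" "y \<in> carrier N" "y' \<in> carrier N"
    | a x y where "h = frag_of (a \<odot>\<^bsub>M\<^esub> x, y) - frag_of (x, a \<odot>\<^bsub>N\<^esub> y)"
      "a \<in> carrier R" "x \<in> carrier M" "y \<in> carrier N"
  using assms unfolding tensor_relators_def by blast

lemma tensor_relatorsI:
  "x \<in> carrier M \<Longrightarrow> x' \<in> carrier M \<Longrightarrow> y \<in> carrier N \<Longrightarrow>
    frag_of (x \<oplus>\<^bsub>M\<^esub> x', y) - frag_of (x, y) - frag_of (x', y) \<in> tensor_relators R M N"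
  "x \<in> carrier M \<Longrightarrow> y \<in> carrier N \<Longrightarrow> y' \<in> carrier N \<Longrightarrow>
    frag_of (x, y \<oplus>\<^bsub>N\<^esub> y') - frag_of (x, y) - frag_of (x, y') \<in> tensor_relators R M N"
  "a \<in> carrier R \<Longrightarrow> x \<in> carrier M \<Longrightarrow> y \<in> carrier N \<Longrightarrow>
    frag_of (a \<odot>\<^bsub>M\<^esub> x, y) - frag_of (x, a \<odot>\<^bsub>N\<^esub> y) \<in> tensor_relators R M N"
  unfolding tensor_relators_def by blast+

lemma tensor_relators_keys:
  fixes M :: "('r, 'm, 'd) module_scheme" and N :: "('r, 'n, 'e) module_scheme"
  assumes "module R M" "module R N" "h \<in> tensor_relators R M N"
  shows "Poly_Mapping.keys h \<subseteq> carrier M \<times> carrier N"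
proof -
  interpret M: module R M by fact
  interpret N: module R N by fact
  have sub: "Poly_Mapping.keys (a - b) \<subseteq> C" if "Poly_Mapping.keys a \<subseteq> C" "Poly_Mapping.keys b \<subseteq> C"
    for a b :: "'m \<times> 'n \<Rightarrow>\<^sub>0 int" and C
    using that keys_diff[of a b] by (meson Un_least order_trans)
  from assms(3) show ?thesis
  proof (cases rule: tensor_relators_cases)
    case add_left
    show ?thesis unfolding add_left(1) by (rule sub, rule sub) (use add_left in simp_all)
  next
    case add_right
    show ?thesis unfolding add_right(1) by (rule sub, rule sub) (use add_right in simp_all)
  next
    case smult
    show ?thesis unfolding smult(1) by (rule sub) (use smult in simp_all)
  qed
qed

lemma tensor_kernel_subgroup:
  assumes "module R M" "module R N"
  shows "subgroup (tensor_kernel R M N) (free_Abelian_group (carrier M \<times> carrier N))"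
  unfolding tensor_kernel_def
  by (rule group.generate_is_subgroup) (use tensor_relators_keys[OF assms] in auto)

lemma tensor_kernel_closed:
  assumes "module R M" "module R N"
  shows "0 \<in> tensor_kernel R M N"
    and "h \<in> tensor_relators R M N \<Longrightarrow> h \<in> tensor_kernel R M N"
    and "a \<in> tensor_kernel R M N \<Longrightarrow> Poly_Mapping.keys a \<subseteq> carrier M \<times> carrier N"
    and "a \<in> tensor_kernel R M N \<Longrightarrow> - a \<in> tensor_kernel R M N"
    and "a \<in> tensor_kernel R M N \<Longrightarrow> b \<in> tensor_kernel R M N \<Longrightarrow> a + b \<in> tensor_kernel R M N"
    and "a \<in> tensor_kernel R M N \<Longrightarrow> b \<in> tensor_kernel R M N \<Longrightarrow> a - b \<in> tensor_kernel R M N"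
proof -
  let ?K = "tensor_kernel R M N"
  note sg = tensor_kernel_subgroup[OF assms]
  show z: "0 \<in> ?K" using subgroup.one_closed[OF sg] by simp
  show "h \<in> tensor_relators R M N \<Longrightarrow> h \<in> ?K"
    unfolding tensor_kernel_def by (rule generate.incl)
  show keys: "Poly_Mapping.keys a \<subseteq> carrier M \<times> carrier N" if "a \<in> ?K" for a
    using subgroup.mem_carrier[OF sg that] by simp
  show neg: "- a \<in> ?K" if "a \<in> ?K" for a
    using subgroup.m_inv_closed[OF sg that] keys[OF that] by simp
  show add: "a + b \<in> ?K" if "a \<in> ?K" "b \<in> ?K" for a b
    using subgroup.m_closed[OF sg that] by simp
  show "a - b \<in> ?K" if "a \<in> ?K" "b \<in> ?K"
    using add[OF that(1) neg[OF that(2)]] by simp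
qed

lemma tensor_kernel_induct [consumes 3, case_names zero rel neg add]:
  assumes "module R M" "module R N" "k \<in> tensor_kernel R M N"
    and "P 0" "\<And>h. h \<in> tensor_relators R M N \<Longrightarrow> P h"
    and "\<And>h. h \<in> tensor_relators R M N \<Longrightarrow> P (- h)"
    and "\<And>a b. P a \<Longrightarrow> P b \<Longrightarrow> P (a + b)"
  shows "P k"
  using assms(3) unfolding tensor_kernel_def
proof (induction rule: generate.induct)
  case (inv h)
  then show ?case using assms(6)[OF inv] tensor_relators_keys[OF assms(1,2) inv] by simp
qed (use assms in auto)

lemma frag_map_left_simps [simp]:
  "frag_map_left f 0 = 0"
  "frag_map_left f (frag_of (x, t)) = frag_of (f x, t)"
  "frag_map_left f (a + b) = frag_map_left f a + frag_map_left f b"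
  "frag_map_left f (- a) = - frag_map_left f a"
  "frag_map_left f (a - b) = frag_map_left f a - frag_map_left f b"
  by (simp_all add: frag_map_left_def frag_extend_add frag_extend_minus frag_extend_diff)

lemma frag_map_left_comp: "frag_map_left g (frag_map_left f x) = frag_map_left (g \<circ> f) x"
  by (rule frag_induction[of x UNIV]) (auto simp: frag_map_left_def[symmetric])

lemma frag_map_left_cong:
  "(\<And>m t. (m, t) \<in> Poly_Mapping.keys x \<Longrightarrow> f m = g m) \<Longrightarrow> frag_map_left f x = frag_map_left g x"
  unfolding frag_map_left_def by (rule frag_extend_eq) auto

lemma frag_map_left_id:
  assumes "\<And>m t. (m, t) \<in> Poly_Mapping.keys x \<Longrightarrow> f m = m"
  shows "frag_map_left f x = x"
proof -
  have "frag_map_left f x = frag_extend frag_of x"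
    unfolding frag_map_left_def by (rule frag_extend_eq) (use assms in auto)
  then show ?thesis by (simp flip: frag_expansion)
qed

lemma keys_frag_map_left:
  "Poly_Mapping.keys (frag_map_left f x) \<subseteq> (\<lambda>(m, t). (f m, t)) ` Poly_Mapping.keys x"
  unfolding frag_map_left_def using keys_frag_extend[of "\<lambda>(m, t). frag_of (f m, t)" x] by force

lemma module_homsD:
  assumes "f \<in> module_homs R M N"
  shows "x \<in> carrier M \<Longrightarrow> f x \<in> carrier N"
    and "x \<in> carrier M \<Longrightarrow> y \<in> carrier M \<Longrightarrow> f (x \<oplus>\<^bsub>M\<^esub> y) = f x \<oplus>\<^bsub>N\<^esub> f y"
    and "a \<in> carrier R \<Longrightarrow> x \<in> carrier M \<Longrightarrow> f (a \<odot>\<^bsub>M\<^esub> x) = a \<odot>\<^bsub>N\<^esub> f x"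
  using assms unfolding module_homs_def by auto

lemma module_homs_comp:
  "f \<in> module_homs R M N \<Longrightarrow> g \<in> module_homs R N P \<Longrightarrow> g \<circ> f \<in> module_homs R M P"
  unfolding module_homs_def by (auto simp: Pi_iff)

lemma frag_map_left_kernel:
  assumes "module R M" "module R N" "module R T" "f \<in> module_homs R M N"
    and "k \<in> tensor_kernel R M T"
  shows "frag_map_left f k \<in> tensor_kernel R N T"
proof -
  have rel: "frag_map_left f h \<in> tensor_relators R N T" if "h \<in> tensor_relators R M T" for h
    using that
  proof (cases rule: tensor_relators_cases)
    case (add_left x x' y)
    then show ?thesis
      using tensor_relatorsI(1)[of "f x" N "f x'" y T R] by (simp add: module_homsD[OF assms(4)])
  next
    case (add_right x y y')
    then show ?thesis
      using tensor_relatorsI(2)[of "f x" N y T y' R] by (simp add: module_homsD[OF assms(4)])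
  next
    case (smult a x y)
    then show ?thesis
      using tensor_relatorsI(3)[of a R "f x" N y T] by (simp add: module_homsD[OF assms(4)])
  qed
  note cl = tensor_kernel_closed[OF assms(2,3)]
  show ?thesis using assms(1,3,5)
    by (induction rule: tensor_kernel_induct) (use rel cl in auto)
qed

lemma tensor_map_coset:
  assumes "module R M" "module R N" "module R T" "f \<in> module_homs R M N"
    and x: "Poly_Mapping.keys x \<subseteq> carrier M \<times> carrier T"
  shows "tensor_map R N T f
      (r_coset (free_Abelian_group (carrier M \<times> carrier T)) (tensor_kernel R M T) x) =
    r_coset (free_Abelian_group (carrier N \<times> carrier T)) (tensor_kernel R N T) (frag_map_left f x)"
proof -
  note clM = tensor_kernel_closed[OF assms(1,3)]
  note clN = tensor_kernel_closed[OF assms(2,3)]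
  have *: "frag_map_left f k \<in> tensor_kernel R N T" if "k \<in> tensor_kernel R M T" for k
    by (rule frag_map_left_kernel[OF assms(1-4) that])
  show ?thesis
    unfolding tensor_map_def r_coset_def
    apply (auto simp flip: add.assoc)
     apply (metis * clN(5))
    using clM(1) by force
qed

lemma tensor_map_inj_iff:
  assumes "module R M" "module R N" "module R T" "f \<in> module_homs R M N"
  shows "inj_on (tensor_map R N T f) (carrier (tensor_product R M T)) \<longleftrightarrow>
    (\<forall>x. Poly_Mapping.keys x \<subseteq> carrier M \<times> carrier T \<longrightarrow>
      frag_map_left f x \<in> tensor_kernel R N T \<longrightarrow> x \<in> tensor_kernel R M T)"
    (is "?L \<longleftrightarrow> ?R")
proof -
  let ?FM = "free_Abelian_group (carrier M \<times> carrier T)"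
  let ?FN = "free_Abelian_group (carrier N \<times> carrier T)"
  let ?KM = "tensor_kernel R M T" and ?KN = "tensor_kernel R N T"
  note clM = tensor_kernel_closed[OF assms(1,3)]
  note clN = tensor_kernel_closed[OF assms(2,3)]
  have eqM: "r_coset ?FM ?KM x = r_coset ?FM ?KM y \<longleftrightarrow> x - y \<in> ?KM" for x y
  proof
    assume "r_coset ?FM ?KM x = r_coset ?FM ?KM y"
    moreover have "x \<in> r_coset ?FM ?KM x" unfolding r_coset_def using clM(1) by force
    ultimately show "x - y \<in> ?KM" unfolding r_coset_def by auto
  next
    assume *: "x - y \<in> ?KM"
    have "\<exists>h\<in>?KM. k + x = h + y" if "k \<in> ?KM" for k
      using clM(5)[OF that *] by (intro bexI[of _ "k + (x - y)"]) auto
    moreover have "\<exists>h\<in>?KM. k + y = h + x" if "k \<in> ?KM" for k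
      using clM(6)[OF that *] by (intro bexI[of _ "k - (x - y)"]) auto
    ultimately show "r_coset ?FM ?KM x = r_coset ?FM ?KM y" unfolding r_coset_def by auto
  qed
  have eqN: "r_coset ?FN ?KN x = r_coset ?FN ?KN y \<longleftrightarrow> x - y \<in> ?KN" for x y
  proof
    assume "r_coset ?FN ?KN x = r_coset ?FN ?KN y"
    moreover have "x \<in> r_coset ?FN ?KN x" unfolding r_coset_def using clN(1) by force
    ultimately show "x - y \<in> ?KN" unfolding r_coset_def by auto
  next
    assume *: "x - y \<in> ?KN"
    have "\<exists>h\<in>?KN. k + x = h + y" if "k \<in> ?KN" for k
      using clN(5)[OF that *] by (intro bexI[of _ "k + (x - y)"]) auto
    moreover have "\<exists>h\<in>?KN. k + y = h + x" if "k \<in> ?KN" for k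
      using clN(6)[OF that *] by (intro bexI[of _ "k - (x - y)"]) auto
    ultimately show "r_coset ?FN ?KN x = r_coset ?FN ?KN y" unfolding r_coset_def by auto
  qed
  note tm = tensor_map_coset[OF assms]
  have car: "carrier (tensor_product R M T) =
      r_coset ?FM ?KM ` {x. Poly_Mapping.keys x \<subseteq> carrier M \<times> carrier T}"
    unfolding tensor_product_def FactGroup_def RCOSETS_def by auto
  show ?thesis
  proof
    assume L: ?L
    show ?R
    proof (intro allI impI)
      fix x assume x: "Poly_Mapping.keys x \<subseteq> carrier M \<times> carrier T"
        and fx: "frag_map_left f x \<in> ?KN"
      have "tensor_map R N T f (r_coset ?FM ?KM x) = tensor_map R N T f (r_coset ?FM ?KM 0)"
        using fx by (simp add: tm x eqN)
      then have "r_coset ?FM ?KM x = r_coset ?FM ?KM 0"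
        using L x by (auto simp: car inj_on_def)
      then show "x \<in> ?KM" by (simp add: eqM)
    qed
  next
    assume R: ?R
    show ?L unfolding car
    proof (rule inj_onI, clarify)
      fix x y assume x: "Poly_Mapping.keys x \<subseteq> carrier M \<times> carrier T"
        and y: "Poly_Mapping.keys y \<subseteq> carrier M \<times> carrier T"
        and eq: "tensor_map R N T f (r_coset ?FM ?KM x) = tensor_map R N T f (r_coset ?FM ?KM y)"
      have "frag_map_left f (x - y) \<in> ?KN"
        using eq by (simp add: tm x y eqN)
      moreover have "Poly_Mapping.keys (x - y) \<subseteq> carrier M \<times> carrier T"
        using x y keys_diff[of x y] by blast
      ultimately show "r_coset ?FM ?KM x = r_coset ?FM ?KM y"
        using R by (auto simp: eqM)
    qed
  qed
qed

lemma tensor_kernel_finite_support: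
  assumes N: "module R N" and T: "module R T" and k: "k \<in> tensor_kernel R N T"
  shows "\<exists>A. finite A \<and> A \<subseteq> carrier N \<and>
    (\<forall>H. submodule H R N \<longrightarrow> A \<subseteq> H \<longrightarrow> k \<in> tensor_kernel R (N\<lparr>carrier := H\<rparr>) T)"
  using N T k
proof (induction rule: tensor_kernel_induct)
  case zero
  show ?case
    using tensor_kernel_closed(1)[OF submodule.submodule_is_module[OF _ N] T] by blast
next
  have support: "\<exists>A. finite A \<and> A \<subseteq> carrier N \<and>
      (\<forall>H. submodule H R N \<longrightarrow> A \<subseteq> H \<longrightarrow> h \<in> tensor_relators R (N\<lparr>carrier := H\<rparr>) T)"
    if "h \<in> tensor_relators R N T" for h
  proof -
    let ?N = "\<lambda>H. N\<lparr>carrier := H\<rparr>"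
    from that show ?thesis
    proof (cases rule: tensor_relators_cases)
      case (add_left x x' y)
      then show ?thesis
        using tensor_relatorsI(1)[of x "?N _" x' y T R] by (intro exI[of _ "{x, x'}"]) simp
    next
      case (add_right x y y')
      then show ?thesis
        using tensor_relatorsI(2)[of x "?N _" y T y' R] by (intro exI[of _ "{x}"]) simp
    next
      case (smult a x y)
      then show ?thesis
        using tensor_relatorsI(3)[of a R x "?N _" y T] by (intro exI[of _ "{x}"]) simp
    qed
  qed
  {
    case (rel h)
    then show ?case
      using support[OF rel]
        tensor_kernel_closed(2)[OF submodule.submodule_is_module[OF _ N] T] by meson
  next
    case (neg h)
    then show ?case
      using support[OF neg]
        tensor_kernel_closed(2,4)[OF submodule.submodule_is_module[OF _ N] T] by meson
  }
next
  case (add a b)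
  then obtain A B where A: "finite A" "A \<subseteq> carrier N"
      "\<And>H. submodule H R N \<Longrightarrow> A \<subseteq> H \<Longrightarrow> a \<in> tensor_kernel R (N\<lparr>carrier := H\<rparr>) T"
    and B: "finite B" "B \<subseteq> carrier N"
      "\<And>H. submodule H R N \<Longrightarrow> B \<subseteq> H \<Longrightarrow> b \<in> tensor_kernel R (N\<lparr>carrier := H\<rparr>) T"
    by blast
  show ?case
    using A B tensor_kernel_closed(5)[OF submodule.submodule_is_module[OF _ N] T]
    by (intro exI[of _ "A \<union> B"]) auto
qed

lemma finite_submodule_encoding:
  fixes R :: "('r, 'c) ring_scheme" and N :: "('r, 'n, 'd) module_scheme"
  assumes N: "module R N" and "finite A" "A \<subseteq> carrier N"
  shows "\<exists>H. submodule H R N \<and> A \<subseteq> H \<and> (\<exists>e :: 'n \<Rightarrow> 'r list. inj_on e H)"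
  using assms(2,3)
proof (induction rule: finite_induct)
  case empty
  interpret module R N by fact
  have "submodule {\<zero>\<^bsub>N\<^esub>} R N" by (rule submoduleI) auto
  then show ?case by (intro exI[of _ "{\<zero>\<^bsub>N\<^esub>}"]) auto
next
  case (insert a A)
  interpret module R N by fact
  from insert obtain H and e :: "'n \<Rightarrow> 'r list"
    where H: "submodule H R N" "A \<subseteq> H" "inj_on e H" and a: "a \<in> carrier N" by auto
  note HE = submoduleE[OF H(1)]
  have Hc: "x \<in> H \<Longrightarrow> x \<in> carrier N" for x using HE(1) by auto
  have H0: "\<zero>\<^bsub>N\<^esub> \<in> H"
    using submodule.axioms(1)[OF H(1)] subgroup.one_closed by fastforce
  define H' where "H' = {r \<odot>\<^bsub>N\<^esub> a \<oplus>\<^bsub>N\<^esub> n |r n. r \<in> carrier R \<and> n \<in> H}"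
  have "submodule H' R N"
  proof (rule submoduleI)
    show "H' \<subseteq> carrier N" unfolding H'_def using a Hc by auto
    show "\<zero>\<^bsub>N\<^esub> \<in> H'"
      unfolding H'_def using a H0 by (auto intro!: exI[of _ "\<zero>\<^bsub>R\<^esub>"] exI[of _ "\<zero>\<^bsub>N\<^esub>"])
    show sm: "r \<odot>\<^bsub>N\<^esub> x \<in> H'" if "r \<in> carrier R" "x \<in> H'" for r x
    proof -
      from that obtain s n where s: "s \<in> carrier R" "n \<in> H" "x = s \<odot>\<^bsub>N\<^esub> a \<oplus>\<^bsub>N\<^esub> n"
        unfolding H'_def by auto
      have "r \<odot>\<^bsub>N\<^esub> x = (r \<otimes>\<^bsub>R\<^esub> s) \<odot>\<^bsub>N\<^esub> a \<oplus>\<^bsub>N\<^esub> r \<odot>\<^bsub>N\<^esub> n"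
        using s that a Hc by (simp add: smult_r_distr smult_assoc1)
      then show ?thesis unfolding H'_def using s that HE(4) by blast
    qed
    show "\<ominus>\<^bsub>N\<^esub> x \<in> H'" if "x \<in> H'" for x
    proof -
      have "x \<in> carrier N" using that a Hc unfolding H'_def by auto
      then have "\<ominus>\<^bsub>N\<^esub> x = (\<ominus>\<^bsub>R\<^esub> \<one>\<^bsub>R\<^esub>) \<odot>\<^bsub>N\<^esub> x" by (simp add: smult_l_minus)
      then show ?thesis using sm[OF _ that] by simp
    qed
    show "x \<oplus>\<^bsub>N\<^esub> y \<in> H'" if "x \<in> H'" "y \<in> H'" for x y
    proof -
      from that obtain s n s' n' where s: "s \<in> carrier R" "n \<in> H" "x = s \<odot>\<^bsub>N\<^esub> a \<oplus>\<^bsub>N\<^esub> n"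
        and s': "s' \<in> carrier R" "n' \<in> H" "y = s' \<odot>\<^bsub>N\<^esub> a \<oplus>\<^bsub>N\<^esub> n'"
        unfolding H'_def by auto
      have "x \<oplus>\<^bsub>N\<^esub> y = (s \<oplus>\<^bsub>R\<^esub> s') \<odot>\<^bsub>N\<^esub> a \<oplus>\<^bsub>N\<^esub> (n \<oplus>\<^bsub>N\<^esub> n')"
        using s s' a Hc by (simp add: smult_l_distr M.a_ac)
      then show ?thesis unfolding H'_def using s s' HE(5) by blast
    qed
  qed
  moreover have "insert a A \<subseteq> H'"
  proof -
    have "a = \<one>\<^bsub>R\<^esub> \<odot>\<^bsub>N\<^esub> a \<oplus>\<^bsub>N\<^esub> \<zero>\<^bsub>N\<^esub>" using a by simp
    then have "a \<in> H'" unfolding H'_def using H0 by blast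
    moreover have "x \<in> H'" if "x \<in> A" for x
    proof -
      have "x \<in> H" using that H(2) by auto
      moreover from this have "x = \<zero>\<^bsub>R\<^esub> \<odot>\<^bsub>N\<^esub> a \<oplus>\<^bsub>N\<^esub> x" using a Hc by simp
      ultimately show ?thesis unfolding H'_def by blast
    qed
    ultimately show ?thesis by auto
  qed
  moreover have "\<exists>e :: 'n \<Rightarrow> 'r list. inj_on e H'"
  proof -
    have "\<forall>x. \<exists>p. x \<in> H' \<longrightarrow> fst p \<in> carrier R \<and> snd p \<in> H \<and> x = fst p \<odot>\<^bsub>N\<^esub> a \<oplus>\<^bsub>N\<^esub> snd p"
      unfolding H'_def by auto
    then obtain p where p: "\<And>x. x \<in> H' \<Longrightarrow>
        fst (p x) \<in> carrier R \<and> snd (p x) \<in> H \<and> x = fst (p x) \<odot>\<^bsub>N\<^esub> a \<oplus>\<^bsub>N\<^esub> snd (p x)"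
      by metis
    have "inj_on (\<lambda>x. fst (p x) # e (snd (p x))) H'"
    proof (rule inj_onI)
      fix x y assume "x \<in> H'" "y \<in> H'" "fst (p x) # e (snd (p x)) = fst (p y) # e (snd (p y))"
      then show "x = y" using p[of x] p[of y] inj_onD[OF H(3), of "snd (p x)" "snd (p y)"] by auto
    qed
    then show ?thesis by blast
  qed
  ultimately show ?case by blast
qed

definition image_module :: "('m \<Rightarrow> 'n) \<Rightarrow> ('r, 'm, 'd) module_scheme \<Rightarrow> ('r, 'n) module"
  where "image_module e M =
    (let d = inv_into (carrier M) e in
      \<lparr>carrier = e ` carrier M, monoid.mult = undefined, one = undefined,
       ring.zero = e \<zero>\<^bsub>M\<^esub>, add = (\<lambda>u v. e (d u \<oplus>\<^bsub>M\<^esub> d v)), smult = (\<lambda>a u. e (a \<odot>\<^bsub>M\<^esub> d u))\<rparr>)"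

lemma image_module:
  assumes M: "module R M" and e: "inj_on e (carrier M)"
  shows "module R (image_module e M)"
    and "e \<in> module_homs R M (image_module e M)"
    and "inv_into (carrier M) e \<in> module_homs R (image_module e M) M"
proof -
  interpret module R M by fact
  have d: "inv_into (carrier M) e (e x) = x" if "x \<in> carrier M" for x
    using that e by simp
  show "module R (image_module e M)"
  proof (rule moduleI)
    show "cring R" by (rule R.is_cring)
    show "abelian_group (image_module e M)"
    proof (rule abelian_groupI)
      fix u assume "u \<in> carrier (image_module e M)"
      then obtain x where "x \<in> carrier M" "u = e x" by (auto simp: image_module_def Let_def)
      then show "\<exists>v\<in>carrier (image_module e M).
          v \<oplus>\<^bsub>image_module e M\<^esub> u = \<zero>\<^bsub>image_module e M\<^esub>"
        by (intro bexI[of _ "e (\<ominus>\<^bsub>M\<^esub> x)"]) (auto simp: image_module_def Let_def d M.l_neg)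
    qed (auto simp: image_module_def Let_def d M.a_ac)
  qed (auto simp: image_module_def Let_def d smult_l_distr smult_r_distr smult_assoc1)
  show "e \<in> module_homs R M (image_module e M)"
    "inv_into (carrier M) e \<in> module_homs R (image_module e M) M"
    by (auto simp: module_homs_def image_module_def Let_def d)
qed

theorem flat_module_inj:
  fixes M :: "('r, 'm, 'd) module_scheme" and N :: "('r, 'n, 'e) module_scheme"
  assumes flat: "flat_module R T" and M: "module R M" and N: "module R N"
    and f: "f \<in> module_homs R M N" and inj: "inj_on f (carrier M)"
  shows "inj_on (tensor_map R N T f) (carrier (tensor_product R M T))"
proof -
  have T: "module R T" using flat unfolding flat_module_def by simp
  interpret M: module R M by fact
  interpret N: module R N by fact
  show ?thesis
    unfolding tensor_map_inj_iff[OF M N T f]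
  proof (intro allI impI)
    fix x assume x: "Poly_Mapping.keys x \<subseteq> carrier M \<times> carrier T"
      and fx: "frag_map_left f x \<in> tensor_kernel R N T"
    obtain A where A: "finite A" "A \<subseteq> carrier N"
        "\<And>H. submodule H R N \<Longrightarrow> A \<subseteq> H \<Longrightarrow> frag_map_left f x \<in> tensor_kernel R (N\<lparr>carrier := H\<rparr>) T"
      using tensor_kernel_finite_support[OF N T fx] by blast
    define B where "B = A \<union> f ` fst ` Poly_Mapping.keys x"
    have "finite B" "B \<subseteq> carrier N"
      using A x module_homsD(1)[OF f] unfolding B_def by (auto simp: subset_iff)
    then obtain H and e :: "'n \<Rightarrow> 'r list"
      where H: "submodule H R N" "B \<subseteq> H" "inj_on e H"
      using finite_submodule_encoding[OF N] by blast
    note HE = N.submoduleE[OF H(1)]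
    define G where "G = H \<inter> f ` carrier M"
    have fneg: "\<ominus>\<^bsub>N\<^esub> f m = f (\<ominus>\<^bsub>M\<^esub> m)" if "m \<in> carrier M" for m
    proof -
      have "\<ominus>\<^bsub>N\<^esub> f m = (\<ominus>\<^bsub>R\<^esub> \<one>\<^bsub>R\<^esub>) \<odot>\<^bsub>N\<^esub> f m"
        using that module_homsD(1)[OF f] by (simp add: N.smult_l_minus)
      also have "\<dots> = f ((\<ominus>\<^bsub>R\<^esub> \<one>\<^bsub>R\<^esub>) \<odot>\<^bsub>M\<^esub> m)"
        using that module_homsD(3)[OF f] by simp
      finally show ?thesis using that by (simp add: M.smult_l_minus)
    qed
    have G: "submodule G R N"
    proof (rule N.submoduleI)
      show "G \<subseteq> carrier N" using HE(1) unfolding G_def by auto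
      show neg: "\<ominus>\<^bsub>N\<^esub> a \<in> G" if "a \<in> G" for a
        using that HE(3) fneg unfolding G_def by auto
      show add: "a \<oplus>\<^bsub>N\<^esub> b \<in> G" if "a \<in> G" "b \<in> G" for a b
        using that HE(5) unfolding G_def by (auto simp flip: module_homsD(2)[OF f])
      show sm: "r \<odot>\<^bsub>N\<^esub> a \<in> G" if "r \<in> carrier R" "a \<in> G" for r a
        using that HE(4) unfolding G_def by (auto simp flip: module_homsD(3)[OF f])
      have z: "\<zero>\<^bsub>N\<^esub> = f \<zero>\<^bsub>M\<^esub>"
        using module_homsD(3)[OF f, of "\<zero>\<^bsub>R\<^esub>" "\<zero>\<^bsub>M\<^esub>"] module_homsD(1)[OF f] by simp
      have "\<zero>\<^bsub>N\<^esub> \<in> H" using submodule.axioms(1)[OF H(1)] subgroup.one_closed by fastforce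
      then show "\<zero>\<^bsub>N\<^esub> \<in> G" unfolding G_def using z by blast
    qed
    let ?P = "N\<lparr>carrier := H\<rparr>" and ?Q = "N\<lparr>carrier := G\<rparr>"
    have P: "module R ?P" and Q: "module R ?Q"
      using submodule.submodule_is_module[OF H(1) N] submodule.submodule_is_module[OF G N] by auto
    have eP: "inj_on e (carrier ?P)" and eQ: "inj_on e (carrier ?Q)"
      using H(3) by (auto simp: G_def intro: inj_on_subset)
    let ?P' = "image_module e ?P" and ?Q' = "image_module e ?Q"
    note P' = image_module[OF P eP] and Q' = image_module[OF Q eQ]
    define d where "d = inv_into (carrier ?Q) e"
    have d: "d (e n) = n" if "n \<in> G" for n
      unfolding d_def using eQ that by simp
    have incl: "id \<in> module_homs R ?Q ?P" by (auto simp: module_homs_def G_def)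
    have j: "e \<circ> (id \<circ> d) \<in> module_homs R ?Q' ?P'"
      unfolding d_def by (intro module_homs_comp[OF _ P'(2)] module_homs_comp[OF _ incl] Q'(3))
    have carQ': "carrier ?Q' = e ` G" by (simp add: image_module_def Let_def)
    have "inj_on (e \<circ> (id \<circ> d)) (carrier ?Q')"
      unfolding carQ' by (rule inj_onI) (auto simp: d)
    then have "inj_on (tensor_map R ?P' T (e \<circ> (id \<circ> d))) (carrier (tensor_product R ?Q' T))"
      using flat P'(1) Q'(1) j unfolding flat_module_def by blast
    then have ker: "z \<in> tensor_kernel R ?Q' T"
      if "Poly_Mapping.keys z \<subseteq> carrier ?Q' \<times> carrier T"
        "frag_map_left (e \<circ> (id \<circ> d)) z \<in> tensor_kernel R ?P' T" for z
      unfolding tensor_map_inj_iff[OF Q'(1) P'(1) T j] using that by blast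
    have fG: "f m \<in> G" if "(m, t) \<in> Poly_Mapping.keys x" for m t
      using that H(2) x unfolding G_def B_def by force
    define z where "z = frag_map_left (e \<circ> f) x"
    have "Poly_Mapping.keys z \<subseteq> carrier ?Q' \<times> carrier T"
      using keys_frag_map_left[of "e \<circ> f" x] fG x unfolding z_def carQ' by fastforce
    moreover have "frag_map_left (e \<circ> (id \<circ> d)) z = frag_map_left e (frag_map_left f x)"
      unfolding z_def frag_map_left_comp by (rule frag_map_left_cong) (simp add: d fG)
    moreover have "frag_map_left e (frag_map_left f x) \<in> tensor_kernel R ?P' T"
      using H(2) by (intro frag_map_left_kernel[OF P P'(1) T P'(2)] A(3) H(1)) (auto simp: B_def)
    ultimately have z: "z \<in> tensor_kernel R ?Q' T" using ker by simp
    define g where "g = inv_into (carrier M) f"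
    have g: "g (f m) = m" if "m \<in> carrier M" for m unfolding g_def using inj that by simp
    have "g \<in> module_homs R ?Q M"
      unfolding module_homs_def
      by (auto simp: G_def g simp flip: module_homsD(2,3)[OF f])
    then have "g \<circ> d \<in> module_homs R ?Q' M"
      unfolding d_def by (rule module_homs_comp[OF Q'(3)])
    then have "frag_map_left (g \<circ> d) z \<in> tensor_kernel R M T"
      using frag_map_left_kernel[OF Q'(1) M T _ z] by blast
    moreover have "frag_map_left (g \<circ> d) z = x"
      unfolding z_def frag_map_left_comp
    proof (rule frag_map_left_id)
      fix m t assume "(m, t) \<in> Poly_Mapping.keys x"
      then show "((g \<circ> d) \<circ> (e \<circ> f)) m = m" using x by (auto simp: d[OF fG] g)
    qed
    ultimately show "x \<in> tensor_kernel R M T" by simp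
  qed
qed

theorem epi_ext_eq:
  fixes S :: "('a, 'b) ring_scheme" and C :: "('c, 'd) ring_scheme"
  assumes "cring S" and epi: "epi_ext R S" and C: "cring C"
    and f: "f \<in> ring_hom S C" and g: "g \<in> ring_hom S C"
    and eq: "\<And>x. x \<in> R \<Longrightarrow> f x = g x" and x: "x \<in> carrier S"
  shows "f x = g x"
proof -
  interpret S: cring S by fact
  interpret C: cring C by fact
  have fc: "f a \<in> carrier C" "g a \<in> carrier C" if "a \<in> carrier S" for a
    using f g that by (auto intro: ring_hom_closed)
  define L where "L = lists (carrier S \<times> carrier S)"
  define h where "h = (\<lambda>us. foldr (\<lambda>(a, b) c. f a \<otimes>\<^bsub>C\<^esub> g b \<oplus>\<^bsub>C\<^esub> c) us \<zero>\<^bsub>C\<^esub>)"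
  have h_simps: "h [] = \<zero>\<^bsub>C\<^esub>" "h ((a, b) # us) = f a \<otimes>\<^bsub>C\<^esub> g b \<oplus>\<^bsub>C\<^esub> h us" for a b us
    by (auto simp: h_def)
  have hc: "h us \<in> carrier C" if "us \<in> L" for us
    using that unfolding L_def by (induction us rule: lists.induct) (auto simp: h_simps fc)
  define A where "A = h ` L"
  have A0: "\<zero>\<^bsub>C\<^esub> \<in> A" unfolding A_def L_def by (rule image_eqI[of _ _ "[]"]) (auto simp: h_simps)
  have Aone: "f a \<otimes>\<^bsub>C\<^esub> g b \<in> A" if "a \<in> carrier S" "b \<in> carrier S" for a b
    unfolding A_def L_def using that
    by (intro image_eqI[of _ _ "[(a, b)]"]) (auto simp: h_simps fc)
  have Aadd: "u \<oplus>\<^bsub>C\<^esub> v \<in> A" if "u \<in> A" "v \<in> A" for u v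
  proof -
    have "h us \<oplus>\<^bsub>C\<^esub> v \<in> A" if "us \<in> L" for us
      using that unfolding L_def
    proof (induction us rule: lists.induct)
      case Nil
      then show ?case using \<open>v \<in> A\<close> hc by (auto simp: h_simps A_def)
    next
      case (Cons p us)
      obtain a b where p: "p = (a, b)" "a \<in> carrier S" "b \<in> carrier S" using Cons by auto
      obtain ws where ws: "ws \<in> L" "h us \<oplus>\<^bsub>C\<^esub> v = h ws" using Cons by (auto simp: A_def)
      have us: "h us \<in> carrier C" using Cons hc by (simp add: L_def)
      have v: "v \<in> carrier C" using \<open>v \<in> A\<close> hc by (auto simp: A_def)
      have "h (p # us) \<oplus>\<^bsub>C\<^esub> v = f a \<otimes>\<^bsub>C\<^esub> g b \<oplus>\<^bsub>C\<^esub> (h us \<oplus>\<^bsub>C\<^esub> v)"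
        using p us v fc by (simp add: h_simps C.a_assoc)
      also have "\<dots> = h (p # ws)" by (simp add: p(1) h_simps ws(2))
      finally have "h (p # us) \<oplus>\<^bsub>C\<^esub> v = h (p # ws)" .
      moreover have "p # ws \<in> L" using p ws by (auto simp: L_def)
      ultimately show ?case by (auto simp: A_def)
    qed
    then show ?thesis using that by (auto simp: A_def)
  qed
  have Ac: "u \<in> carrier C" if "u \<in> A" for u using that hc by (auto simp: A_def)
  have Amul1: "f a \<otimes>\<^bsub>C\<^esub> g b \<otimes>\<^bsub>C\<^esub> u \<in> A" if "u \<in> A" and ab: "a \<in> carrier S" "b \<in> carrier S" for u a b
  proof -
    have "f a \<otimes>\<^bsub>C\<^esub> g b \<otimes>\<^bsub>C\<^esub> h us \<in> A" if "us \<in> L" for us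
      using that unfolding L_def
    proof (induction us rule: lists.induct)
      case Nil
      then show ?case using A0 ab fc by (simp add: h_simps)
    next
      case (Cons p us)
      obtain a' b' where p: "p = (a', b')" "a' \<in> carrier S" "b' \<in> carrier S" using Cons by auto
      have us: "h us \<in> carrier C" using Cons hc by (simp add: L_def)
      have "f a \<otimes>\<^bsub>C\<^esub> g b \<otimes>\<^bsub>C\<^esub> h (p # us) =
          f (a \<otimes>\<^bsub>S\<^esub> a') \<otimes>\<^bsub>C\<^esub> g (b \<otimes>\<^bsub>S\<^esub> b') \<oplus>\<^bsub>C\<^esub> f a \<otimes>\<^bsub>C\<^esub> g b \<otimes>\<^bsub>C\<^esub> h us"
        using p ab fc us ring_hom_mult[OF f] ring_hom_mult[OF g]
        by (simp add: h_simps C.r_distr C.m_ac)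
      then show ?case using Aadd[OF Aone Cons.IH] p ab by simp
    qed
    then show ?thesis using that by (auto simp: A_def)
  qed
  have sub: "subring A C"
  proof (rule C.subringI)
    show "A \<subseteq> carrier C" using Ac by auto
    show "\<one>\<^bsub>C\<^esub> \<in> A" using Aone[of "\<one>\<^bsub>S\<^esub>" "\<one>\<^bsub>S\<^esub>"] ring_hom_one[OF f] ring_hom_one[OF g] by simp
    show "u \<oplus>\<^bsub>C\<^esub> v \<in> A" if "u \<in> A" "v \<in> A" for u v by (rule Aadd[OF that])
    show mul: "u \<otimes>\<^bsub>C\<^esub> v \<in> A" if "u \<in> A" "v \<in> A" for u v
    proof -
      have "h us \<otimes>\<^bsub>C\<^esub> v \<in> A" if "us \<in> L" for us
        using that unfolding L_def
      proof (induction us rule: lists.induct)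
        case Nil
        then show ?case using A0 \<open>v \<in> A\<close> Ac by (simp add: h_simps)
      next
        case (Cons p us)
        obtain a b where p: "p = (a, b)" "a \<in> carrier S" "b \<in> carrier S" using Cons by auto
        have us: "h us \<in> carrier C" using Cons hc by (simp add: L_def)
        have "h (p # us) \<otimes>\<^bsub>C\<^esub> v = f a \<otimes>\<^bsub>C\<^esub> g b \<otimes>\<^bsub>C\<^esub> v \<oplus>\<^bsub>C\<^esub> h us \<otimes>\<^bsub>C\<^esub> v"
          using p fc us Ac[OF \<open>v \<in> A\<close>] by (simp add: h_simps C.l_distr)
        then show ?case using Aadd[OF Amul1[OF \<open>v \<in> A\<close>] Cons.IH] p by simp
      qed
      then show ?thesis using that by (auto simp: A_def)
    qed
    show "\<ominus>\<^bsub>C\<^esub> u \<in> A" if "u \<in> A" for u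
    proof -
      interpret F: ring_hom_cring S C f by unfold_locales (rule f)
      have "f (\<ominus>\<^bsub>S\<^esub> \<one>\<^bsub>S\<^esub>) \<otimes>\<^bsub>C\<^esub> g \<one>\<^bsub>S\<^esub> \<otimes>\<^bsub>C\<^esub> u = \<ominus>\<^bsub>C\<^esub> u"
        using Ac[OF that] ring_hom_one[OF g] by (simp add: C.l_minus)
      then show ?thesis using Amul1[OF that, of "\<ominus>\<^bsub>S\<^esub> \<one>\<^bsub>S\<^esub>" "\<one>\<^bsub>S\<^esub>"] by simp
    qed
  qed
  let ?B = "C\<lparr>carrier := A\<rparr>"
  have B: "cring ?B"
    using C.subcring_iff[of A] C.subcringI'[OF sub] Ac by auto
  define e where "e = inv_into L h"
  have e: "inj_on e (carrier ?B)"
    unfolding e_def A_def by (simp add: inj_on_inv_into)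
  let ?D = "image_ring e ?B"
  have iso: "e \<in> ring_iso ?B ?D" by (rule inj_imp_image_ring_iso[OF e])
  have D: "cring ?D"
    using cring.ring_iso_imp_img_cring[OF B iso]
    by (simp add: image_ring_def image_group_def monoid.defs)
  have fA: "f a \<in> A" "g a \<in> A" if "a \<in> carrier S" for a
    using Aone[of a "\<one>\<^bsub>S\<^esub>"] Aone[of "\<one>\<^bsub>S\<^esub>" a] that fc ring_hom_one[OF f] ring_hom_one[OF g] by auto
  have f': "f \<in> ring_hom S ?B" and g': "g \<in> ring_hom S ?B"
    using f g fA by (auto simp: ring_hom_def)
  have eh: "e \<in> ring_hom ?B ?D" using iso by (simp add: ring_iso_def)
  have "\<forall>y \<in> R. (e \<circ> f) y = (e \<circ> g) y" using eq by simp
  then have "(e \<circ> f) x = (e \<circ> g) x"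
    using epi[unfolded epi_ext_def, rule_format, OF D ring_hom_trans[OF f' eh] ring_hom_trans[OF g' eh] _ x]
    by blast
  then show ?thesis using inj_onD[OF e] fA[OF x] by simp
qed

end

theory Submission
  imports Defs
begin

text \<open>
  \<^emph>\<open>Least element.\<close> By FCP there is a minimal \<open>T\<close> with \<open>T \<subseteq> S\<close> integral, so it suffices that
  integrality of \<open>U \<subseteq> S\<close> and \<open>V \<subseteq> S\<close> implies that of \<open>W = U \<inter> V \<subseteq> S\<close>. For \<open>x \<in> U\<close> the
  descending chains \<open>T + x\<^sup>n T[t]\<close> become stationary; with Nakayama's lemma this yields
  \<open>x\<^sup>N (1 - x q) S \<subseteq> U\<close> for some \<open>N\<close> and \<open>q\<close>. Hence modulo the conductor of \<open>W\<close> in \<open>S\<close> some power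
  of each \<open>x \<in> W\<close> has a quasi-inverse, and this quasi-inverse, being integral over \<open>U\<close> and over
  \<open>V\<close>, lies in \<open>W\<close>. So modulo its conductor \<open>W\<close> is zero-dimensional. Now let \<open>A\<close> be the integral
  closure of \<open>W\<close> in \<open>S\<close>. The chain \<open>W + t\<^sup>n W[t]\<close> shows that every \<open>t \<in> S\<close> is a root of a
  polynomial over \<open>W\<close> with a coefficient \<open>-1\<close>. Its leading coefficient \<open>c\<close> satisfies \<open>c t \<in> A\<close>, and
  by zero-dimensionality the leading term can be split off, so that all coefficients multiply \<open>t\<close>
  into \<open>A\<close>; for the coefficient \<open>-1\<close> this means \<open>t \<in> A\<close>.

  \<^emph>\<open>Pruefer hull.\<close> If \<open>R \<subseteq> T\<close> is Pruefer, \<open>R \<subseteq> U\<close> and \<open>t \<in> T\<close> is integral over \<open>U\<close>, then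
  \<open>U \<subseteq> U[t]\<close> is a finite epimorphism, hence an equality. This gives \<open>T \<subseteq> U\<close> whenever \<open>U \<subseteq> S\<close> is
  integral, and for \<open>U = R\<close> that \<open>R\<close> is integrally closed in \<open>T\<close>. Conversely, under FCP, if \<open>R\<close> is
  integrally closed in \<open>T\<close>, the denominators \<open>(R : t)\<close> of each \<open>t \<in> T\<close> generate the unit ideal of
  \<open>R[t]\<close>, and so \<open>R \<subseteq> T\<close> is Pruefer. Being integrally closed passes from \<open>R \<subseteq> T\<close> and \<open>R \<subseteq> T'\<close> to
  a subring containing both, which together with FCP provides the greatest Pruefer subextension.
\<close>

section \<open>Submodules and spans over a subring\<close>

context cring
begin

lemma subring_mem: "subring K R \<Longrightarrow> a \<in> K \<Longrightarrow> a \<in> carrier R"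
  using subringE(1) by auto

lemma subring_nat_pow: "subring K R \<Longrightarrow> a \<in> K \<Longrightarrow> a [^] (n::nat) \<in> K"
  by (induction n) (simp_all add: subringE(3,6))

lemma subring_minus: "subring K R \<Longrightarrow> a \<in> K \<Longrightarrow> b \<in> K \<Longrightarrow> a \<ominus> b \<in> K"
  by (simp add: a_minus_def subringE(5,7))

definition submodule_over :: "'a set \<Rightarrow> 'a set \<Rightarrow> bool"
  where "submodule_over K N \<longleftrightarrow> N \<subseteq> carrier R \<and> \<zero> \<in> N \<and>
    (\<forall>a\<in>N. \<forall>b\<in>N. a \<oplus> b \<in> N) \<and> (\<forall>k\<in>K. \<forall>a\<in>N. k \<otimes> a \<in> N)"

lemma submodule_overI:
  assumes "N \<subseteq> carrier R" "\<zero> \<in> N"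
    and "\<And>a b. a \<in> N \<Longrightarrow> b \<in> N \<Longrightarrow> a \<oplus> b \<in> N"
    and "\<And>k a. k \<in> K \<Longrightarrow> a \<in> N \<Longrightarrow> k \<otimes> a \<in> N"
  shows "submodule_over K N"
  using assms by (simp add: submodule_over_def)

lemma submodule_overE:
  assumes "submodule_over K N"
  shows "N \<subseteq> carrier R" "a \<in> N \<Longrightarrow> a \<in> carrier R" "\<zero> \<in> N"
    and "a \<in> N \<Longrightarrow> b \<in> N \<Longrightarrow> a \<oplus> b \<in> N"
    and "k \<in> K \<Longrightarrow> a \<in> N \<Longrightarrow> k \<otimes> a \<in> N"
  using assms by (auto simp: submodule_over_def)

lemma submodule_over_minus:
  assumes K: "subring K R" and N: "submodule_over K N" and "a \<in> N"
  shows "\<ominus> a \<in> N" and "b \<in> N \<Longrightarrow> b \<ominus> a \<in> N"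
proof -
  have "\<ominus> \<one> \<otimes> a \<in> N"
    using subringE(3,5)[OF K] \<open>a \<in> N\<close> by (intro submodule_overE(5)[OF N])
  then show neg: "\<ominus> a \<in> N"
    using submodule_overE(2)[OF N \<open>a \<in> N\<close>] by (simp add: l_minus)
  show "b \<ominus> a \<in> N" if "b \<in> N"
    unfolding a_minus_def by (rule submodule_overE(4)[OF N that neg])
qed

lemma submodule_over_zero: "K \<subseteq> carrier R \<Longrightarrow> submodule_over K {\<zero>}"
  by (rule submodule_overI) auto

lemma submodule_over_subring:
  assumes "subring B R" "K \<subseteq> B"
  shows "submodule_over K B"
  using subringE[OF assms(1)] assms(2) by (intro submodule_overI) auto

lemma submodule_over_Int:
  "submodule_over K N \<Longrightarrow> submodule_over K N' \<Longrightarrow> submodule_over K (N \<inter> N')"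
  by (simp add: submodule_over_def inf.coboundedI1)

lemma submodule_over_carrier_imp_ideal:
  assumes I: "submodule_over (carrier R) I"
  shows "ideal I R"
proof (rule idealI[OF ring_axioms])
  note I_closed = submodule_overE[OF I]
  show "subgroup I (add_monoid R)"
    by (rule add.subgroupI)
      (use I_closed submodule_over_minus(1)[OF carrier_is_subring I] in \<open>auto simp flip: a_inv_def\<close>)
  show "x \<otimes> a \<in> I" "a \<otimes> x \<in> I" if "a \<in> I" "x \<in> carrier R" for a x
    using that I_closed(2,5) by (simp_all add: m_comm[of a x])
qed

definition line_extensions :: "'a set \<Rightarrow> 'a list \<Rightarrow> 'a set \<Rightarrow> 'a set"
  where "line_extensions D gs N = foldr (line_extension D) gs N"

lemma Span_eq_line_extensions: "Span D gs = line_extensions D gs {\<zero>}"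
  by (simp add: line_extensions_def)

declare Span.simps [simp del]

lemma Span_Nil [simp]: "Span D [] = {\<zero>}"
  and Span_Cons [simp]: "Span D (g # gs) = line_extension D g (Span D gs)"
  by (simp_all add: Span.simps)

lemma line_extensions_simps [simp]:
  "line_extensions D [] N = N"
  "line_extensions D (g # gs) N = line_extension D g (line_extensions D gs N)"
  by (simp_all add: line_extensions_def)

lemma line_extensions_in_carrier:
  assumes "D \<subseteq> carrier R" "N \<subseteq> carrier R" "set gs \<subseteq> carrier R"
  shows "line_extensions D gs N \<subseteq> carrier R"
  using assms(3) by (induction gs) (simp_all add: assms line_extension_in_carrier)

lemma line_extensions_smult:
  assumes "D \<subseteq> carrier R" "N \<subseteq> carrier R" "set gs \<subseteq> carrier R" and c: "c \<in> carrier R"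
    and "\<And>d. d \<in> D \<Longrightarrow> c \<otimes> d \<in> D'" "\<And>v. v \<in> N \<Longrightarrow> c \<otimes> v \<in> N'"
    and "u \<in> line_extensions D gs N"
  shows "c \<otimes> u \<in> line_extensions D' gs N'"
  using assms(3,7)
proof (induction gs arbitrary: u)
  case (Cons g gs)
  obtain d v where u: "d \<in> D" "v \<in> line_extensions D gs N" "u = d \<otimes> g \<oplus> v"
    using Cons.prems(2) by (auto simp: line_extension_mem_iff)
  have "line_extensions D gs N \<subseteq> carrier R"
    using assms(1,2) Cons.prems(1) by (intro line_extensions_in_carrier) auto
  then have "c \<otimes> u = (c \<otimes> d) \<otimes> g \<oplus> c \<otimes> v"
    using u assms(1) c Cons.prems(1) by (auto simp: r_distr m_assoc subset_iff)
  then show ?case using u(1,2) assms(5) Cons by (auto simp: line_extension_mem_iff)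
qed (use assms(6) in simp)

lemma submodule_over_line_extension:
  assumes "K \<subseteq> carrier R" "submodule_over K D" "submodule_over K N" and g: "g \<in> carrier R"
  shows "submodule_over K (line_extension D g N)"
proof (rule submodule_overI)
  note D_closed = submodule_overE[OF assms(2)] and N_closed = submodule_overE[OF assms(3)]
  show "line_extension D g N \<subseteq> carrier R"
    by (rule line_extension_in_carrier[OF D_closed(1) g N_closed(1)])
  have "\<zero> = \<zero> \<otimes> g \<oplus> \<zero>" using g by simp
  then show "\<zero> \<in> line_extension D g N"
    using D_closed(3) N_closed(3) by (metis line_extension_mem_iff)
  fix u assume "u \<in> line_extension D g N"
  then obtain d v where u: "d \<in> D" "v \<in> N" "u = d \<otimes> g \<oplus> v" by (auto simp: line_extension_mem_iff)
  show "k \<otimes> u \<in> line_extension D g N" if "k \<in> K" for k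
  proof -
    have "k \<otimes> u = (k \<otimes> d) \<otimes> g \<oplus> k \<otimes> v"
      using u D_closed(2) N_closed(2) assms(1) g that by (auto simp: r_distr m_assoc)
    then show ?thesis using u D_closed(5) N_closed(5) that by (metis line_extension_mem_iff)
  qed
  fix u' assume "u' \<in> line_extension D g N"
  then obtain d' v' where u': "d' \<in> D" "v' \<in> N" "u' = d' \<otimes> g \<oplus> v'"
    by (auto simp: line_extension_mem_iff)
  have "u \<oplus> u' = (d \<oplus> d') \<otimes> g \<oplus> (v \<oplus> v')"
    unfolding u(3) u'(3)
    using D_closed(2)[OF u(1)] D_closed(2)[OF u'(1)] N_closed(2)[OF u(2)] N_closed(2)[OF u'(2)] g
    by algebra
  then show "u \<oplus> u' \<in> line_extension D g N"
    using u u' D_closed(4) N_closed(4) by (metis line_extension_mem_iff)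
qed

lemma submodule_over_line_extensions:
  assumes "K \<subseteq> carrier R" "submodule_over K D" "submodule_over K N" "set gs \<subseteq> carrier R"
  shows "submodule_over K (line_extensions D gs N)"
  using assms(4) by (induction gs) (simp_all add: assms(1-3) submodule_over_line_extension)

lemma subset_line_extension:
  assumes "\<zero> \<in> D" "g \<in> carrier R" "E \<subseteq> carrier R"
  shows "E \<subseteq> line_extension D g E"
proof
  fix v assume "v \<in> E"
  then have "v = \<zero> \<otimes> g \<oplus> v" using assms(2,3) by auto
  then show "v \<in> line_extension D g E"
    unfolding line_extension_mem_iff using assms(1) \<open>v \<in> E\<close> by blast
qed

lemma subset_line_extensions:
  assumes "\<zero> \<in> D" "D \<subseteq> carrier R" "N \<subseteq> carrier R" "set gs \<subseteq> carrier R"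
  shows "N \<subseteq> line_extensions D gs N"
  using assms(4)
proof (induction gs)
  case (Cons g gs)
  then show ?case
    using subset_line_extension[OF assms(1) _ line_extensions_in_carrier[OF assms(2,3)], of g gs]
    by auto
qed simp

lemma mem_line_extensionsI:
  assumes "K \<subseteq> carrier R" "submodule_over K D" "submodule_over K N" "set gs \<subseteq> carrier R"
    and g: "g \<in> carrier R" and v: "v \<in> Span D gs" and diff: "g \<ominus> v \<in> N"
  shows "g \<in> line_extensions D gs N"
proof -
  note D = submodule_overE[OF assms(2)] and N = submodule_overE[OF assms(3)]
  have "v \<in> carrier R" using Span_in_carrier[OF D(1) assms(4)] v by blast
  have "\<one> \<otimes> v \<in> line_extensions D gs N"
    using v[unfolded Span_eq_line_extensions] D(1,2) N(3) assms(4)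
    by (intro line_extensions_smult[of D "{\<zero>}" gs \<one>]) auto
  moreover have "g \<ominus> v \<in> line_extensions D gs N"
    using subset_line_extensions[OF D(3,1) N(1) assms(4)] diff by blast
  ultimately have "(g \<ominus> v) \<oplus> v \<in> line_extensions D gs N"
    using submodule_overE(4)[OF submodule_over_line_extensions[OF assms(1-4)]] \<open>v \<in> carrier R\<close>
    by simp
  then show ?thesis using g \<open>v \<in> carrier R\<close> by (simp add: a_minus_def a_assoc l_neg)
qed

lemma submodule_over_multiples:
  assumes "subring K R" "x \<in> carrier R"
  shows "submodule_over K ((\<otimes>) x ` K)"
proof (rule submodule_overI)
  note K_closed = subringE[OF assms(1)] and K_carrier = subring_mem[OF assms(1)]
  show "\<zero> \<in> (\<otimes>) x ` K" using K_closed(2) assms(2) by (intro image_eqI[of _ _ \<zero>]) auto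
  show "a \<oplus> b \<in> (\<otimes>) x ` K" if "a \<in> (\<otimes>) x ` K" "b \<in> (\<otimes>) x ` K" for a b
    using that K_closed(7) K_carrier assms(2) by (auto simp flip: r_distr)
  show "k \<otimes> a \<in> (\<otimes>) x ` K" if "k \<in> K" "a \<in> (\<otimes>) x ` K" for k a
    using that K_closed(6) K_carrier assms(2) by (auto simp: m_lcomm[of k x])
qed (use assms subringE(1) in auto)

lemma submodule_over_Span:
  assumes "subring K R" "submodule_over K I" "set gs \<subseteq> carrier R"
  shows "submodule_over K (Span I gs)"
  unfolding Span_eq_line_extensions
  using assms subringE(1) by (intro submodule_over_line_extensions submodule_over_zero) auto

lemma Span_incl:
  assumes "subring K R" "set gs \<subseteq> carrier R"
  shows "set gs \<subseteq> Span K gs"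
  using assms(2)
proof (induction gs)
  case (Cons g gs)
  note K_closed = subringE[OF assms(1)]
  have S: "submodule_over K (Span K gs)"
    using Cons.prems assms(1) by (intro submodule_over_Span submodule_over_subring) auto
  have "g = \<one> \<otimes> g \<oplus> \<zero>" using Cons.prems by simp
  then have "g \<in> line_extension K g (Span K gs)"
    using K_closed(3) submodule_overE(3)[OF S] by (metis line_extension_mem_iff)
  moreover have "Span K gs \<subseteq> line_extension K g (Span K gs)"
    using Cons.prems by (intro subset_line_extension K_closed(2) submodule_overE(1)[OF S]) auto
  ultimately show ?case using Cons by auto
qed simp

lemma line_extensions_subsetI:
  assumes "submodule_over K M" "N \<subseteq> M" "\<And>d g. d \<in> D \<Longrightarrow> g \<in> set gs \<Longrightarrow> d \<otimes> g \<in> M"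
  shows "line_extensions D gs N \<subseteq> M"
  using assms(3)
proof (induction gs)
  case (Cons g gs)
  then have "line_extensions D gs N \<subseteq> M" by simp
  then show ?case
    using Cons.prems submodule_overE(4)[OF assms(1)]
    by (auto simp: line_extension_mem_iff subset_iff)
qed (use assms(2) in simp)

lemma Span_subsetI:
  assumes "submodule_over K M" "\<And>d g. d \<in> D \<Longrightarrow> g \<in> set gs \<Longrightarrow> d \<otimes> g \<in> M"
  shows "Span D gs \<subseteq> M"
  unfolding Span_eq_line_extensions
  using submodule_overE(3)[OF assms(1)] assms by (intro line_extensions_subsetI) auto

lemma Span_least: "submodule_over K N \<Longrightarrow> set gs \<subseteq> N \<Longrightarrow> Span K gs \<subseteq> N"
  by (rule Span_subsetI) (auto intro: submodule_overE(5))

lemma Span_singleton_one: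
  assumes "subring K R"
  shows "Span K [\<one>] = K"
  using subring_mem[OF assms] by (force simp: line_extension_mem_iff)

lemma Span_Span_subset:
  assumes K: "subring K R" and gs: "set gs \<subseteq> carrier R" and hs: "set hs \<subseteq> carrier R"
  shows "Span (Span K gs) hs \<subseteq> Span K [g \<otimes> h. h \<leftarrow> hs, g \<leftarrow> gs]"
proof -
  let ?ps = "[g \<otimes> h. h \<leftarrow> hs, g \<leftarrow> gs]"
  have ps: "set ?ps \<subseteq> carrier R" using gs hs by auto
  have S: "submodule_over K (Span K ?ps)"
    by (rule submodule_over_Span[OF K submodule_over_subring[OF K subset_refl] ps])
  have "u \<otimes> h \<in> Span K ?ps" if h: "h \<in> set hs" and u: "u \<in> Span K gs" for u h
  proof -
    let ?N = "{u \<in> carrier R. u \<otimes> h \<in> Span K ?ps}"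
    have "h \<in> carrier R" using h hs by auto
    then have "submodule_over K ?N"
      using submodule_overE[OF S] subring_mem[OF K]
      by (intro submodule_overI) (auto simp: l_distr m_assoc)
    moreover have "set gs \<subseteq> ?N" using Span_incl[OF K ps] gs h by auto
    ultimately show ?thesis using Span_least[of K ?N gs] u by blast
  qed
  then show ?thesis by (rule Span_subsetI[OF S])
qed

section \<open>Simple extensions and integral elements\<close>

definition poly_span :: "'a set \<Rightarrow> 'a \<Rightarrow> nat \<Rightarrow> 'a set"
  where "poly_span K t m = Span K (exp_base t m)"

lemma poly_span_0 [simp]: "poly_span K t 0 = {\<zero>}"
  by (simp add: poly_span_def exp_base_def)

lemma poly_span_Suc: "poly_span K t (Suc m) = line_extension K (t [^] m) (poly_span K t m)"
  by (simp add: poly_span_def exp_base_def)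

lemma poly_span_SucI: "a \<in> K \<Longrightarrow> n \<in> poly_span K t m \<Longrightarrow> a \<otimes> t [^] m \<oplus> n \<in> poly_span K t (Suc m)"
  by (auto simp: poly_span_Suc line_extension_mem_iff)

lemma poly_span_SucE:
  assumes "y \<in> poly_span K t (Suc m)"
  obtains a n where "a \<in> K" "n \<in> poly_span K t m" "y = a \<otimes> t [^] m \<oplus> n"
  using assms by (auto simp: poly_span_Suc line_extension_mem_iff)

lemma poly_span_eq_eval: "poly_span K t m = {eval p t |p. set p \<subseteq> K \<and> length p = m}"
proof (induction m)
  case (Suc m)
  show ?case
  proof (intro equalityI subsetI)
    fix y assume "y \<in> poly_span K t (Suc m)"
    then obtain a p where "a \<in> K" "y = a \<otimes> t [^] m \<oplus> eval p t" "set p \<subseteq> K" "length p = m"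
      using Suc by (auto elim!: poly_span_SucE)
    then show "y \<in> {eval p t |p. set p \<subseteq> K \<and> length p = Suc m}"
      by (intro CollectI exI[of _ "a # p"]) auto
  next
    fix y assume "y \<in> {eval p t |p. set p \<subseteq> K \<and> length p = Suc m}"
    then obtain p where "y = eval p t" "set p \<subseteq> K" "length p = Suc m" by auto
    then show "y \<in> poly_span K t (Suc m)"
      using Suc by (cases p) (auto intro!: poly_span_SucI)
  qed
qed auto

context
  fixes K t assumes K: "subring K R" and t: "t \<in> carrier R"
begin

lemma submodule_over_poly_span: "submodule_over K (poly_span K t m)"
  unfolding poly_span_def
  using submodule_over_Span[OF K submodule_over_subring[OF K subset_refl] exp_base_closed[OF t]] .

lemmas poly_span_carrier = submodule_overE(2)[OF submodule_over_poly_span]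
  and poly_span_zero = submodule_overE(3)[OF submodule_over_poly_span]
  and poly_span_add = submodule_overE(4)[OF submodule_over_poly_span]
  and poly_span_smult = submodule_overE(5)[OF submodule_over_poly_span]
  and poly_span_neg = submodule_over_minus(1)[OF K submodule_over_poly_span]

lemma poly_span_mono: "m \<le> n \<Longrightarrow> poly_span K t m \<subseteq> poly_span K t n"
proof (induction rule: dec_induct)
  case (step n)
  have "y \<in> poly_span K t (Suc n)" if "y \<in> poly_span K t n" for y
    using poly_span_SucI[OF subringE(2)[OF K] that] poly_span_carrier[OF that] t by simp
  then show ?case using step by auto
qed simp

lemma poly_span_1: "poly_span K t 1 = K"
  using Span_singleton_one[OF K] by (simp add: poly_span_def exp_base_def)

lemma subset_poly_span_Suc: "K \<subseteq> poly_span K t (Suc m)"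
  using poly_span_mono[of 1 "Suc m"] poly_span_1 by simp

lemma poly_span_times_gen: "y \<in> poly_span K t m \<Longrightarrow> t \<otimes> y \<in> poly_span K t (Suc m)"
proof (induction m arbitrary: y)
  case 0
  then show ?case using poly_span_zero[of 1] t by simp
next
  case (Suc m)
  obtain a n where y: "a \<in> K" "n \<in> poly_span K t m" "y = a \<otimes> t [^] m \<oplus> n"
    using Suc.prems by (rule poly_span_SucE)
  have "t \<otimes> y = a \<otimes> t [^] Suc m \<oplus> t \<otimes> n"
    unfolding y(3) using subring_mem[OF K y(1)] poly_span_carrier[OF y(2)] t
    by (simp add: r_distr m_ac)
  then show ?case using poly_span_SucI[OF y(1) Suc.IH[OF y(2)]] by simp
qed

lemma poly_span_times_pow: "y \<in> poly_span K t m \<Longrightarrow> t [^] (k::nat) \<otimes> y \<in> poly_span K t (k + m)"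
proof (induction k)
  case (Suc k)
  have "t [^] Suc k \<otimes> y = t \<otimes> (t [^] k \<otimes> y)"
    using t poly_span_carrier[OF Suc.prems] by (simp add: m_ac)
  then show ?case using poly_span_times_gen[OF Suc.IH[OF Suc.prems]] by simp
qed (simp add: poly_span_carrier)

lemma poly_span_mult:
  "y \<in> poly_span K t m \<Longrightarrow> z \<in> poly_span K t k \<Longrightarrow> y \<otimes> z \<in> poly_span K t (m + k)"
proof (induction m arbitrary: y)
  case 0
  then show ?case using poly_span_zero poly_span_carrier[of z] by simp
next
  case (Suc m)
  obtain a n where y: "a \<in> K" "n \<in> poly_span K t m" "y = a \<otimes> t [^] m \<oplus> n"
    using Suc.prems(1) by (rule poly_span_SucE)
  have "y \<otimes> z = a \<otimes> (t [^] m \<otimes> z) \<oplus> n \<otimes> z"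
    unfolding y(3) using subring_mem[OF K y(1)] poly_span_carrier[OF y(2)] t
      poly_span_carrier[OF Suc.prems(2)] by (simp add: l_distr m_assoc)
  moreover have "a \<otimes> (t [^] m \<otimes> z) \<oplus> n \<otimes> z \<in> poly_span K t (m + k)"
    using Suc.prems(2) y by (intro poly_span_add poly_span_smult poly_span_times_pow Suc.IH)
  ultimately show ?case using poly_span_mono[of "m + k" "Suc m + k"] by auto
qed

lemma simple_extension_eq_poly_span: "simple_extension K t = (\<Union>m. poly_span K t m)"
proof -
  have "y \<in> (\<Union>m. poly_span K t m)" if "y \<in> simple_extension K t" for y
    using that
  proof (induction rule: simple_extension.induct)
    case (lin y a)
    then obtain m where m: "y \<in> poly_span K t m" by auto
    have "t \<otimes> y \<oplus> a \<in> poly_span K t (Suc m)"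
      using poly_span_times_gen[OF m] subset_poly_span_Suc lin(2) by (intro poly_span_add) auto
    then show ?case using t poly_span_carrier[OF m] by (auto simp: m_comm)
  qed (use poly_span_zero in blast)
  moreover have "eval p t \<in> simple_extension K t" if "set p \<subseteq> K" for p
    using that
  proof (induction p rule: rev_induct)
    case (snoc a p)
    then have "eval (p @ [a]) t = eval p t \<otimes> t \<oplus> a"
      using eval_append_aux[of p a t] subring_mem[OF K] t by auto
    then show ?case using snoc simple_extension.lin[of "eval p t" K t a] by auto
  qed auto
  ultimately show ?thesis by (auto simp: poly_span_eq_eval)
qed

lemma simple_extension_subring: "subring (simple_extension K t) R"
proof (rule subringI)
  note eq = simple_extension_eq_poly_span
  show "simple_extension K t \<subseteq> carrier R" using poly_span_carrier by (auto simp: eq)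
  show "\<one> \<in> simple_extension K t" using subringE(3)[OF K] poly_span_1 by (auto simp: eq)
  show "\<ominus> y \<in> simple_extension K t" if "y \<in> simple_extension K t" for y
    using that poly_span_neg by (auto simp: eq)
  fix y z assume "y \<in> simple_extension K t" "z \<in> simple_extension K t"
  then obtain m n where yz: "y \<in> poly_span K t m" "z \<in> poly_span K t n" by (auto simp: eq)
  have "poly_span K t m \<subseteq> poly_span K t (m + n)" "poly_span K t n \<subseteq> poly_span K t (m + n)"
    by (simp_all add: poly_span_mono)
  then show "y \<otimes> z \<in> simple_extension K t" "y \<oplus> z \<in> simple_extension K t"
    using yz poly_span_mult[OF yz] poly_span_add[of y "m + n" z] by (auto simp: eq)
qed

lemma integral_over_iff_poly_span:
  "integral_over K R t \<longleftrightarrow> (\<exists>m. t [^] (m::nat) \<in> poly_span K t m)"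
proof -
  have root: "eval (\<one> # p) t = \<zero> \<longleftrightarrow> \<ominus> (t [^] length p) = eval p t" if "set p \<subseteq> K" for p
  proof -
    have "eval p t \<in> carrier R" using subringE(1)[OF K] that t by (intro eval_in_carrier) auto
    then show ?thesis
      using minus_equality[of "eval p t" "t [^] length p"] l_neg[of "t [^] length p"] t
      by (auto simp: a_comm)
  qed
  have "integral_over K R t \<longleftrightarrow> (\<exists>m. \<ominus> (t [^] (m::nat)) \<in> poly_span K t m)"
    unfolding integral_over_def poly_span_eq_eval by (auto simp del: eval.simps simp: root)
  also have "\<dots> \<longleftrightarrow> (\<exists>m. t [^] (m::nat) \<in> poly_span K t m)"
  proof -
    have "\<ominus> (t [^] m) \<in> poly_span K t m \<longleftrightarrow> t [^] m \<in> poly_span K t m" for m :: nat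
      using poly_span_neg[of "t [^] m" m] poly_span_neg[of "\<ominus> (t [^] m)" m] t by auto
    then show ?thesis by simp
  qed
  finally show ?thesis .
qed

lemma integral_overE:
  assumes "integral_over K R t"
  obtains m :: nat where "t [^] Suc m \<in> poly_span K t (Suc m)"
proof -
  obtain m :: nat where "t [^] m \<in> poly_span K t m"
    using assms integral_over_iff_poly_span by blast
  from poly_span_times_gen[OF this] show ?thesis using t by (intro that) (simp add: m_comm)
qed

lemma simple_extension_integral:
  assumes m: "t [^] (m::nat) \<in> poly_span K t m"
  shows "simple_extension K t = poly_span K t m"
proof -
  have sub: "poly_span K t (Suc m) \<subseteq> poly_span K t m"
    using poly_span_smult[OF _ m] poly_span_add by (auto elim!: poly_span_SucE)
  have "y \<in> poly_span K t m" if "y \<in> simple_extension K t" for y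
    using that
  proof (induction rule: simple_extension.induct)
    case (lin y a)
    have "t \<otimes> y \<oplus> a \<in> poly_span K t m"
      using poly_span_times_gen[OF lin(3)] subset_poly_span_Suc sub lin(2)
      by (intro poly_span_add) auto
    then show ?case using t poly_span_carrier[OF lin(3)] by (auto simp: m_comm)
  qed (rule poly_span_zero)
  then show ?thesis using simple_extension_eq_poly_span by auto
qed

lemma integral_over_if_nat_pow_mem:
  assumes "t [^] Suc n \<in> K"
  shows "integral_over K R t"
  using assms subset_poly_span_Suc integral_over_iff_poly_span by blast

lemma poly_span_scale:
  assumes c: "c \<in> K"
  shows "y \<in> poly_span K t (Suc m) \<Longrightarrow> c [^] m \<otimes> y \<in> poly_span K (c \<otimes> t) (Suc m)"
proof (induction m arbitrary: y)
  case 0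
  then show ?case
    using poly_span_1 Span_singleton_one[OF K] subring_mem[OF K]
    by (simp add: poly_span_def exp_base_def)
next
  case (Suc m)
  have ct: "c \<otimes> t \<in> carrier R" using subring_mem[OF K c] t by simp
  obtain a n where y: "a \<in> K" "n \<in> poly_span K t (Suc m)" "y = a \<otimes> t [^] Suc m \<oplus> n"
    using Suc.prems by (rule poly_span_SucE)
  have "c [^] Suc m \<otimes> y = a \<otimes> (c \<otimes> t) [^] Suc m \<oplus> c \<otimes> (c [^] m \<otimes> n)"
    unfolding y(3)
    using subring_mem[OF K y(1)] subring_mem[OF K c] poly_span_carrier[OF y(2)] t
    by (simp add: r_distr m_ac nat_pow_distrib)
  moreover have "c \<otimes> (c [^] m \<otimes> n) \<in> poly_span K (c \<otimes> t) (Suc m)"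
    using submodule_overE(5)[OF submodule_over_Span[OF K submodule_over_subring[OF K subset_refl]
          exp_base_closed[OF ct]] c] Suc.IH[OF y(2)] by (simp add: poly_span_def)
  ultimately show ?case using poly_span_SucI[OF y(1)] by metis
qed

end

text \<open>A leading coefficient: \<open>c t\<^sup>m\<^sup>+\<^sup>1 = a\<^sub>m t\<^sup>m + \<dots> + a\<^sub>0\<close> becomes monic in \<open>c t\<close> after
  multiplication by \<open>c\<^sup>m\<close>.\<close>

lemma integral_over_leading_coeff:
  assumes K: "subring K R" and t: "t \<in> carrier R" and c: "c \<in> K"
    and rel: "c \<otimes> t [^] Suc m \<in> poly_span K t (Suc m)"
  shows "integral_over K R (c \<otimes> t)"
proof -
  have c_carrier: "c \<in> carrier R" by (rule subring_mem[OF K c])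
  have "(c \<otimes> t) [^] Suc m = c [^] m \<otimes> (c \<otimes> t [^] Suc m)"
    using c_carrier t by (simp add: nat_pow_distrib m_ac)
  then show ?thesis
    using poly_span_scale[OF K t c rel] integral_over_iff_poly_span[OF K] c_carrier t
    by (metis m_closed)
qed

lemma integral_over_smult:
  assumes K: "subring K R" and t: "t \<in> carrier R" and c: "c \<in> K" and int: "integral_over K R t"
  shows "integral_over K R (c \<otimes> t)"
proof -
  obtain m where "t [^] Suc m \<in> poly_span K t (Suc m)" using integral_overE[OF K t int] .
  then show ?thesis
    by (intro integral_over_leading_coeff[OF K t c] poly_span_smult[OF K t c])
qed

end

lemma integral_over_mono: "integral_over R S x \<Longrightarrow> R \<subseteq> T \<Longrightarrow> integral_over T S x"
  unfolding integral_over_def by (meson subset_trans)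

section \<open>Elimination: Nakayama's lemma and integrality of stable elements\<close>

text \<open>
  Gaussian elimination for a system \<open>a g\<^sub>i \<in> \<Sum>\<^sub>j \<Delta> g\<^sub>j + N\<close> whose diagonal is monic relative to
  the other coefficients: the entries \<open>s\<^sup>k - d\<close> with \<open>d \<in> \<Delta> k\<close> never have to be inverted. With
  \<open>s = \<one>\<close> and \<open>\<Delta> k\<close> an ideal this gives Nakayama's lemma, and with \<open>\<Delta> k\<close> the polynomials in
  \<open>s\<close> of degree less than \<open>k\<close> it gives monic equations for \<open>s\<close>.
\<close>

locale graded_multipliers = cring R for R (structure) +
  fixes K :: "'a set" and s :: 'a and \<Delta> :: "nat \<Rightarrow> 'a set" and N :: "'a set"
  assumes K: "subring K R" and s: "s \<in> carrier R"
    and submodule_\<Delta>: "submodule_over K (\<Delta> k)"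
    and \<Delta>_mult: "d \<in> \<Delta> j \<Longrightarrow> e \<in> \<Delta> k \<Longrightarrow> d \<otimes> e \<in> \<Delta> (j + k)"
    and \<Delta>_smult: "d \<in> \<Delta> k \<Longrightarrow> s \<otimes> d \<in> \<Delta> (Suc k)"
    and submodule_N: "submodule_over K N"
    and N_smult: "v \<in> N \<Longrightarrow> s \<otimes> v \<in> N"
    and N_\<Delta>: "d \<in> \<Delta> k \<Longrightarrow> v \<in> N \<Longrightarrow> d \<otimes> v \<in> N"
begin

definition multipliers :: "nat \<Rightarrow> 'a set"
  where "multipliers k = {s [^] k \<ominus> d |d. d \<in> \<Delta> k}"

lemma \<Delta>_carrier: "d \<in> \<Delta> k \<Longrightarrow> d \<in> carrier R"
  by (rule submodule_overE(2)[OF submodule_\<Delta>])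

lemma N_carrier: "v \<in> N \<Longrightarrow> v \<in> carrier R"
  by (rule submodule_overE(2)[OF submodule_N])

lemma multipliers_carrier: "a \<in> multipliers k \<Longrightarrow> a \<in> carrier R"
  using s \<Delta>_carrier by (auto simp: multipliers_def)

lemma \<Delta>_nat_pow: "d \<in> \<Delta> k \<Longrightarrow> s [^] (j::nat) \<otimes> d \<in> \<Delta> (j + k)"
proof (induction j)
  case (Suc j)
  have "s [^] Suc j \<otimes> d = s \<otimes> (s [^] j \<otimes> d)"
    using s \<Delta>_carrier[OF Suc.prems] by (simp add: m_ac)
  then show ?case using \<Delta>_smult[OF Suc.IH[OF Suc.prems]] by simp
qed (simp add: \<Delta>_carrier)

lemma N_nat_pow: "v \<in> N \<Longrightarrow> s [^] (j::nat) \<otimes> v \<in> N"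
proof (induction j)
  case (Suc j)
  have "s [^] Suc j \<otimes> v = s \<otimes> (s [^] j \<otimes> v)"
    using s N_carrier[OF Suc.prems] by (simp add: m_ac)
  then show ?case using N_smult[OF Suc.IH[OF Suc.prems]] by simp
qed (simp add: N_carrier)

lemma multipliers_\<Delta>:
  assumes "a \<in> multipliers j" "d \<in> \<Delta> k"
  shows "a \<otimes> d \<in> \<Delta> (j + k)"
proof -
  obtain e where e: "e \<in> \<Delta> j" "a = s [^] j \<ominus> e" using assms(1) by (auto simp: multipliers_def)
  have "a \<otimes> d = s [^] j \<otimes> d \<ominus> e \<otimes> d"
    unfolding e(2) using s \<Delta>_carrier e(1) assms(2) by (simp add: a_minus_def l_distr l_minus)
  then show ?thesis
    using submodule_over_minus(2)[OF K submodule_\<Delta> \<Delta>_mult[OF e(1) assms(2)] \<Delta>_nat_pow[OF assms(2)]]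
    by simp
qed

lemma multipliers_N:
  assumes "a \<in> multipliers k" "v \<in> N"
  shows "a \<otimes> v \<in> N"
proof -
  obtain d where d: "d \<in> \<Delta> k" "a = s [^] k \<ominus> d" using assms(1) by (auto simp: multipliers_def)
  have "a \<otimes> v = s [^] k \<otimes> v \<ominus> d \<otimes> v"
    unfolding d(2) using s \<Delta>_carrier[OF d(1)] N_carrier[OF assms(2)]
    by (simp add: a_minus_def l_distr l_minus)
  then show ?thesis
    using submodule_over_minus(2)[OF K submodule_N N_\<Delta>[OF d(1) assms(2)] N_nat_pow[OF assms(2)]]
    by simp
qed

lemma multipliers_diff:
  assumes "a \<in> multipliers k" "d \<in> \<Delta> k"
  shows "a \<ominus> d \<in> multipliers k"
proof -
  obtain e where e: "e \<in> \<Delta> k" "a = s [^] k \<ominus> e" using assms(1) by (auto simp: multipliers_def)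
  have "a \<ominus> d = s [^] k \<ominus> (e \<oplus> d)"
    unfolding e(2) using s \<Delta>_carrier[OF e(1)] \<Delta>_carrier[OF assms(2)]
    by (simp add: a_minus_def minus_add a_assoc)
  then show ?thesis
    using submodule_overE(4)[OF submodule_\<Delta> e(1) assms(2)] by (auto simp: multipliers_def)
qed

lemma multipliers_mult:
  assumes "a \<in> multipliers j" "b \<in> multipliers k"
  shows "a \<otimes> b \<in> multipliers (j + k)"
proof -
  obtain d e where d: "d \<in> \<Delta> j" "a = s [^] j \<ominus> d" and e: "e \<in> \<Delta> k" "b = s [^] k \<ominus> e"
    using assms by (auto simp: multipliers_def)
  note in_carrier = \<Delta>_carrier[OF d(1)] \<Delta>_carrier[OF e(1)] s
  have "a \<otimes> b = s [^] (j + k) \<ominus> s [^] k \<otimes> d \<ominus> a \<otimes> e"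
    unfolding d(2) e(2) using in_carrier
    by (simp add: a_minus_def l_distr r_distr l_minus r_minus minus_add a_ac m_ac
      flip: nat_pow_mult)
  moreover have "s [^] (j + k) \<in> multipliers (j + k)"
    using submodule_overE(3)[OF submodule_\<Delta>] s by (force simp: multipliers_def a_minus_def)
  moreover have "s [^] k \<otimes> d \<in> \<Delta> (j + k)" using \<Delta>_nat_pow[OF d(1), of k] by (simp add: add.commute)
  ultimately show ?thesis using multipliers_diff multipliers_\<Delta>[OF assms(1) e(1)] by metis
qed

lemma submodule_over_extensions:
  "set gs \<subseteq> carrier R \<Longrightarrow> submodule_over K (line_extensions (\<Delta> k) gs N)"
  using subringE(1)[OF K] by (intro submodule_over_line_extensions submodule_\<Delta> submodule_N)

lemma multipliers_extensions:
  assumes gs: "set gs \<subseteq> carrier R" and c: "c \<in> multipliers m" "\<And>g. g \<in> set gs \<Longrightarrow> c \<otimes> g \<in> N"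
    and v: "v \<in> line_extensions (\<Delta> k) gs N"
  shows "c \<otimes> v \<in> N"
proof -
  let ?M = "{v \<in> carrier R. c \<otimes> v \<in> N}"
  note c_carrier = multipliers_carrier[OF c(1)]
  have "submodule_over K ?M"
    using submodule_overE[OF submodule_N] subring_mem[OF K] c_carrier
    by (intro submodule_overI) (auto simp: r_distr m_lcomm)
  moreover have "N \<subseteq> ?M" using multipliers_N[OF c(1)] N_carrier by auto
  moreover have "d \<otimes> g \<in> ?M" if d: "d \<in> \<Delta> k" and g: "g \<in> set gs" for d g
  proof -
    have "g \<in> carrier R" using g gs by auto
    then have "c \<otimes> (d \<otimes> g) = d \<otimes> (c \<otimes> g)" using c_carrier \<Delta>_carrier[OF d] by (simp add: m_lcomm)
    then show ?thesis using N_\<Delta>[OF d c(2)[OF g]] \<Delta>_carrier[OF d] \<open>g \<in> carrier R\<close> by simp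
  qed
  ultimately have "line_extensions (\<Delta> k) gs N \<subseteq> ?M" by (rule line_extensions_subsetI)
  then show ?thesis using v by auto
qed

lemma eliminate_generator:
  assumes gs: "g \<in> carrier R" "set gs \<subseteq> carrier R"
    and a: "a \<in> multipliers k" "a \<otimes> g \<in> line_extensions (\<Delta> k) gs N"
    and b: "b \<in> multipliers k" "b \<otimes> h \<in> line_extensions (\<Delta> k) (g # gs) N" and h: "h \<in> carrier R"
  shows "(a \<otimes> b) \<otimes> h \<in> line_extensions (\<Delta> (k + k)) gs N"
proof -
  obtain e w where e: "e \<in> \<Delta> k" "w \<in> line_extensions (\<Delta> k) gs N" "b \<otimes> h = e \<otimes> g \<oplus> w"
    using b(2) by (auto simp: line_extension_mem_iff)
  note \<Delta>_sub = submodule_overE(1)[OF submodule_\<Delta>] and N_sub = submodule_overE(1)[OF submodule_N]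
    and extensions = submodule_over_extensions[OF gs(2)]
    and a_carrier = multipliers_carrier[OF a(1)]
  have "(a \<otimes> b) \<otimes> h = a \<otimes> (b \<otimes> h)"
    using a_carrier multipliers_carrier[OF b(1)] h by (simp add: m_assoc)
  also have "\<dots> = e \<otimes> (a \<otimes> g) \<oplus> a \<otimes> w"
    unfolding e(3) using a_carrier \<Delta>_carrier[OF e(1)] submodule_overE(2)[OF extensions e(2)] gs(1)
    by (simp add: r_distr m_lcomm)
  finally have "(a \<otimes> b) \<otimes> h = e \<otimes> (a \<otimes> g) \<oplus> a \<otimes> w" .
  moreover have "e \<otimes> (a \<otimes> g) \<in> line_extensions (\<Delta> (k + k)) gs N"
    by (rule line_extensions_smult[OF \<Delta>_sub N_sub gs(2) \<Delta>_carrier[OF e(1)]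
          \<Delta>_mult[OF e(1)] N_\<Delta>[OF e(1)] a(2)])
  moreover have "a \<otimes> w \<in> line_extensions (\<Delta> (k + k)) gs N"
    by (rule line_extensions_smult[OF \<Delta>_sub N_sub gs(2) a_carrier multipliers_\<Delta>[OF a(1)]
          multipliers_N[OF a(1)] e(2)])
  ultimately show ?thesis using submodule_overE(4)[OF extensions] by metis
qed

lemma elimination:
  assumes "set gs \<subseteq> carrier R"
    and "\<And>g. g \<in> set gs \<Longrightarrow> \<exists>a\<in>multipliers k. a \<otimes> g \<in> line_extensions (\<Delta> k) gs N"
  shows "\<exists>m. \<exists>c\<in>multipliers m. \<forall>g\<in>set gs. c \<otimes> g \<in> N"
  using assms
proof (induction gs arbitrary: k)
  case Nil
  have "s [^] (0::nat) \<ominus> \<zero> \<in> multipliers 0"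
    unfolding multipliers_def using submodule_overE(3)[OF submodule_\<Delta>] by blast
  then show ?case by auto
next
  case (Cons g gs)
  have gs: "g \<in> carrier R" "set gs \<subseteq> carrier R" using Cons.prems(1) by auto
  obtain a' d v where a': "a' \<in> multipliers k" "d \<in> \<Delta> k" "v \<in> line_extensions (\<Delta> k) gs N"
      "a' \<otimes> g = d \<otimes> g \<oplus> v"
    using Cons.prems(2)[of g] by (auto simp: line_extension_mem_iff)
  define a where "a = a' \<ominus> d"
  have a: "a \<in> multipliers k" unfolding a_def by (rule multipliers_diff[OF a'(1,2)])
  note v_carrier = submodule_overE(2)[OF submodule_over_extensions[OF gs(2)] a'(3)]
    and d_carrier = \<Delta>_carrier[OF a'(2)] and a_carrier = multipliers_carrier[OF a]
  have "a \<otimes> g = a' \<otimes> g \<ominus> d \<otimes> g"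
    unfolding a_def using multipliers_carrier[OF a'(1)] d_carrier gs
    by (simp add: a_minus_def l_distr l_minus)
  also have "\<dots> = v"
    unfolding a'(4) using v_carrier d_carrier gs by (simp add: a_minus_def a_ac r_neg)
  finally have ag_mem: "a \<otimes> g \<in> line_extensions (\<Delta> k) gs N" using a'(3) by simp
  have "\<exists>b\<in>multipliers (k + k). b \<otimes> h \<in> line_extensions (\<Delta> (k + k)) gs N" if h: "h \<in> set gs" for h
  proof -
    obtain b where b: "b \<in> multipliers k" "b \<otimes> h \<in> line_extensions (\<Delta> k) (g # gs) N"
      using Cons.prems(2)[of h] h by auto
    then show ?thesis
      using eliminate_generator[OF gs a ag_mem b] multipliers_mult[OF a b(1)] h gs(2) by blast
  qed
  then obtain m c where c: "c \<in> multipliers m" "\<And>h. h \<in> set gs \<Longrightarrow> c \<otimes> h \<in> N"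
    using Cons.IH[OF gs(2)] by blast
  note c_carrier = multipliers_carrier[OF c(1)]
  have "(c \<otimes> a) \<otimes> g = c \<otimes> (a \<otimes> g)" using c_carrier a_carrier gs by (simp add: m_assoc)
  then have "(c \<otimes> a) \<otimes> g \<in> N" using multipliers_extensions[OF gs(2) c ag_mem] by simp
  moreover have "(c \<otimes> a) \<otimes> h \<in> N" if h: "h \<in> set gs" for h
  proof -
    have "(c \<otimes> a) \<otimes> h = a \<otimes> (c \<otimes> h)" using c_carrier a_carrier gs h by (auto simp: m_ac)
    then show ?thesis using multipliers_N[OF a c(2)[OF h]] by simp
  qed
  ultimately show ?case using multipliers_mult[OF c(1) a] by auto
qed

end

context cring
begin

lemma nakayama:
  assumes K: "subring K R" and I: "submodule_over K I" "I \<subseteq> K" and N: "submodule_over K N"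
    and gs: "set gs \<subseteq> carrier R" "set gs \<subseteq> line_extensions I gs N"
  shows "\<exists>a\<in>I. \<forall>b\<in>Span K gs. (\<one> \<ominus> a) \<otimes> b \<in> N"
proof -
  note I_closed = submodule_overE[OF I(1)] and N_closed = submodule_overE[OF N]
  interpret graded_multipliers R K \<one> "\<lambda>_. I" N
    using K I N I_closed(2,5) N_closed(2,5) is_cring
    by (intro graded_multipliers.intro graded_multipliers_axioms.intro) (simp_all add: subset_iff)
  have "\<one> [^] (0::nat) \<ominus> \<zero> \<in> multipliers 0" unfolding multipliers_def using I_closed(3) by blast
  then have one: "\<one> \<in> multipliers 0" by (simp add: a_minus_def)
  obtain m c where c: "c \<in> multipliers m" "\<forall>g\<in>set gs. c \<otimes> g \<in> N"
  proof -
    have "\<exists>a\<in>multipliers 0. a \<otimes> g \<in> line_extensions I gs N" if "g \<in> set gs" for g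
      using one gs that by (intro bexI[of _ \<one>]) (simp_all add: subset_iff)
    then show ?thesis using elimination[OF gs(1), of 0] that by blast
  qed
  then obtain a where a: "a \<in> I" "c = \<one> \<ominus> a" by (auto simp: multipliers_def nat_pow_one)
  have "submodule_over K {b \<in> carrier R. c \<otimes> b \<in> N}"
    using N_closed subring_mem[OF K] multipliers_carrier[OF c(1)]
    by (intro submodule_overI) (auto simp: r_distr m_lcomm)
  then have "Span K gs \<subseteq> {b \<in> carrier R. c \<otimes> b \<in> N}" using c(2) gs(1) by (intro Span_least) auto
  then show ?thesis using a by auto
qed

lemma integral_over_if_Span_stable:
  assumes K: "subring K R" and t: "t \<in> carrier R"
    and gs: "set gs \<subseteq> carrier R" "\<one> \<in> Span K gs" "\<And>g. g \<in> set gs \<Longrightarrow> t \<otimes> g \<in> Span K gs"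
  shows "integral_over K R t"
proof -
  note span_closed = submodule_overE[OF submodule_over_poly_span[OF K t]]
  interpret graded_multipliers R K t "poly_span K t" "{\<zero>}"
    using K t span_closed(2) poly_span_mult[OF K t] poly_span_times_gen[OF K t]
      submodule_over_poly_span[OF K t] submodule_over_zero[OF subringE(1)[OF K]] is_cring
    by (intro graded_multipliers.intro graded_multipliers_axioms.intro) simp_all
  have gen: "t \<in> multipliers 1"
  proof -
    have "t = t [^] (1::nat) \<ominus> \<zero>" using t by (simp add: a_minus_def)
    then show ?thesis unfolding multipliers_def using span_closed(3) by blast
  qed
  obtain m c where c: "c \<in> multipliers m" "\<forall>g\<in>set gs. c \<otimes> g = \<zero>"
  proof -
    have "\<exists>a\<in>multipliers 1. a \<otimes> g \<in> line_extensions (poly_span K t 1) gs {\<zero>}"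
      if "g \<in> set gs" for g
      unfolding poly_span_1[OF K t]
      using gen gs(3)[OF that, unfolded Span_eq_line_extensions] by blast
    then show ?thesis using elimination[OF gs(1), of 1] that by blast
  qed
  then obtain d where d: "d \<in> poly_span K t m" "c = t [^] m \<ominus> d" by (auto simp: multipliers_def)
  have "submodule_over K {b \<in> carrier R. c \<otimes> b = \<zero>}"
    using subring_mem[OF K] multipliers_carrier[OF c(1)]
    by (intro submodule_overI) (auto simp: r_distr m_lcomm)
  then have "Span K gs \<subseteq> {b \<in> carrier R. c \<otimes> b = \<zero>}" using c(2) gs(1) by (intro Span_least) auto
  then have "t [^] m \<ominus> d = \<zero>" using gs(2) d(2) multipliers_carrier[OF c(1)] by auto
  then have "t [^] m = d" using t span_closed(2)[OF d(1)] by simp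
  then show ?thesis using d(1) integral_over_iff_poly_span[OF K t] by blast
qed

end

section \<open>Chains of intermediate rings\<close>

lemma subset_chain_mono: "subset.chain \<A> C \<Longrightarrow> \<A> \<subseteq> \<B> \<Longrightarrow> subset.chain \<B> C"
  by (auto simp: subset_chain_def)

lemma finite_chain_Union_mem:
  assumes "subset.chain \<A> C" "finite C" "C \<noteq> {}"
  shows "\<Union>C \<in> \<A>"
proof -
  obtain M where M: "M \<in> C" "\<forall>Y\<in>C. M \<subseteq> Y \<longrightarrow> M = Y"
    using finite_has_maximal[OF assms(2,3)] by auto
  have "Y \<subseteq> M" if "Y \<in> C" for Y
    using subset.chain_total[OF assms(1) that M(1)] M(2) that by blast
  then have "\<Union>C = M" using M(1) by blast
  then show ?thesis using M(1) assms(1) by (auto simp: subset.chain_def)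
qed

lemma FCP_mono: "FCP R S \<Longrightarrow> R \<subseteq> T \<Longrightarrow> FCP T S"
  unfolding FCP_def
  by (intro allI impI) (auto simp: intermediate_rings_def elim!: allE impE subset_chain_mono)

lemma FCP_maximal:
  assumes "FCP R S" "\<A> \<subseteq> intermediate_rings R S" "\<A> \<noteq> {}"
  shows "\<exists>M\<in>\<A>. \<forall>Y\<in>\<A>. M \<subseteq> Y \<longrightarrow> Y = M"
proof (rule subset_Zorn_nonempty[OF assms(3)])
  fix C assume C: "C \<noteq> {}" "subset.chain \<A> C"
  then have "finite C"
    using assms(1) subset_chain_mono[OF C(2) assms(2)] unfolding FCP_def by blast
  then show "\<Union>C \<in> \<A>" using finite_chain_Union_mem C by blast
qed

lemma FCP_minimal:
  assumes "FCP R S" "\<A> \<subseteq> intermediate_rings R S" "\<A> \<noteq> {}"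
  shows "\<exists>M\<in>\<A>. \<forall>Y\<in>\<A>. Y \<subseteq> M \<longrightarrow> Y = M"
proof -
  have "\<exists>M\<in>uminus ` \<A>. \<forall>Y\<in>uminus ` \<A>. M \<subseteq> Y \<longrightarrow> Y = M"
  proof (rule subset_Zorn_nonempty)
    fix C assume C: "C \<noteq> {}" "subset.chain (uminus ` \<A>) C"
    have "subset.chain \<A> (uminus ` C)" using C(2) by (auto simp: subset_chain_def)
    then have "finite (uminus ` C)"
      using assms(1) subset_chain_mono[OF _ assms(2)] unfolding FCP_def by blast
    then have "finite C" by (rule finite_imageD) (auto intro: inj_onI)
    then show "\<Union>C \<in> uminus ` \<A>" using finite_chain_Union_mem C by blast
  qed (use assms(3) in auto)
  then obtain M where "M \<in> \<A>" "\<forall>Y\<in>\<A>. - M \<subseteq> - Y \<longrightarrow> - Y = - M" by auto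
  then show ?thesis by auto
qed

lemma FCP_decreasing:
  fixes A :: "nat \<Rightarrow> 'a set"
  assumes "FCP R S" "\<And>n. A n \<in> intermediate_rings R S" "\<And>n. A (Suc n) \<subseteq> A n"
  shows "\<exists>n. A (Suc n) = A n"
proof -
  have "range A \<subseteq> intermediate_rings R S" using assms(2) by auto
  then obtain n where "\<forall>Y\<in>range A. Y \<subseteq> A n \<longrightarrow> Y = A n"
    using FCP_minimal[OF assms(1), of "range A"] by auto
  then have "A (Suc n) = A n" using assms(3)[of n] by simp
  then show ?thesis ..
qed

context cring
begin

lemma subring_plus_multiples:
  assumes K: "subring K R" and B: "subring B R" and "K \<subseteq> B" and c: "c \<in> B"
  shows "subring {a \<oplus> c \<otimes> y |a y. a \<in> K \<and> y \<in> B} R" (is "subring ?A R")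
proof (rule subringI)
  note K_carrier = subring_mem[OF K] and B_carrier = subring_mem[OF B]
    and c_carrier = subring_mem[OF B c]
  note K_closed = subringE[OF K] and B_closed = subringE[OF B]
  show "?A \<subseteq> carrier R" using K_carrier B_carrier c_carrier by auto
  have "\<one> = \<one> \<oplus> c \<otimes> \<zero>" using c_carrier by simp
  then show "\<one> \<in> ?A" using K_closed(3) B_closed(2) by blast
  show "\<ominus> u \<in> ?A" if uA: "u \<in> ?A" for u
  proof -
    obtain a y where u: "u = a \<oplus> c \<otimes> y" "a \<in> K" "y \<in> B" using uA by blast
    have "\<ominus> u = \<ominus> a \<oplus> c \<otimes> (\<ominus> y)"
      unfolding u using K_carrier[OF u(2)] B_carrier[OF u(3)] c_carrier by algebra
    then show ?thesis using K_closed(5)[OF u(2)] B_closed(5)[OF u(3)] by blast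
  qed
  fix u v assume "u \<in> ?A" "v \<in> ?A"
  then obtain a y b z where u: "u = a \<oplus> c \<otimes> y" "a \<in> K" "y \<in> B"
    and v: "v = b \<oplus> c \<otimes> z" "b \<in> K" "z \<in> B" by blast
  note in_carrier = K_carrier[OF u(2)] B_carrier[OF u(3)] K_carrier[OF v(2)] B_carrier[OF v(3)]
    c_carrier
  have "u \<oplus> v = (a \<oplus> b) \<oplus> c \<otimes> (y \<oplus> z)" unfolding u v using in_carrier by algebra
  then show "u \<oplus> v \<in> ?A" using K_closed(7)[OF u(2) v(2)] B_closed(7)[OF u(3) v(3)] by blast
  have "u \<otimes> v = (a \<otimes> b) \<oplus> c \<otimes> (a \<otimes> z \<oplus> b \<otimes> y \<oplus> c \<otimes> y \<otimes> z)"
    unfolding u v using in_carrier by (simp add: l_distr r_distr m_ac a_ac)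
  moreover have "a \<in> B" "b \<in> B" using u v \<open>K \<subseteq> B\<close> by auto
  then have "a \<otimes> z \<oplus> b \<otimes> y \<oplus> c \<otimes> y \<otimes> z \<in> B" using u v c B_closed(6,7) by simp
  ultimately show "u \<otimes> v \<in> ?A" using K_closed(6)[OF u(2) v(2)] by blast
qed

text \<open>The rings \<open>K + c\<^sup>n B\<close> form a descending chain.\<close>

lemma FCP_power_stationary:
  assumes K: "subring K R" and FCP: "FCP K R" and B: "subring B R" "K \<subseteq> B" and c: "c \<in> B"
  shows "\<exists>n::nat. \<forall>y\<in>B. \<exists>a\<in>K. \<exists>z\<in>B. c [^] Suc n \<otimes> y = a \<oplus> c [^] Suc (Suc n) \<otimes> z"
proof -
  define A where "A = (\<lambda>n::nat. {a \<oplus> c [^] Suc n \<otimes> y |a y. a \<in> K \<and> y \<in> B})"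
  note K_carrier = subring_mem[OF K] and B_carrier = subring_mem[OF B(1)]
    and c_carrier = subring_mem[OF B(1) c]
  have "A n \<in> intermediate_rings K R" for n
  proof -
    have "a \<in> A n" if "a \<in> K" for a
    proof -
      have "a = a \<oplus> c [^] Suc n \<otimes> \<zero>" using K_carrier[OF that] c_carrier by simp
      then show ?thesis unfolding A_def using that subringE(2)[OF B(1)] by blast
    qed
    moreover have "subring (A n) R"
      unfolding A_def by (rule subring_plus_multiples[OF K B subring_nat_pow[OF B(1) c]])
    ultimately show ?thesis by (auto simp: intermediate_rings_def)
  qed
  moreover have "A (Suc n) \<subseteq> A n" for n
  proof
    fix u assume "u \<in> A (Suc n)"
    then obtain a y where u: "u = a \<oplus> c [^] Suc (Suc n) \<otimes> y" "a \<in> K" "y \<in> B"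
      unfolding A_def by blast
    have "u = a \<oplus> c [^] Suc n \<otimes> (c \<otimes> y)"
      unfolding u(1) using c_carrier B_carrier[OF u(3)] by (simp add: m_assoc)
    then show "u \<in> A n" unfolding A_def using u subringE(6)[OF B(1) c u(3)] by blast
  qed
  ultimately obtain n where n: "A (Suc n) = A n" using FCP_decreasing[OF FCP, of A] by blast
  have "c [^] Suc n \<otimes> y \<in> A (Suc n)" if y: "y \<in> B" for y
  proof -
    have "c [^] Suc n \<otimes> y = \<zero> \<oplus> c [^] Suc n \<otimes> y" using c_carrier B_carrier[OF y] by simp
    then show ?thesis unfolding n unfolding A_def using subringE(2)[OF K] y by blast
  qed
  then show ?thesis unfolding A_def by (intro exI[of _ n]) blast
qed

lemma FCP_relation:
  assumes K: "subring K R" and FCP: "FCP K R" and t: "t \<in> carrier R"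
  shows "\<exists>f. set f \<subseteq> K \<and> \<ominus> \<one> \<in> set f \<and> eval f t = \<zero>"
proof -
  let ?B = "simple_extension K t"
  note B = simple_extension_subring[OF K t] simple_extension_incl[OF subringE(1)[OF K] t]
    and gen_mem = simple_extension_mem[OF K t] and K_closed = subringE[OF K]
  obtain n :: nat and a y where y: "a \<in> K" "y \<in> ?B" "t [^] Suc n = a \<oplus> t [^] Suc (Suc n) \<otimes> y"
    using FCP_power_stationary[OF K FCP B gen_mem] subringE(3)[OF B(1)] t
    by (metis nat_pow_closed r_one)
  obtain p where p: "set p \<subseteq> K" "y = eval p t"
    using y(2) unfolding simple_extension_eq_poly_span[OF K t] poly_span_eq_eval by blast
  let ?q = "\<ominus> \<one> # replicate n \<zero> @ [a]"
  note a_carrier = subring_mem[OF K y(1)] and y_carrier = subring_mem[OF B(1) y(2)]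
  have q_subset: "set ?q \<subseteq> K"
    using K_closed(2) K_closed(5)[OF K_closed(3)] y(1) by (simp add: set_replicate_conv_if)
  have "eval ?q t = \<ominus> (t [^] Suc n) \<oplus> a"
    using eval_replicate[of "[a]" t n] a_carrier t by (simp add: l_minus)
  moreover have "eval (p @ ?q) t = y \<otimes> t [^] Suc (Suc n) \<oplus> eval ?q t"
    unfolding p(2)
    using eval_append[OF order_trans[OF p(1) K_closed(1)] order_trans[OF q_subset K_closed(1)] t]
    by (simp del: eval.simps nat_pow_Suc)
  moreover have "y \<otimes> v \<oplus> (\<ominus> (a \<oplus> v \<otimes> y) \<oplus> a) = \<zero>" if "v \<in> carrier R" for v
    using that a_carrier y_carrier by algebra
  ultimately have "eval (p @ ?q) t = \<zero>" using y(3) t by (metis nat_pow_closed)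
  then show ?thesis using p(1) q_subset by (intro exI[of _ "p @ ?q"]) simp
qed

definition integral_closure :: "'a set \<Rightarrow> 'a set"
  where "integral_closure K = {x \<in> carrier R. integral_over K R x}"

lemma integral_simple_extension_eq_Span:
  assumes K: "subring K R" and A: "subring A R" "K \<subseteq> A" and gs: "set gs \<subseteq> carrier R" "A = Span K gs"
    and t: "t \<in> carrier R" and int: "integral_over A R t"
  shows "\<exists>ps. set ps \<subseteq> carrier R \<and> simple_extension A t = Span K ps"
proof -
  let ?B = "simple_extension A t" and ?ps = "\<lambda>m. [g \<otimes> h. h \<leftarrow> exp_base t m, g \<leftarrow> gs]"
  note B = simple_extension_subring[OF A(1) t]
  obtain m :: nat where m: "?B = poly_span A t m"
    using int integral_over_iff_poly_span[OF A(1) t] simple_extension_integral[OF A(1) t] by blast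
  have A_subset: "A \<subseteq> ?B" by (rule simple_extension_incl[OF subringE(1)[OF A(1)] t])
  have "set gs \<subseteq> ?B" using Span_incl[OF K gs(1)] A_subset gs(2) by blast
  moreover have "set (exp_base t m) \<subseteq> ?B"
    using Span_incl[OF A(1) exp_base_closed[OF t]] unfolding m poly_span_def .
  ultimately have ps: "set (?ps m) \<subseteq> ?B" using subringE(6)[OF B] by auto
  have "?B \<subseteq> Span K (?ps m)"
    unfolding m poly_span_def unfolding gs(2)
    by (rule Span_Span_subset[OF K gs(1) exp_base_closed[OF t]])
  moreover have "Span K (?ps m) \<subseteq> ?B"
    using A_subset A(2) ps by (intro Span_least submodule_over_subring[OF B]) auto
  ultimately show ?thesis using ps subringE(1)[OF B] by blast
qed

text \<open>Under FCP there is a largest subring that is a finitely generated \<open>K\<close>-module, and it is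
  the integral closure.\<close>

lemma FCP_integral_closure:
  assumes K: "subring K R" and FCP: "FCP K R"
  shows "subring (integral_closure K) R" and "K \<subseteq> integral_closure K"
    and "integral_closure (integral_closure K) = integral_closure K"
proof -
  let ?\<A> = "{A \<in> intermediate_rings K R. \<exists>gs. set gs \<subseteq> carrier R \<and> A = Span K gs}"
  have "K \<in> ?\<A>"
    using K Span_singleton_one[OF K]
    by (auto simp: intermediate_rings_def intro!: exI[of _ "[\<one>]"] simp del: Span_Cons)
  then have "?\<A> \<noteq> {}" by blast
  then obtain A where "A \<in> ?\<A>" and max: "\<forall>B\<in>?\<A>. A \<subseteq> B \<longrightarrow> B = A"
    using FCP_maximal[OF FCP, of ?\<A>] by blast
  then obtain gs where A: "subring A R" "K \<subseteq> A" and gs: "set gs \<subseteq> carrier R" "A = Span K gs"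
    by (auto simp: intermediate_rings_def)
  have closed: "t \<in> A" if t: "t \<in> carrier R" and int: "integral_over A R t" for t
  proof -
    have A_subset: "A \<subseteq> simple_extension A t"
      by (rule simple_extension_incl[OF subringE(1)[OF A(1)] t])
    then have "simple_extension A t \<in> ?\<A>"
      using integral_simple_extension_eq_Span[OF K A gs t int] simple_extension_subring[OF A(1) t]
        A(2)
      by (auto simp: intermediate_rings_def)
    then show ?thesis using max A_subset simple_extension_mem[OF A(1) t] by blast
  qed
  have "integral_over K R a" if a: "a \<in> A" for a
  proof (rule integral_over_if_Span_stable[OF K subring_mem[OF A(1) a] gs(1)])
    show "\<one> \<in> Span K gs" using subringE(3)[OF A(1)] gs(2) by simp
    show "a \<otimes> g \<in> Span K gs" if "g \<in> set gs" for g
      using Span_incl[OF K gs(1)] subringE(6)[OF A(1) a] that gs(2) by blast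
  qed
  then have eq: "integral_closure K = A"
    unfolding integral_closure_def using closed integral_over_mono[OF _ A(2)] subring_mem[OF A(1)]
    by blast
  show "subring (integral_closure K) R" "K \<subseteq> integral_closure K" unfolding eq by (rule A)+
  have "integral_over A R a" if "a \<in> A" for a
    using that integral_over_if_nat_pow_mem[OF A(1), of a 0] subring_mem[OF A(1)] by simp
  then show "integral_closure (integral_closure K) = integral_closure K"
    unfolding eq using closed subring_mem[OF A(1)] by (auto simp: integral_closure_def)
qed

section \<open>Intersections of subrings over which a ring is integral\<close>

definition pi_regular_factors :: "'a \<Rightarrow> 'a set"
  where "pi_regular_factors x = {x [^] N \<otimes> (\<one> \<ominus> x \<otimes> q) |(N::nat) q. q \<in> carrier R}"

lemma pi_regular_factors_mult:
  assumes x: "x \<in> carrier R" and "c \<in> pi_regular_factors x" "d \<in> pi_regular_factors x"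
  shows "c \<otimes> d \<in> pi_regular_factors x"
proof -
  obtain M N :: nat and p q where p: "p \<in> carrier R" "c = x [^] M \<otimes> (\<one> \<ominus> x \<otimes> p)"
    and q: "q \<in> carrier R" "d = x [^] N \<otimes> (\<one> \<ominus> x \<otimes> q)"
    using assms(2,3) by (auto simp: pi_regular_factors_def)
  have "c \<otimes> d = x [^] (M + N) \<otimes> ((\<one> \<ominus> x \<otimes> p) \<otimes> (\<one> \<ominus> x \<otimes> q))"
    unfolding p(2) q(2) using x p(1) q(1) by (simp add: m_ac flip: nat_pow_mult)
  also have "(\<one> \<ominus> x \<otimes> p) \<otimes> (\<one> \<ominus> x \<otimes> q) = \<one> \<ominus> x \<otimes> (p \<oplus> q \<ominus> x \<otimes> p \<otimes> q)"
    using x p(1) q(1) by algebra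
  finally show ?thesis
    unfolding pi_regular_factors_def using x p(1) q(1) by blast
qed

text \<open>With \<open>B = T[t]\<close> and \<open>x\<^sup>n B \<subseteq> T + x\<^sup>n\<^sup>+\<^sup>1 B\<close>, Nakayama's lemma applies to the ideal \<open>x T\<close> and
  the submodule \<open>{b. x\<^sup>n b \<in> T}\<close>.\<close>

lemma simple_extension_conductor:
  assumes T: "subring T R" and FCP: "FCP T R" and t: "t \<in> carrier R" and int: "integral_over T R t"
    and x: "x \<in> T"
  shows "\<exists>c\<in>pi_regular_factors x. \<forall>b\<in>simple_extension T t. c \<otimes> b \<in> T"
proof -
  let ?B = "simple_extension T t" and ?I = "(\<otimes>) x ` T"
  note T_closed = subringE[OF T] and T_carrier = subring_mem[OF T]
    and x_carrier = subring_mem[OF T x]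
  note B = simple_extension_subring[OF T t] simple_extension_incl[OF T_closed(1) t]
  obtain n :: nat where n: "\<forall>y\<in>?B. \<exists>a\<in>T. \<exists>z\<in>?B. x [^] Suc n \<otimes> y = a \<oplus> x [^] Suc (Suc n) \<otimes> z"
    using FCP_power_stationary[OF T FCP B] x B(2) by blast
  obtain m :: nat where m: "?B = Span T (exp_base t m)"
    using int integral_over_iff_poly_span[OF T t] simple_extension_integral[OF T t]
    unfolding poly_span_def by blast
  let ?gs = "exp_base t m" and ?N = "{b \<in> carrier R. x [^] Suc n \<otimes> b \<in> T}"
  note gs = exp_base_closed[OF t, of m] and I = submodule_over_multiples[OF T x_carrier]
  have N: "submodule_over T ?N"
    using T_closed(2,6,7) T_carrier x_carrier
    by (intro submodule_overI) (auto simp: r_distr m_lcomm simp del: nat_pow_Suc)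
  have "g \<in> line_extensions ?I ?gs ?N" if g: "g \<in> set ?gs" for g
  proof -
    have g_mem: "g \<in> ?B" using Span_incl[OF T gs] g unfolding m by blast
    obtain a z where z: "a \<in> T" "z \<in> ?B" "x [^] Suc n \<otimes> g = a \<oplus> x [^] Suc (Suc n) \<otimes> z"
      using n g_mem by blast
    have gz_carrier: "g \<in> carrier R" "z \<in> carrier R" using subring_mem[OF B(1)] g_mem z(2) by auto
    have "x [^] Suc n \<otimes> (g \<ominus> x \<otimes> z) = x [^] Suc n \<otimes> g \<ominus> x [^] Suc (Suc n) \<otimes> z"
      using gz_carrier x_carrier by (simp add: a_minus_def r_distr r_minus m_assoc)
    also have "\<dots> = a" unfolding z(3)
      using T_carrier[OF z(1)] gz_carrier x_carrier by (simp add: a_minus_def a_ac r_neg)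
    finally have "g \<ominus> x \<otimes> z \<in> ?N" using z(1) gz_carrier x_carrier by simp
    moreover have "x \<otimes> z \<in> Span ?I ?gs"
      using z(2) x_carrier T_closed(1) gs unfolding m Span_eq_line_extensions
      by (intro line_extensions_smult[of T "{\<zero>}" ?gs x]) auto
    ultimately show ?thesis by (intro mem_line_extensionsI[OF T_closed(1) I N gs gz_carrier(1)])
  qed
  moreover have "?I \<subseteq> T" using x T_closed(6) by auto
  ultimately obtain a where a: "a \<in> T" "\<forall>b\<in>?B. (\<one> \<ominus> x \<otimes> a) \<otimes> b \<in> ?N"
    using nakayama[OF T I _ N gs] unfolding m by blast
  have "x [^] Suc n \<otimes> (\<one> \<ominus> x \<otimes> a) \<otimes> b = x [^] Suc n \<otimes> ((\<one> \<ominus> x \<otimes> a) \<otimes> b)" if "b \<in> ?B" for b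
    using subring_mem[OF B(1) that] T_carrier[OF a(1)] x_carrier by (simp add: m_assoc)
  then have "\<forall>b\<in>?B. x [^] Suc n \<otimes> (\<one> \<ominus> x \<otimes> a) \<otimes> b \<in> T" using a(2) by auto
  then show ?thesis unfolding pi_regular_factors_def using T_carrier[OF a(1)] by blast
qed

text \<open>The rings \<open>T\<close> such that a \<open>\<pi>\<close>-regular factor of \<open>x\<close> moves \<open>T\<close> into \<open>U\<close> have a maximal element,
  which absorbs every integral element.\<close>

lemma FCP_integral_conductor:
  assumes U: "subring U R" and FCP: "FCP U R" and int: "integral_ext U R" and x: "x \<in> U"
  shows "\<exists>c\<in>pi_regular_factors x. \<forall>s\<in>carrier R. c \<otimes> s \<in> U"
proof -
  let ?\<A> = "{T \<in> intermediate_rings U R. \<exists>c\<in>pi_regular_factors x. \<forall>s\<in>T. c \<otimes> s \<in> U}"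
  note x_carrier = subring_mem[OF U x]
  have "\<one> = x [^] (0::nat) \<otimes> (\<one> \<ominus> x \<otimes> \<zero>)" using x_carrier by (simp add: a_minus_def)
  then have "\<one> \<in> pi_regular_factors x" unfolding pi_regular_factors_def by blast
  then have "U \<in> ?\<A>"
    using U subring_mem[OF U] by (auto simp: intermediate_rings_def intro!: bexI[of _ \<one>])
  then have "?\<A> \<noteq> {}" by blast
  then obtain T where T': "T \<in> ?\<A>" and max: "\<forall>B\<in>?\<A>. T \<subseteq> B \<longrightarrow> B = T"
    using FCP_maximal[OF FCP, of ?\<A>] by blast
  then obtain c where T: "subring T R" "U \<subseteq> T"
    and c: "c \<in> pi_regular_factors x" "\<forall>s\<in>T. c \<otimes> s \<in> U"
    by (auto simp: intermediate_rings_def)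
  have "t \<in> T" if t: "t \<in> carrier R" for t
  proof -
    let ?B = "simple_extension T t"
    have B: "subring ?B R" "T \<subseteq> ?B"
      using simple_extension_subring[OF T(1) t] simple_extension_incl[OF subringE(1)[OF T(1)] t] .
    have "integral_over T R t"
      using int t by (intro integral_over_mono[OF _ T(2)]) (simp add: integral_ext_def)
    then obtain d where d: "d \<in> pi_regular_factors x" "\<forall>b\<in>?B. d \<otimes> b \<in> T"
      using simple_extension_conductor[OF T(1) FCP_mono[OF FCP T(2)] t] x T(2) by blast
    have cd_carrier: "c \<in> carrier R" "d \<in> carrier R"
      using c(1) d(1) x_carrier by (auto simp: pi_regular_factors_def)
    have "c \<otimes> d \<otimes> b \<in> U" if "b \<in> ?B" for b
      using c(2) d(2) that cd_carrier subring_mem[OF B(1) that] by (simp add: m_assoc)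
    then have "?B \<in> ?\<A>"
      using B T(2) pi_regular_factors_mult[OF x_carrier c(1) d(1)]
      by (auto simp: intermediate_rings_def)
    then show ?thesis using max B(2) simple_extension_mem[OF T(1) t] by blast
  qed
  then show ?thesis using c by blast
qed

lemma quasi_inverse_absorbs_pow:
  assumes I: "submodule_over (carrier R) I" and p: "p \<in> carrier R" and z: "z \<in> carrier R"
    and reg: "p \<otimes> (p \<otimes> z) \<ominus> p \<in> I"
  shows "p \<otimes> (p \<otimes> z) [^] (k::nat) \<ominus> p \<in> I"
proof (induction k)
  case 0
  then show ?case using submodule_overE(3)[OF I] p by (simp add: a_minus_def r_neg)
next
  case (Suc k)
  have "p \<otimes> (v \<otimes> (p \<otimes> z)) \<ominus> p = p \<otimes> z \<otimes> (p \<otimes> v \<ominus> p) \<oplus> (p \<otimes> (p \<otimes> z) \<ominus> p)"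
    if "v \<in> carrier R" for v
    using p z that by algebra
  from this[of "(p \<otimes> z) [^] k"] show ?case
    using submodule_overE(4)[OF I submodule_overE(5)[OF I m_closed[OF p z] Suc] reg] p z by simp
qed

lemma quasi_inverse_poly_span:
  assumes U: "subring U R" and I: "submodule_over (carrier R) I" and p: "p \<in> U"
    and z: "z \<in> carrier R" and reg: "p \<otimes> (p \<otimes> z) \<ominus> p \<in> I" and y: "y \<in> poly_span U z m"
  shows "\<exists>u\<in>U. p [^] m \<otimes> y \<ominus> p \<otimes> u \<in> I"
  using y
proof (induction m arbitrary: y)
  case 0
  then show ?case
    using subringE(2)[OF U] submodule_overE(3)[OF I] subring_mem[OF U p]
    by (auto simp: a_minus_def intro!: bexI[of _ \<zero>])
next
  case (Suc m)
  have p_carrier: "p \<in> carrier R" by (rule subring_mem[OF U p])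
  obtain a n where y: "a \<in> U" "n \<in> poly_span U z m" "y = a \<otimes> z [^] m \<oplus> n"
    using Suc.prems by (rule poly_span_SucE)
  obtain u where u: "u \<in> U" "p [^] m \<otimes> n \<ominus> p \<otimes> u \<in> I" using Suc.IH[OF y(2)] by blast
  note in_carrier = subring_mem[OF U y(1)] poly_span_carrier[OF U z y(2)] subring_mem[OF U u(1)]
    p_carrier z
  have "v \<otimes> p \<otimes> (a \<otimes> w \<oplus> n) \<ominus> p \<otimes> (a \<oplus> p \<otimes> u)
      = a \<otimes> (p \<otimes> (v \<otimes> w) \<ominus> p) \<oplus> p \<otimes> (v \<otimes> n \<ominus> p \<otimes> u)"
    if "v \<in> carrier R" "w \<in> carrier R" for v w
    using in_carrier that by algebra
  from this[of "p [^] m" "z [^] m"] have "p [^] Suc m \<otimes> y \<ominus> p \<otimes> (a \<oplus> p \<otimes> u)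
      = a \<otimes> (p \<otimes> (p \<otimes> z) [^] m \<ominus> p) \<oplus> p \<otimes> (p [^] m \<otimes> n \<ominus> p \<otimes> u)"
    unfolding y(3) nat_pow_distrib[OF p_carrier z] using p_carrier z by simp
  also have "\<dots> \<in> I"
    using quasi_inverse_absorbs_pow[OF I p_carrier z reg] u(2) in_carrier(1) p_carrier
    by (intro submodule_overE(4,5)[OF I])
  finally show ?case using subringE(6,7)[OF U] p u(1) y(1) by blast
qed

text \<open>Multiplying a monic equation \<open>z\<^sup>m = a\<^sub>m\<^sub>-\<^sub>1 z\<^sup>m\<^sup>-\<^sup>1 + \<dots>\<close> by \<open>p\<^sup>m\<close> expresses
  \<open>(p z)\<^sup>m \<equiv> p z\<close> modulo \<open>I\<close> as a multiple of \<open>p\<close> in \<open>U\<close>.\<close>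

lemma integral_quasi_inverse_mem:
  assumes U: "subring U R" and I: "submodule_over (carrier R) I" "I \<subseteq> U" and p: "p \<in> U"
    and z: "z \<in> carrier R" "integral_over U R z" and reg: "p \<otimes> (p \<otimes> z) \<ominus> p \<in> I"
  shows "p \<otimes> z \<otimes> z \<in> U"
proof -
  note U_closed = subringE[OF U] and p_carrier = subring_mem[OF U p]
  obtain m where "z [^] Suc m \<in> poly_span U z (Suc m)" using integral_overE[OF U z] .
  then obtain u where u: "u \<in> U" "p [^] Suc m \<otimes> z [^] Suc m \<ominus> p \<otimes> u \<in> I"
    using quasi_inverse_poly_span[OF U I(1) p z(1) reg] by blast
  note u_carrier = subring_mem[OF U u(1)]
  have pow: "p [^] Suc m \<otimes> z [^] Suc m = z \<otimes> (p \<otimes> (p \<otimes> z) [^] m)"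
    unfolding nat_pow_distrib[OF p_carrier z(1)] using p_carrier z(1) by (simp add: m_ac)
  have "p \<otimes> z \<ominus> p \<otimes> u = (z \<otimes> w \<ominus> p \<otimes> u) \<ominus> z \<otimes> (w \<ominus> p)" if "w \<in> carrier R" for w
    using p_carrier z(1) u_carrier that by algebra
  from this[of "p \<otimes> (p \<otimes> z) [^] m"]
  have "p \<otimes> z \<ominus> p \<otimes> u
      = (p [^] Suc m \<otimes> z [^] Suc m \<ominus> p \<otimes> u) \<ominus> z \<otimes> (p \<otimes> (p \<otimes> z) [^] m \<ominus> p)"
    unfolding pow using p_carrier z(1) by simp
  also have "\<dots> \<in> I"
    by (rule submodule_over_minus(2)[OF carrier_is_subring I(1)
          submodule_overE(5)[OF I(1) z(1) quasi_inverse_absorbs_pow[OF I(1) p_carrier z(1) reg]]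
            u(2)])
  finally have diff: "p \<otimes> z \<ominus> p \<otimes> u \<in> I" .
  have "p \<otimes> z = (p \<otimes> z \<ominus> p \<otimes> u) \<oplus> p \<otimes> u"
    using z(1) p_carrier u_carrier by (simp add: a_minus_def a_assoc l_neg)
  then have "p \<otimes> z \<in> U" using U_closed(7)[OF subsetD[OF I(2) diff] U_closed(6)[OF p u(1)]] by simp
  moreover have "p \<otimes> z \<otimes> z = z \<otimes> (p \<otimes> z \<ominus> p \<otimes> u) \<oplus> p \<otimes> z \<otimes> u"
    using p_carrier z(1) u_carrier by algebra
  moreover have "z \<otimes> (p \<otimes> z \<ominus> p \<otimes> u) \<in> U"
    using submodule_overE(5)[OF I(1) z(1) diff] I(2) by blast
  ultimately show ?thesis using U_closed(6,7) u(1) by simp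
qed

lemma submodule_over_conductor:
  assumes "subring W R"
  shows "submodule_over (carrier R) {s \<in> carrier R. \<forall>z\<in>carrier R. s \<otimes> z \<in> W}"
proof (rule submodule_overI)
  let ?I = "{s \<in> carrier R. \<forall>z\<in>carrier R. s \<otimes> z \<in> W}"
  show "k \<otimes> a \<in> ?I" if "k \<in> carrier R" "a \<in> ?I" for k a
  proof -
    have "k \<otimes> a \<otimes> z = a \<otimes> (k \<otimes> z)" if "z \<in> carrier R" for z
      using that \<open>k \<in> carrier R\<close> \<open>a \<in> ?I\<close> by (simp add: m_ac)
    then show ?thesis using that by simp
  qed
qed (use subringE(2,7)[OF assms] in \<open>auto simp: l_distr\<close>)

lemma pi_regular_factors_dvd:
  assumes x: "x \<in> carrier R" and c: "c \<in> pi_regular_factors x"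
  shows "\<exists>k. \<exists>q\<in>carrier R. \<exists>y\<in>carrier R. x [^] Suc k \<ominus> x [^] Suc k \<otimes> (x [^] Suc k \<otimes> q) = y \<otimes> c"
proof -
  obtain k :: nat and q where q: "q \<in> carrier R" "c = x [^] k \<otimes> (\<one> \<ominus> x \<otimes> q)"
    using c by (auto simp: pi_regular_factors_def)
  have geometric: "\<exists>y\<in>carrier R. \<one> \<ominus> w [^] n = y \<otimes> (\<one> \<ominus> w)" if w: "w \<in> carrier R" for w and n :: nat
  proof (induction n)
    case (Suc n)
    then obtain y where y: "y \<in> carrier R" "\<one> \<ominus> w [^] n = y \<otimes> (\<one> \<ominus> w)" by blast
    have "\<one> \<ominus> v \<otimes> w = (\<one> \<ominus> v) \<oplus> v \<otimes> (\<one> \<ominus> w)" if "v \<in> carrier R" for v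
      using w that by algebra
    then have "\<one> \<ominus> w [^] Suc n = (y \<oplus> w [^] n) \<otimes> (\<one> \<ominus> w)"
      using w y by (simp add: l_distr)
    then show ?case using y(1) w by blast
  qed (auto simp: a_minus_def r_neg that intro!: bexI[of _ \<zero>])
  obtain y where y: "y \<in> carrier R" "\<one> \<ominus> (x \<otimes> q) [^] Suc k = y \<otimes> (\<one> \<ominus> x \<otimes> q)"
    using geometric[of "x \<otimes> q" "Suc k"] x q(1) by blast
  have "x [^] Suc k \<ominus> x [^] Suc k \<otimes> (x [^] Suc k \<otimes> q [^] Suc k) = x [^] Suc k \<otimes> (\<one> \<ominus> (x \<otimes> q) [^] Suc k)"
    unfolding nat_pow_distrib[OF x q(1)] using x q(1)
    by (simp add: a_minus_def r_distr r_minus del: nat_pow_Suc)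
  also have "\<dots> = (x \<otimes> y) \<otimes> c" unfolding y(2) q(2) using x y(1) q(1) by (simp add: m_ac)
  finally show ?thesis using x y(1) q(1) by (metis m_closed nat_pow_closed)
qed

lemma FCP_integral_conductor_Int:
  assumes U: "subring U R" "integral_ext U R" and V: "subring V R" "integral_ext V R"
    and FCP: "FCP (U \<inter> V) R" and x: "x \<in> U \<inter> V"
  shows "\<exists>c\<in>pi_regular_factors x. \<forall>s\<in>carrier R. c \<otimes> s \<in> U \<inter> V"
proof -
  have x_carrier: "x \<in> carrier R" using subring_mem[OF U(1)] x by blast
  obtain c where c: "c \<in> pi_regular_factors x" "\<forall>s\<in>carrier R. c \<otimes> s \<in> U"
    using FCP_integral_conductor[OF U(1) FCP_mono[OF FCP Int_lower1] U(2)] x by blast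
  obtain d where d: "d \<in> pi_regular_factors x" "\<forall>s\<in>carrier R. d \<otimes> s \<in> V"
    using FCP_integral_conductor[OF V(1) FCP_mono[OF FCP Int_lower2] V(2)] x by blast
  have cd_carrier: "c \<in> carrier R" "d \<in> carrier R"
    using c(1) d(1) x_carrier by (auto simp: pi_regular_factors_def)
  have "c \<otimes> d \<otimes> s \<in> U \<inter> V" if "s \<in> carrier R" for s
  proof -
    have "c \<otimes> d \<otimes> s = c \<otimes> (d \<otimes> s)" "c \<otimes> d \<otimes> s = d \<otimes> (c \<otimes> s)"
      using cd_carrier that by (simp_all add: m_ac)
    then show ?thesis using c(2) d(2) cd_carrier that by (metis IntI m_closed)
  qed
  then show ?thesis using pi_regular_factors_mult[OF x_carrier c(1) d(1)] by blast
qed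

text \<open>\<open>r\<close> is the quasi-inverse \<open>p q\<^sup>2\<close> of \<open>p = x\<^sup>k\<close> modulo the conductor of \<open>U \<inter> V\<close>, which by
  integrality lies in \<open>U\<close> as well as in \<open>V\<close>.\<close>

lemma integral_Int_pi_regular:
  assumes U: "subring U R" "integral_ext U R" and V: "subring V R" "integral_ext V R"
    and FCP: "FCP (U \<inter> V) R" and x: "x \<in> U \<inter> V"
  shows "\<exists>k. \<exists>r\<in>U \<inter> V. \<forall>s\<in>carrier R. x [^] Suc k \<otimes> (\<one> \<ominus> x [^] Suc k \<otimes> r) \<otimes> s \<in> U \<inter> V"
proof -
  let ?I = "{s \<in> carrier R. \<forall>z\<in>carrier R. s \<otimes> z \<in> U \<inter> V}"
  have W: "subring (U \<inter> V) R" by (rule subring_inter[OF U(1) V(1)])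
  note I = submodule_over_conductor[OF W] and x_carrier = subring_mem[OF W x]
  note I_minus = submodule_over_minus(1)[OF carrier_is_subring I]
  have conductor_subset: "?I \<subseteq> U \<inter> V"
    using r_one by (metis (no_types, lifting) mem_Collect_eq one_closed subsetI)
  obtain c where c: "c \<in> pi_regular_factors x" "\<forall>s\<in>carrier R. c \<otimes> s \<in> U \<inter> V"
    using FCP_integral_conductor_Int[OF U V FCP x] by blast
  then have c_conductor: "c \<in> ?I" using x_carrier by (auto simp: pi_regular_factors_def)
  obtain k :: nat and q y where q: "q \<in> carrier R" "y \<in> carrier R"
      "x [^] Suc k \<ominus> x [^] Suc k \<otimes> (x [^] Suc k \<otimes> q) = y \<otimes> c"
    using pi_regular_factors_dvd[OF x_carrier c(1)] by blast
  define p where "p = x [^] Suc k"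
  have p: "p \<in> U \<inter> V" "p \<in> carrier R"
    unfolding p_def using subring_nat_pow[OF W x] x_carrier by blast+
  have "p \<ominus> p \<otimes> (p \<otimes> q) \<in> ?I"
    unfolding p_def q(3) by (rule submodule_overE(5)[OF I q(2) c_conductor])
  then have "\<ominus> (p \<ominus> p \<otimes> (p \<otimes> q)) \<in> ?I" by (rule I_minus)
  moreover have "\<ominus> (p \<ominus> p \<otimes> (p \<otimes> q)) = p \<otimes> (p \<otimes> q) \<ominus> p" using p(2) q(1) by algebra
  ultimately have reg: "p \<otimes> (p \<otimes> q) \<ominus> p \<in> ?I" by simp
  define r where "r = p \<otimes> q \<otimes> q"
  have mem: "r \<in> A" if "subring A R" "integral_ext A R" "U \<inter> V \<subseteq> A" for A
    unfolding r_def
    using that conductor_subset p(1) q(1) reg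
    by (intro integral_quasi_inverse_mem[OF _ I]) (auto simp: integral_ext_def)
  have "p \<otimes> (\<one> \<ominus> p \<otimes> r) = \<ominus> ((\<one> \<oplus> p \<otimes> q) \<otimes> (p \<otimes> (p \<otimes> q) \<ominus> p))"
    unfolding r_def using p(2) q(1) by algebra
  also have "\<dots> \<in> ?I"
    using p(2) q(1) reg by (intro I_minus submodule_overE(5)[OF I]) auto
  finally have "\<forall>s\<in>carrier R. p \<otimes> (\<one> \<ominus> p \<otimes> r) \<otimes> s \<in> U \<inter> V" by simp
  moreover have "r \<in> U \<inter> V" using mem[OF U] mem[OF V] by blast
  ultimately show ?thesis unfolding p_def by blast
qed

lemma eval_map_smult:
  assumes "u \<in> carrier R" "t \<in> carrier R" "set g \<subseteq> carrier R"
  shows "eval (map ((\<otimes>) u) g) t = u \<otimes> eval g t"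
  using assms(3)
proof (induction g)
  case (Cons c g)
  then show ?case using assms(1,2) eval_in_carrier[of g t] by (simp add: r_distr m_assoc)
qed (use assms(1) in simp)

lemma eval_map_smult_Cons:
  assumes "c \<in> carrier R" "u \<in> carrier R" "t \<in> carrier R" "set g \<subseteq> carrier R" "s \<in> carrier R"
  shows "eval (map ((\<otimes>) u) g) t \<otimes> s =
    eval (c # g) t \<otimes> (u \<otimes> s) \<ominus> u \<otimes> c \<otimes> (t [^] length g \<otimes> s)"
proof -
  have "u \<otimes> w \<otimes> s = (c \<otimes> v \<oplus> w) \<otimes> (u \<otimes> s) \<ominus> u \<otimes> c \<otimes> (v \<otimes> s)"
    if "v \<in> carrier R" "w \<in> carrier R" for v w
    using assms that by algebra
  from this[of "t [^] length g" "eval g t"] show ?thesis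
    using eval_in_carrier[OF assms(4,3)] assms by (simp add: eval_map_smult)
qed

lemma integrally_closed_leading_coeff_mem:
  assumes A: "subring A R" "integral_closure A \<subseteq> A" and t: "t \<in> carrier R"
    and g: "c \<in> A" "set g \<subseteq> A" and conductor: "\<And>s. s \<in> carrier R \<Longrightarrow> eval (c # g) t \<otimes> s \<in> A"
  shows "c \<otimes> t \<in> A"
proof (cases g)
  case Nil
  then show ?thesis using conductor[OF t] subring_mem[OF A(1) g(1)] by simp
next
  case (Cons b g')
  define m where "m = length g'"
  note c_carrier = subring_mem[OF A(1) g(1)]
  have e: "eval g t \<in> poly_span A t (Suc m)"
    using g(2) by (auto simp: poly_span_eq_eval Cons m_def intro!: exI[of _ "b # g'"])
  note e_carrier = poly_span_carrier[OF A(1) t e]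
  have y: "eval (c # g) t = c \<otimes> t [^] Suc m \<oplus> eval g t" by (simp add: Cons m_def)
  have "eval (c # g) t \<in> A" using conductor[OF one_closed] y c_carrier e_carrier t by simp
  then have "eval (c # g) t \<ominus> eval g t \<in> poly_span A t (Suc m)"
    using subset_poly_span_Suc[OF A(1) t] e
    by (intro submodule_over_minus(2)[OF A(1) submodule_over_poly_span[OF A(1) t]]) auto
  moreover have "eval (c # g) t \<ominus> eval g t = c \<otimes> t [^] Suc m"
    unfolding y using c_carrier e_carrier t by (simp add: a_minus_def a_assoc r_neg)
  ultimately have "integral_over A R (c \<otimes> t)"
    by (intro integral_over_leading_coeff[OF A(1) t g(1), of m]) simp
  then show ?thesis using A(2) c_carrier t by (auto simp: integral_closure_def)
qed

lemma integrally_closed_nilpotent_mem: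
  assumes A: "subring A R" "integral_closure A \<subseteq> A" and c: "c \<in> carrier R" and u: "u \<in> carrier R"
    and conductor: "\<And>s. s \<in> carrier R \<Longrightarrow> c [^] Suc k \<otimes> u \<otimes> s \<in> A" and s: "s \<in> carrier R"
  shows "u \<otimes> c \<otimes> s \<in> A"
proof -
  have "(u \<otimes> c \<otimes> s) [^] Suc k = (c [^] Suc k \<otimes> u) \<otimes> (u [^] k \<otimes> s [^] Suc k)"
    using u c s by (simp add: nat_pow_distrib m_ac)
  also have "\<dots> \<in> A" using conductor u s by simp
  finally have "integral_over A R (u \<otimes> c \<otimes> s)"
    using u c s by (intro integral_over_if_nat_pow_mem[OF A(1)]) simp_all
  then show ?thesis using A(2) u c s by (auto simp: integral_closure_def)
qed

text \<open>A factor \<open>u = \<one> - c\<^sup>k r\<close> makes the leading coefficient \<open>c\<close> nilpotent modulo the conductor of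
  \<open>A\<close>, so that the leading term can be dropped after multiplication by \<open>u\<close>.\<close>

lemma pi_regular_coeff_mem:
  assumes W: "subring W R" and A: "subring A R" "integral_closure A \<subseteq> A" "W \<subseteq> A"
    and t: "t \<in> carrier R"
    and reg: "\<And>x. x \<in> W \<Longrightarrow> \<exists>k. \<exists>r\<in>W. \<forall>s\<in>carrier R. x [^] Suc k \<otimes> (\<one> \<ominus> x [^] Suc k \<otimes> r) \<otimes> s \<in> A"
    and "set g \<subseteq> W" "\<And>s. s \<in> carrier R \<Longrightarrow> eval g t \<otimes> s \<in> A" "a \<in> set g"
  shows "a \<otimes> t \<in> A"
  using assms(7-)
proof (induction "length g" arbitrary: g a)
  case (Suc n)
  then obtain c g' where g: "g = c # g'" "length g' = n" by (cases g) auto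
  have c: "c \<in> W" "c \<in> carrier R" and g': "set g' \<subseteq> W" "set g' \<subseteq> carrier R"
    using Suc.prems(1) subringE(1)[OF W] unfolding g(1) by auto
  note W_closed = subringE[OF W]
  have ct: "c \<otimes> t \<in> A"
    using Suc.prems(1,2) A(3) unfolding g(1)
    by (intro integrally_closed_leading_coeff_mem[OF A(1,2) t]) auto
  show ?case
  proof (cases "a = c")
    case False
    then have a: "a \<in> set g'" "a \<in> W" "a \<in> carrier R" using Suc.prems(3) g' unfolding g(1) by auto
    obtain k r where r: "r \<in> W" "\<forall>s\<in>carrier R. c [^] Suc k \<otimes> (\<one> \<ominus> c [^] Suc k \<otimes> r) \<otimes> s \<in> A"
      using reg[OF c(1)] by blast
    define u where "u = \<one> \<ominus> c [^] Suc k \<otimes> r"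
    have u: "u \<in> W" unfolding u_def
      using subring_nat_pow[OF W c(1), of "Suc k"] r(1) by (intro subring_minus[OF W] W_closed(3,6))
    note u_carrier = subring_mem[OF W u] and r_carrier = subring_mem[OF W r(1)]
    have drop: "u \<otimes> c \<otimes> s \<in> A" if "s \<in> carrier R" for s
      using r(2) unfolding u_def[symmetric]
      by (intro integrally_closed_nilpotent_mem[OF A(1,2) c(2) u_carrier _ that]) blast
    have "(u \<otimes> a) \<otimes> t \<in> A"
    proof (rule Suc.hyps(1)[of "map ((\<otimes>) u) g'"])
      show "set (map ((\<otimes>) u) g') \<subseteq> W" using W_closed(6)[OF u] g'(1) by auto
      show "u \<otimes> a \<in> set (map ((\<otimes>) u) g')" using a(1) by simp
      fix s assume s: "s \<in> carrier R"
      have "eval (map ((\<otimes>) u) g') t \<otimes> s = eval g t \<otimes> (u \<otimes> s) \<ominus> u \<otimes> c \<otimes> (t [^] n \<otimes> s)"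
        using eval_map_smult_Cons[OF c(2) u_carrier t g'(2) s] g by simp
      then show "eval (map ((\<otimes>) u) g') t \<otimes> s \<in> A"
        using subring_minus[OF A(1) Suc.prems(2) drop] u_carrier s t by simp
    qed (use g(2) in simp)
    moreover have "(c [^] k \<otimes> r \<otimes> a) \<otimes> (c \<otimes> t) \<in> A"
      using subring_nat_pow[OF W c(1)] r(1) a(2) A(3)
      by (intro subringE(6)[OF A(1) _ ct] subsetD[OF A(3)] W_closed(6))
    moreover have "a \<otimes> t = (u \<otimes> a) \<otimes> t \<oplus> (c [^] k \<otimes> r \<otimes> a) \<otimes> (c \<otimes> t)"
    proof -
      have "a \<otimes> t = (\<one> \<ominus> v \<otimes> c \<otimes> r) \<otimes> a \<otimes> t \<oplus> (v \<otimes> r \<otimes> a) \<otimes> (c \<otimes> t)" if "v \<in> carrier R" for v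
        using a(3) c(2) r_carrier t that by algebra
      from this[of "c [^] k"] show ?thesis unfolding u_def using c(2) by simp
    qed
    ultimately show ?thesis using subringE(7)[OF A(1)] by metis
  qed (simp add: ct)
qed simp

theorem integral_ext_Int:
  assumes U: "subring U R" "integral_ext U R" and V: "subring V R" "integral_ext V R"
    and FCP: "FCP (U \<inter> V) R"
  shows "integral_ext (U \<inter> V) R"
proof -
  let ?A = "integral_closure (U \<inter> V)"
  have W: "subring (U \<inter> V) R" by (rule subring_inter[OF U(1) V(1)])
  note A = FCP_integral_closure[OF W FCP]
  have "t \<in> ?A" if t: "t \<in> carrier R" for t
  proof -
    obtain f where f: "set f \<subseteq> U \<inter> V" "\<ominus> \<one> \<in> set f" "eval f t = \<zero>"
      using FCP_relation[OF W FCP t] by blast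
    have "\<ominus> \<one> \<otimes> t \<in> ?A"
    proof (rule pi_regular_coeff_mem[OF W A(1) _ A(2) t _ f(1) _ f(2)])
      show "\<exists>k. \<exists>r\<in>U \<inter> V. \<forall>s\<in>carrier R. x [^] Suc k \<otimes> (\<one> \<ominus> x [^] Suc k \<otimes> r) \<otimes> s \<in> ?A"
        if "x \<in> U \<inter> V" for x
        using integral_Int_pi_regular[OF U V FCP that] A(2) by blast
      show "eval f t \<otimes> s \<in> ?A" if "s \<in> carrier R" for s
        using f(3) that subringE(2)[OF A(1)] by simp
    qed (simp add: A(3))
    then show ?thesis using subringE(5)[OF A(1)] t by (fastforce simp: l_minus)
  qed
  then show ?thesis by (simp add: integral_ext_def integral_closure_def)
qed

end

section \<open>Finite epimorphisms\<close>

definition (in ring) commutant :: "'a set \<Rightarrow> 'a set"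
  where "commutant A = {a \<in> carrier R. \<forall>x\<in>A. a \<otimes> x = x \<otimes> a}"

lemma (in ring) commutant_subring:
  assumes "A \<subseteq> carrier R"
  shows "subring (commutant A) R"
proof (rule subringI)
  have A: "x \<in> carrier R" if "x \<in> A" for x using that assms by auto
  show "commutant A \<subseteq> carrier R" "\<one> \<in> commutant A" using A by (auto simp: commutant_def)
  show "\<ominus> a \<in> commutant A" if "a \<in> commutant A" for a
    using that A by (simp add: commutant_def l_minus r_minus)
  fix a b assume ab_carrier: "a \<in> commutant A" "b \<in> commutant A"
  then show "a \<oplus> b \<in> commutant A" using A by (simp add: commutant_def l_distr r_distr)
  have "a \<otimes> b \<otimes> x = x \<otimes> (a \<otimes> b)" if "x \<in> A" for x
    using ab_carrier A[OF that] that by (simp add: commutant_def m_assoc) (simp flip: m_assoc)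
  then show "a \<otimes> b \<in> commutant A" using ab_carrier by (simp add: commutant_def)
qed

lemma (in ring) bicommutant_cring:
  assumes A: "A \<subseteq> carrier R" and comm: "\<And>x y. x \<in> A \<Longrightarrow> y \<in> A \<Longrightarrow> x \<otimes> y = y \<otimes> x"
  shows "cring (R\<lparr>carrier := commutant (commutant A)\<rparr>)" "A \<subseteq> commutant (commutant A)"
proof -
  let ?C = "commutant (commutant A)"
  have C: "subring ?C R" by (rule commutant_subring) (auto simp: commutant_def)
  show "A \<subseteq> ?C" using A by (auto simp: commutant_def)
  have "A \<subseteq> commutant A" using A comm by (auto simp: commutant_def)
  then have "?C \<subseteq> commutant A" by (auto simp: commutant_def)
  then have "a \<otimes> b = b \<otimes> a" if "a \<in> ?C" "b \<in> ?C" for a b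
    using that by (auto simp: commutant_def)
  then have "subcring ?C R" using C by (simp add: subcring_def subcring_axioms_def)
  then show "cring (R\<lparr>carrier := ?C\<rparr>)"
    using subcring_iff[OF subringE(1)[OF C]] by simp
qed

text \<open>The images of the two homomorphisms lie in a commutative subring of the target.\<close>

lemma epi_ext_commuting_homs:
  assumes B: "cring B" "epi_ext K B" and E: "ring E"
    and f: "f \<in> ring_hom B E" and g: "g \<in> ring_hom B E"
    and comm: "\<And>x y. x \<in> carrier B \<Longrightarrow> y \<in> carrier B \<Longrightarrow> f x \<otimes>\<^bsub>E\<^esub> g y = g y \<otimes>\<^bsub>E\<^esub> f x"
    and eq: "\<And>x. x \<in> K \<Longrightarrow> f x = g x" and x: "x \<in> carrier B"
  shows "f x = g x"
proof -
  interpret B: cring B by (rule B(1))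
  interpret E: ring E by (rule E)
  let ?A = "f ` carrier B \<union> g ` carrier B"
  have "u \<otimes>\<^bsub>E\<^esub> v = v \<otimes>\<^bsub>E\<^esub> u" if "u \<in> ?A" "v \<in> ?A" for u v
    using that comm[symmetric] comm
    by (elim UnE imageE) (simp_all add: B.m_comm flip: ring_hom_mult[OF f] ring_hom_mult[OF g])
  moreover have "?A \<subseteq> carrier E" using ring_hom_closed[OF f] ring_hom_closed[OF g] by auto
  ultimately have A: "cring (E\<lparr>carrier := E.commutant (E.commutant ?A)\<rparr>)"
      "?A \<subseteq> E.commutant (E.commutant ?A)"
    using E.bicommutant_cring[of ?A] by simp_all
  have "f \<in> ring_hom B (E\<lparr>carrier := E.commutant (E.commutant ?A)\<rparr>)"
    "g \<in> ring_hom B (E\<lparr>carrier := E.commutant (E.commutant ?A)\<rparr>)"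
    using f g A(2) by (auto simp: ring_hom_def)
  then show ?thesis using epi_ext_eq[OF B A(1) _ _ _ x] eq by simp
qed

definition additive_maps :: "('g, 'b) ring_scheme \<Rightarrow> ('h, 'c) ring_scheme \<Rightarrow> ('g \<Rightarrow> 'h) set"
  where "additive_maps G H = {\<phi> \<in> carrier G \<rightarrow>\<^sub>E carrier H.
    \<forall>x\<in>carrier G. \<forall>y\<in>carrier G. \<phi> (x \<oplus>\<^bsub>G\<^esub> y) = \<phi> x \<oplus>\<^bsub>H\<^esub> \<phi> y}"

lemma additive_mapsI:
  assumes "\<And>x. x \<in> carrier G \<Longrightarrow> \<phi> x \<in> carrier H" "\<phi> \<in> extensional (carrier G)"
    "\<And>x y. x \<in> carrier G \<Longrightarrow> y \<in> carrier G \<Longrightarrow> \<phi> (x \<oplus>\<^bsub>G\<^esub> y) = \<phi> x \<oplus>\<^bsub>H\<^esub> \<phi> y"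
  shows "\<phi> \<in> additive_maps G H"
  using assms by (auto simp: additive_maps_def PiE_def)

lemma additive_mapsE:
  assumes "\<phi> \<in> additive_maps G H"
  shows "x \<in> carrier G \<Longrightarrow> \<phi> x \<in> carrier H" "\<phi> \<in> extensional (carrier G)"
    "x \<in> carrier G \<Longrightarrow> y \<in> carrier G \<Longrightarrow> \<phi> (x \<oplus>\<^bsub>G\<^esub> y) = \<phi> x \<oplus>\<^bsub>H\<^esub> \<phi> y"
  using assms by (auto simp: additive_maps_def PiE_def)

lemma abelian_group_pointwise:
  fixes F :: "('g \<Rightarrow> 'h) ring"
  assumes G: "abelian_group G" and H: "abelian_group H" and maps: "carrier F \<subseteq> additive_maps G H"
    and zero: "\<zero>\<^bsub>F\<^esub> = (\<lambda>x\<in>carrier G. \<zero>\<^bsub>H\<^esub>)"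
    and add: "\<And>\<phi> \<psi>. \<phi> \<oplus>\<^bsub>F\<^esub> \<psi> = (\<lambda>x\<in>carrier G. \<phi> x \<oplus>\<^bsub>H\<^esub> \<psi> x)"
    and closed: "\<zero>\<^bsub>F\<^esub> \<in> carrier F" "\<And>\<phi> \<psi>. \<phi> \<in> carrier F \<Longrightarrow> \<psi> \<in> carrier F \<Longrightarrow> \<phi> \<oplus>\<^bsub>F\<^esub> \<psi> \<in> carrier F"
      "\<And>\<phi>. \<phi> \<in> carrier F \<Longrightarrow> (\<lambda>x\<in>carrier G. \<ominus>\<^bsub>H\<^esub> \<phi> x) \<in> carrier F"
  shows "abelian_group F"
proof (rule abelian_groupI)
  interpret G: abelian_group G by (rule G)
  interpret H: abelian_group H by (rule H)
  have in_H: "\<phi> x \<in> carrier H" if "\<phi> \<in> carrier F" "x \<in> carrier G" for \<phi> x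
    by (rule additive_mapsE(1)[OF subsetD[OF maps that(1)] that(2)])
  fix \<phi> assume \<phi>: "\<phi> \<in> carrier F"
  have "(\<lambda>x\<in>carrier G. \<ominus>\<^bsub>H\<^esub> \<phi> x) \<oplus>\<^bsub>F\<^esub> \<phi> = \<zero>\<^bsub>F\<^esub>"
    unfolding add zero by (rule restrict_ext) (simp add: in_H[OF \<phi>] H.l_neg)
  then show "\<exists>\<psi>\<in>carrier F. \<psi> \<oplus>\<^bsub>F\<^esub> \<phi> = \<zero>\<^bsub>F\<^esub>" using closed(3)[OF \<phi>] by blast
  have "\<phi> \<in> extensional (carrier G)" by (rule additive_mapsE(2)[OF subsetD[OF maps \<phi>]])
  then show "\<zero>\<^bsub>F\<^esub> \<oplus>\<^bsub>F\<^esub> \<phi> = \<phi>"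
    unfolding add zero by (intro extensionalityI[of _ "carrier G"]) (auto simp: in_H[OF \<phi>])
  fix \<psi> assume \<psi>: "\<psi> \<in> carrier F"
  show "\<phi> \<oplus>\<^bsub>F\<^esub> \<psi> = \<psi> \<oplus>\<^bsub>F\<^esub> \<phi>"
    unfolding add by (rule restrict_ext) (simp add: in_H \<phi> \<psi> H.a_comm)
  fix \<chi> assume \<chi>: "\<chi> \<in> carrier F"
  show "\<phi> \<oplus>\<^bsub>F\<^esub> \<psi> \<oplus>\<^bsub>F\<^esub> \<chi> = \<phi> \<oplus>\<^bsub>F\<^esub> (\<psi> \<oplus>\<^bsub>F\<^esub> \<chi>)"
    unfolding add by (rule restrict_ext) (simp add: in_H \<phi> \<psi> \<chi> H.a_assoc)
qed (fact closed)+

definition endo_ring :: "('g, 'b) ring_scheme \<Rightarrow> ('g \<Rightarrow> 'g) ring"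
  where "endo_ring G =
    \<lparr>carrier = additive_maps G G, monoid.mult = compose (carrier G), one = (\<lambda>x\<in>carrier G. x),
     ring.zero = (\<lambda>x\<in>carrier G. \<zero>\<^bsub>G\<^esub>), add = (\<lambda>\<phi> \<psi>. \<lambda>x\<in>carrier G. \<phi> x \<oplus>\<^bsub>G\<^esub> \<psi> x)\<rparr>"

lemma endo_ring_simps:
  "carrier (endo_ring G) = additive_maps G G"
  "\<phi> \<otimes>\<^bsub>endo_ring G\<^esub> \<psi> = (\<lambda>x\<in>carrier G. \<phi> (\<psi> x))"
  "\<one>\<^bsub>endo_ring G\<^esub> = (\<lambda>x\<in>carrier G. x)"
  "\<zero>\<^bsub>endo_ring G\<^esub> = (\<lambda>x\<in>carrier G. \<zero>\<^bsub>G\<^esub>)"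
  "\<phi> \<oplus>\<^bsub>endo_ring G\<^esub> \<psi> = (\<lambda>x\<in>carrier G. \<phi> x \<oplus>\<^bsub>G\<^esub> \<psi> x)"
  by (simp_all add: endo_ring_def compose_def)

lemma endo_ring_ring:
  assumes "abelian_group G"
  shows "ring (endo_ring G)"
proof (rule ringI)
  interpret G: abelian_group G by fact
  note E = additive_mapsE[of _ G G] and simps = endo_ring_simps
  have closed: "\<phi> \<otimes>\<^bsub>endo_ring G\<^esub> \<psi> \<in> carrier (endo_ring G)"
    "\<phi> \<oplus>\<^bsub>endo_ring G\<^esub> \<psi> \<in> carrier (endo_ring G)"
    if "\<phi> \<in> carrier (endo_ring G)" "\<psi> \<in> carrier (endo_ring G)" for \<phi> \<psi>
    using that unfolding simps by (auto intro!: additive_mapsI simp: E(1,3) G.a_ac)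
  have units: "\<one>\<^bsub>endo_ring G\<^esub> \<in> carrier (endo_ring G)" "\<zero>\<^bsub>endo_ring G\<^esub> \<in> carrier (endo_ring G)"
    unfolding simps by (auto intro!: additive_mapsI)
  show "abelian_group (endo_ring G)"
  proof (rule abelian_group_pointwise[OF assms assms])
    show "(\<lambda>x\<in>carrier G. \<ominus>\<^bsub>G\<^esub> \<phi> x) \<in> carrier (endo_ring G)" if "\<phi> \<in> carrier (endo_ring G)" for \<phi>
      using that unfolding simps by (auto intro!: additive_mapsI simp: E(1,3) G.minus_add)
  qed (use closed units in \<open>auto simp: simps\<close>)
  show "monoid (endo_ring G)"
  proof (rule monoidI)
    fix \<phi> assume \<phi>: "\<phi> \<in> carrier (endo_ring G)"
    show "\<one>\<^bsub>endo_ring G\<^esub> \<otimes>\<^bsub>endo_ring G\<^esub> \<phi> = \<phi>" "\<phi> \<otimes>\<^bsub>endo_ring G\<^esub> \<one>\<^bsub>endo_ring G\<^esub> = \<phi>"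
      unfolding simps
      by (rule extensionalityI[of _ "carrier G"]; use \<phi>[unfolded simps] in \<open>simp add: E\<close>)+
    fix \<psi> \<chi> assume "\<psi> \<in> carrier (endo_ring G)" "\<chi> \<in> carrier (endo_ring G)"
    with \<phi> show "\<phi> \<otimes>\<^bsub>endo_ring G\<^esub> \<psi> \<otimes>\<^bsub>endo_ring G\<^esub> \<chi> = \<phi> \<otimes>\<^bsub>endo_ring G\<^esub> (\<psi> \<otimes>\<^bsub>endo_ring G\<^esub> \<chi>)"
      unfolding simps by (intro restrict_ext) (simp add: E(1))
  qed (use closed units in auto)
  fix \<phi> \<psi> \<chi> assume "\<phi> \<in> carrier (endo_ring G)" "\<psi> \<in> carrier (endo_ring G)"
    "\<chi> \<in> carrier (endo_ring G)"
  then show "(\<phi> \<oplus>\<^bsub>endo_ring G\<^esub> \<psi>) \<otimes>\<^bsub>endo_ring G\<^esub> \<chi> = \<phi> \<otimes>\<^bsub>endo_ring G\<^esub> \<chi> \<oplus>\<^bsub>endo_ring G\<^esub> \<psi> \<otimes>\<^bsub>endo_ring G\<^esub> \<chi>"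
    "\<chi> \<otimes>\<^bsub>endo_ring G\<^esub> (\<phi> \<oplus>\<^bsub>endo_ring G\<^esub> \<psi>) = \<chi> \<otimes>\<^bsub>endo_ring G\<^esub> \<phi> \<oplus>\<^bsub>endo_ring G\<^esub> \<chi> \<otimes>\<^bsub>endo_ring G\<^esub> \<psi>"
    unfolding simps by (auto intro!: restrict_ext simp: E(1,3))
qed

text \<open>Only the additive group is meant: multiplication and unit are junk.\<close>

definition linear_maps ::
    "'a set \<Rightarrow> ('a, 'b) ring_scheme \<Rightarrow> ('c, 'd) ring_scheme \<Rightarrow> ('a \<Rightarrow> 'c) \<Rightarrow> ('a \<Rightarrow> 'c) ring"
  where "linear_maps K R S h =
    \<lparr>carrier = {\<phi> \<in> additive_maps R S. \<forall>a\<in>K. \<forall>x\<in>carrier R. \<phi> (a \<otimes>\<^bsub>R\<^esub> x) = h a \<otimes>\<^bsub>S\<^esub> \<phi> x},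
     monoid.mult = undefined, one = undefined,
     ring.zero = (\<lambda>x\<in>carrier R. \<zero>\<^bsub>S\<^esub>), add = (\<lambda>\<phi> \<psi>. \<lambda>x\<in>carrier R. \<phi> x \<oplus>\<^bsub>S\<^esub> \<psi> x)\<rparr>"

lemma linear_maps_simps:
  "\<phi> \<in> carrier (linear_maps K R S h) \<longleftrightarrow>
    \<phi> \<in> additive_maps R S \<and> (\<forall>a\<in>K. \<forall>x\<in>carrier R. \<phi> (a \<otimes>\<^bsub>R\<^esub> x) = h a \<otimes>\<^bsub>S\<^esub> \<phi> x)"
  "\<zero>\<^bsub>linear_maps K R S h\<^esub> = (\<lambda>x\<in>carrier R. \<zero>\<^bsub>S\<^esub>)"
  "\<phi> \<oplus>\<^bsub>linear_maps K R S h\<^esub> \<psi> = (\<lambda>x\<in>carrier R. \<phi> x \<oplus>\<^bsub>S\<^esub> \<psi> x)"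
  by (simp_all add: linear_maps_def)

context ring_hom_cring
begin

lemma linear_maps_abelian_group:
  assumes K: "K \<subseteq> carrier R"
  shows "abelian_group (linear_maps K R S h)"
proof (rule abelian_group_pointwise[OF R.abelian_group_axioms S.abelian_group_axioms])
  note simps = linear_maps_simps and E = additive_mapsE[of _ R S]
  have K_carrier: "a \<in> carrier R" if "a \<in> K" for a using that K by blast
  show "\<zero>\<^bsub>linear_maps K R S h\<^esub> \<in> carrier (linear_maps K R S h)"
    unfolding simps by (auto intro!: additive_mapsI simp: K_carrier)
  fix \<phi> assume \<phi>: "\<phi> \<in> carrier (linear_maps K R S h)"
  then show "(\<lambda>x\<in>carrier R. \<ominus>\<^bsub>S\<^esub> \<phi> x) \<in> carrier (linear_maps K R S h)"
    unfolding simps by (auto intro!: additive_mapsI simp: K_carrier E(1,3) S.minus_add S.r_minus)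
  fix \<psi> assume "\<psi> \<in> carrier (linear_maps K R S h)"
  with \<phi> show "\<phi> \<oplus>\<^bsub>linear_maps K R S h\<^esub> \<psi> \<in> carrier (linear_maps K R S h)"
    unfolding simps by (auto intro!: additive_mapsI simp: K_carrier E(1,3) S.a_ac S.r_distr)
qed (auto simp: linear_maps_simps)

definition post_mult :: "'a set \<Rightarrow> 'a \<Rightarrow> ('a \<Rightarrow> 'c) \<Rightarrow> 'a \<Rightarrow> 'c"
  where "post_mult K b = (\<lambda>\<phi>\<in>carrier (linear_maps K R S h). \<lambda>x\<in>carrier R. h b \<otimes>\<^bsub>S\<^esub> \<phi> x)"

definition pre_mult :: "'a set \<Rightarrow> 'a \<Rightarrow> ('a \<Rightarrow> 'c) \<Rightarrow> 'a \<Rightarrow> 'c"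
  where "pre_mult K b = (\<lambda>\<phi>\<in>carrier (linear_maps K R S h). \<lambda>x\<in>carrier R. \<phi> (b \<otimes> x))"

lemma mult_linear_maps:
  assumes K: "K \<subseteq> carrier R" and \<phi>: "\<phi> \<in> carrier (linear_maps K R S h)" and b: "b \<in> carrier R"
  shows "post_mult K b \<phi> \<in> carrier (linear_maps K R S h)"
    and "pre_mult K b \<phi> \<in> carrier (linear_maps K R S h)"
proof -
  have \<phi>': "\<phi> \<in> additive_maps R S" "\<And>a x. a \<in> K \<Longrightarrow> x \<in> carrier R \<Longrightarrow> \<phi> (a \<otimes> x) = h a \<otimes>\<^bsub>S\<^esub> \<phi> x"
    using \<phi> by (auto simp: linear_maps_simps)
  have K_carrier: "a \<in> carrier R" if "a \<in> K" for a using that K by blast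
  note E = additive_mapsE[OF \<phi>'(1)]
  show "post_mult K b \<phi> \<in> carrier (linear_maps K R S h)"
    unfolding post_mult_def restrict_apply'[OF \<phi>] linear_maps_simps
    using b by (auto intro!: additive_mapsI simp: E(1,3) \<phi>'(2) K_carrier S.r_distr S.m_lcomm)
  show "pre_mult K b \<phi> \<in> carrier (linear_maps K R S h)"
    unfolding pre_mult_def restrict_apply'[OF \<phi>] linear_maps_simps
    using b by (auto intro!: additive_mapsI simp: E(1,3) \<phi>'(2) K_carrier R.r_distr R.m_lcomm[of b])
qed

abbreviation linear_endos :: "'a set \<Rightarrow> (('a \<Rightarrow> 'c) \<Rightarrow> 'a \<Rightarrow> 'c) ring"
  where "linear_endos K \<equiv> endo_ring (linear_maps K R S h)"

lemma mult_linear_maps_apply: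
  assumes "\<phi> \<in> carrier (linear_maps K R S h)" "x \<in> carrier R"
  shows "post_mult K b \<phi> x = h b \<otimes>\<^bsub>S\<^esub> \<phi> x" "pre_mult K b \<phi> x = \<phi> (b \<otimes> x)"
  using assms by (simp_all add: post_mult_def pre_mult_def)

lemma linear_maps_eqI:
  assumes "\<phi> \<in> carrier (linear_maps K R S h)" "\<psi> \<in> carrier (linear_maps K R S h)"
    and "\<And>x. x \<in> carrier R \<Longrightarrow> \<phi> x = \<psi> x"
  shows "\<phi> = \<psi>"
  using assms additive_mapsE(2)
  by (intro extensionalityI[of _ "carrier R"]) (auto simp: linear_maps_simps)

lemma linear_endos_eqI:
  assumes "F \<in> carrier (linear_endos K)" "G \<in> carrier (linear_endos K)"
    and "\<And>\<phi> x. \<phi> \<in> carrier (linear_maps K R S h) \<Longrightarrow> x \<in> carrier R \<Longrightarrow> F \<phi> x = G \<phi> x"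
  shows "F = G"
proof (rule extensionalityI)
  note FG = assms(1,2)[unfolded endo_ring_simps(1)]
  show "F \<in> extensional (carrier (linear_maps K R S h))"
    "G \<in> extensional (carrier (linear_maps K R S h))"
    by (rule additive_mapsE(2)[OF FG(1)], rule additive_mapsE(2)[OF FG(2)])
  fix \<phi> assume \<phi>: "\<phi> \<in> carrier (linear_maps K R S h)"
  show "F \<phi> = G \<phi>"
    by (rule linear_maps_eqI[OF additive_mapsE(1)[OF FG(1) \<phi>] additive_mapsE(1)[OF FG(2) \<phi>]
      assms(3)[OF \<phi>]])
qed

lemma mult_linear_endos:
  assumes K: "K \<subseteq> carrier R" and b: "b \<in> carrier R"
  shows "post_mult K b \<in> carrier (linear_endos K)" and "pre_mult K b \<in> carrier (linear_endos K)"
  unfolding endo_ring_simps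
proof -
  let ?G = "linear_maps K R S h"
  interpret G: abelian_group ?G by (rule linear_maps_abelian_group[OF K])
  note mult_closed = mult_linear_maps[OF K _ b] and mult_apply_at = mult_linear_maps_apply
  have in_S: "\<phi> x \<in> carrier S" if "\<phi> \<in> carrier ?G" "x \<in> carrier R" for \<phi> x
    using additive_mapsE(1) that by (auto simp: linear_maps_simps)
  have plus_apply: "(\<phi> \<oplus>\<^bsub>?G\<^esub> \<psi>) x = \<phi> x \<oplus>\<^bsub>S\<^esub> \<psi> x" if "x \<in> carrier R" for \<phi> \<psi> x
    using that by (simp add: linear_maps_simps)
  show "post_mult K b \<in> additive_maps ?G ?G"
  proof (rule additive_mapsI)
    fix \<phi> \<psi> assume \<phi>\<psi>: "\<phi> \<in> carrier ?G" "\<psi> \<in> carrier ?G"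
    have "post_mult K b (\<phi> \<oplus>\<^bsub>?G\<^esub> \<psi>) x = (post_mult K b \<phi> \<oplus>\<^bsub>?G\<^esub> post_mult K b \<psi>) x"
      if "x \<in> carrier R" for x
      using \<phi>\<psi> that b in_S by (simp add: mult_apply_at plus_apply S.r_distr)
    then show "post_mult K b (\<phi> \<oplus>\<^bsub>?G\<^esub> \<psi>) = post_mult K b \<phi> \<oplus>\<^bsub>?G\<^esub> post_mult K b \<psi>"
      by (intro linear_maps_eqI[of _ K] mult_closed G.a_closed \<phi>\<psi>)
  qed (use mult_closed in \<open>auto simp: post_mult_def\<close>)
  show "pre_mult K b \<in> additive_maps ?G ?G"
  proof (rule additive_mapsI)
    fix \<phi> \<psi> assume \<phi>\<psi>: "\<phi> \<in> carrier ?G" "\<psi> \<in> carrier ?G"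
    have "pre_mult K b (\<phi> \<oplus>\<^bsub>?G\<^esub> \<psi>) x = (pre_mult K b \<phi> \<oplus>\<^bsub>?G\<^esub> pre_mult K b \<psi>) x"
      if "x \<in> carrier R" for x
      using \<phi>\<psi> that b by (simp add: mult_apply_at plus_apply)
    then show "pre_mult K b (\<phi> \<oplus>\<^bsub>?G\<^esub> \<psi>) = pre_mult K b \<phi> \<oplus>\<^bsub>?G\<^esub> pre_mult K b \<psi>"
      by (intro linear_maps_eqI[of _ K] mult_closed G.a_closed \<phi>\<psi>)
  qed (use mult_closed in \<open>auto simp: pre_mult_def\<close>)
qed

lemma mult_linear_maps_ring_hom:
  assumes K: "K \<subseteq> carrier R"
  shows "post_mult K \<in> ring_hom R (linear_endos K)" and "pre_mult K \<in> ring_hom R (linear_endos K)"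
    and "b \<in> carrier R \<Longrightarrow> c \<in> carrier R \<Longrightarrow>
      post_mult K b \<otimes>\<^bsub>linear_endos K\<^esub> pre_mult K c = pre_mult K c \<otimes>\<^bsub>linear_endos K\<^esub> post_mult K b"
proof -
  let ?E = "linear_endos K"
  let ?G = "linear_maps K R S h"
  interpret G: abelian_group ?G by (rule linear_maps_abelian_group[OF K])
  interpret E: ring ?E by (rule endo_ring_ring[OF linear_maps_abelian_group[OF K]])
  note mem = mult_linear_endos[OF K] and mult_closed = mult_linear_maps[OF K]
    and mult_apply_at = mult_linear_maps_apply and simps = endo_ring_simps
  have in_S: "\<phi> x \<in> carrier S" "\<phi> (x \<oplus> y) = \<phi> x \<oplus>\<^bsub>S\<^esub> \<phi> y"
    if "\<phi> \<in> carrier ?G" "x \<in> carrier R" "y \<in> carrier R" for \<phi> x y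
    using additive_mapsE(1,3) that by (auto simp: linear_maps_simps)
  have add_apply: "(F \<oplus>\<^bsub>?E\<^esub> F') \<phi> x = F \<phi> x \<oplus>\<^bsub>S\<^esub> F' \<phi> x"
    if "\<phi> \<in> carrier ?G" "x \<in> carrier R" for F F' \<phi> x
    using that by (simp add: simps linear_maps_simps(3))
  have mult_apply: "(F \<otimes>\<^bsub>?E\<^esub> F') \<phi> x = F (F' \<phi>) x" "\<one>\<^bsub>?E\<^esub> \<phi> x = \<phi> x"
    if "\<phi> \<in> carrier ?G" for F F' \<phi> x
    using that by (simp_all add: simps)
  show "post_mult K \<in> ring_hom R ?E"
    by (rule ring_hom_memI; (rule linear_endos_eqI)?)
      (auto simp: mem mult_apply_at mult_closed mult_apply add_apply in_S S.m_assoc S.l_distr)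
  show "pre_mult K \<in> ring_hom R ?E"
    by (rule ring_hom_memI; (rule linear_endos_eqI)?)
      (auto simp: mem mult_apply_at mult_closed mult_apply add_apply in_S R.l_distr R.m_assoc
        R.m_lcomm)
  show "post_mult K b \<otimes>\<^bsub>?E\<^esub> pre_mult K c = pre_mult K c \<otimes>\<^bsub>?E\<^esub> post_mult K b"
    if "b \<in> carrier R" "c \<in> carrier R"
    by (rule linear_endos_eqI) (use that in \<open>auto simp: mem mult_apply_at mult_closed mult_apply\<close>)
qed

lemma epi_ext_linear_map:
  assumes epi: "epi_ext K R" and K: "K \<subseteq> carrier R" and \<phi>: "\<phi> \<in> carrier (linear_maps K R S h)"
    and b: "b \<in> carrier R"
  shows "\<phi> b = h b \<otimes>\<^bsub>S\<^esub> \<phi> \<one>"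
proof -
  have "post_mult K a = pre_mult K a" if a: "a \<in> K" for a
  proof (rule linear_endos_eqI)
    have "a \<in> carrier R" using a K by blast
    then show "post_mult K a \<in> carrier (linear_endos K)" "pre_mult K a \<in> carrier (linear_endos K)"
      using mult_linear_endos[OF K] by blast+
  qed (use a in \<open>auto simp: mult_linear_maps_apply linear_maps_simps\<close>)
  then have "post_mult K b = pre_mult K b"
    using epi_ext_commuting_homs[OF R.is_cring epi
        endo_ring_ring[OF linear_maps_abelian_group[OF K]] mult_linear_maps_ring_hom[OF K]] b by blast
  then show ?thesis
    using mult_linear_maps_apply[OF \<phi> R.one_closed] b by (metis R.r_one)
qed

end

context cring
begin

lemma line_extension_coordinate:
  assumes "K \<subseteq> carrier R" "N \<subseteq> carrier R" "g \<in> carrier R" "y \<in> line_extension K g N"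
  shows "\<exists>a\<in>K. y \<ominus> a \<otimes> g \<in> N"
proof -
  obtain a v where a: "a \<in> K" "v \<in> N" "y = a \<otimes> g \<oplus> v"
    using assms(4) by (auto simp: line_extension_mem_iff)
  then have "y \<ominus> a \<otimes> g = v" using assms(1-3) by (auto simp: a_minus_def a_ac r_neg subset_iff)
  then show ?thesis using a(1,2) by blast
qed

lemma coordinate_coset_eq:
  assumes K: "subring K R" and N: "submodule_over K N" and g: "g \<in> carrier R"
    and J: "ideal J R" "{a \<in> K. a \<otimes> g \<in> N} \<subseteq> J" and y: "y \<in> carrier R"
    and a: "a \<in> K" "y \<ominus> a \<otimes> g \<in> N" and b: "b \<in> K" "y \<ominus> b \<otimes> g \<in> N"
  shows "J +> a = J +> b"
proof -
  note ab_carrier = subring_mem[OF K a(1)] subring_mem[OF K b(1)]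
  have "(a \<ominus> b) \<otimes> g = (y \<ominus> b \<otimes> g) \<ominus> (y \<ominus> a \<otimes> g)" using ab_carrier y g by algebra
  also have "\<dots> \<in> N" by (rule submodule_over_minus(2)[OF K N a(2) b(2)])
  finally have "a \<ominus> b \<in> J" using J(2) subring_minus[OF K a(1) b(1)] by blast
  then show ?thesis using quotient_eq_iff_same_a_r_cos[OF J(1) ab_carrier] by simp
qed

text \<open>The map \<open>a g + v \<mapsto> a\<close> from \<open>R = K g + N\<close> to \<open>R / J\<close> is \<open>K\<close>-linear and vanishes on \<open>N\<close>.\<close>

lemma line_extension_functional:
  assumes K: "subring K R" and N: "submodule_over K N" and g: "g \<in> carrier R"
    and R: "carrier R = line_extension K g N"
    and J: "ideal J R" "{a \<in> K. a \<otimes> g \<in> N} \<subseteq> J"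
  obtains \<phi> where "\<phi> \<in> carrier (linear_maps K R (R Quot J) ((+>) J))"
    and "\<And>v. v \<in> N \<Longrightarrow> \<phi> v = \<zero>\<^bsub>R Quot J\<^esub>" and "\<phi> g = \<one>\<^bsub>R Quot J\<^esub>"
proof -
  interpret h: ring_hom_cring R "R Quot J" "(+>) J"
    by (rule ideal.rcos_ring_hom_cring[OF J(1) is_cring])
  note K_closed = subringE[OF K] and K_carrier = subring_mem[OF K]
    and N_closed = submodule_overE[OF N]
  have "\<forall>y\<in>carrier R. \<exists>a\<in>K. y \<ominus> a \<otimes> g \<in> N"
    using line_extension_coordinate[OF K_closed(1) N_closed(1) g] R by blast
  then obtain l where l: "\<And>y. y \<in> carrier R \<Longrightarrow> l y \<in> K" "\<And>y. y \<in> carrier R \<Longrightarrow> y \<ominus> l y \<otimes> g \<in> N"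
    by metis
  define \<phi> where "\<phi> = (\<lambda>y\<in>carrier R. J +> l y)"
  have \<phi>_l: "\<phi> y = J +> l y" if "y \<in> carrier R" for y using that by (simp add: \<phi>_def)
  have \<phi>: "\<phi> y = J +> a" if "y \<in> carrier R" "a \<in> K" "y \<ominus> a \<otimes> g \<in> N" for y a
    using coordinate_coset_eq[OF K N g J that(1) l[OF that(1)] that(2,3)] \<phi>_l[OF that(1)] by simp
  have "\<phi> \<in> carrier (linear_maps K R (R Quot J) ((+>) J))"
    unfolding linear_maps_simps
  proof (intro conjI ballI additive_mapsI)
    fix x y assume xy: "x \<in> carrier R" "y \<in> carrier R"
    note lx = l[OF xy(1)] and ly = l[OF xy(2)]
    have "(x \<oplus> y) \<ominus> (l x \<oplus> l y) \<otimes> g = (x \<ominus> l x \<otimes> g) \<oplus> (y \<ominus> l y \<otimes> g)"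
      using xy K_carrier[OF lx(1)] K_carrier[OF ly(1)] g by algebra
    then have "\<phi> (x \<oplus> y) = J +> (l x \<oplus> l y)"
      using N_closed(4)[OF lx(2) ly(2)] K_closed(7)[OF lx(1) ly(1)] xy by (intro \<phi>) auto
    then show "\<phi> (x \<oplus> y) = \<phi> x \<oplus>\<^bsub>R Quot J\<^esub> \<phi> y"
      using \<phi>_l[OF xy(1)] \<phi>_l[OF xy(2)] K_carrier lx(1) ly(1) by simp
  next
    fix k x assume k: "k \<in> K" and x: "x \<in> carrier R"
    note lx = l[OF x]
    have "k \<otimes> x \<ominus> (k \<otimes> l x) \<otimes> g = k \<otimes> (x \<ominus> l x \<otimes> g)"
      using x K_carrier[OF lx(1)] K_carrier[OF k] g by algebra
    then have "\<phi> (k \<otimes> x) = J +> (k \<otimes> l x)"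
      using N_closed(5)[OF k lx(2)] K_closed(6)[OF k lx(1)] x K_carrier[OF k] by (intro \<phi>) auto
    then show "\<phi> (k \<otimes> x) = (J +> k) \<otimes>\<^bsub>R Quot J\<^esub> \<phi> x"
      using \<phi>_l[OF x] K_carrier k lx(1) by simp
  qed (use l K_carrier in \<open>auto simp: \<phi>_def\<close>)
  moreover have "\<phi> v = \<zero>\<^bsub>R Quot J\<^esub>" if "v \<in> N" for v
    using \<phi>[OF _ K_closed(2), of v] N_closed(2)[OF that] that g h.hom_zero
    by (simp add: a_minus_def)
  moreover have "\<phi> g = \<one>\<^bsub>R Quot J\<^esub>"
    using \<phi>[OF _ K_closed(3), of g] N_closed(3) g h.hom_one by (simp add: a_minus_def r_neg)
  ultimately show ?thesis using that by blast
qed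

lemma Span_ideal:
  assumes K: "subring K R" and I: "submodule_over K I" "I \<subseteq> K"
    and gs: "set gs \<subseteq> carrier R" "carrier R = Span K gs"
  shows "ideal (Span I gs) R" and "I \<subseteq> Span I gs"
proof -
  note S = submodule_over_Span[OF K I(1) gs(1)] and I_closed = submodule_overE[OF I(1)]
  have I_mult: "i \<otimes> u \<in> Span I gs" if i: "i \<in> I" and u: "u \<in> carrier R" for i u
  proof -
    have "u \<in> line_extensions K gs {\<zero>}" using u gs(2) by (simp add: Span_eq_line_extensions)
    then show ?thesis
      unfolding Span_eq_line_extensions
      using I_closed(2)[OF i] I_closed(5) i gs(1) subring_mem[OF K]
      by (intro line_extensions_smult[of K "{\<zero>}" gs i]) (auto simp: m_comm[of i])
  qed
  show "I \<subseteq> Span I gs" using I_mult[OF _ one_closed] I_closed(2) by fastforce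
  have "u \<otimes> v \<in> Span I gs" if u: "u \<in> carrier R" and v: "v \<in> Span I gs" for u v
  proof -
    let ?M = "{v \<in> carrier R. u \<otimes> v \<in> Span I gs}"
    have "submodule_over K ?M"
      using submodule_overE[OF S] subring_mem[OF K] u
      by (intro submodule_overI) (auto simp: r_distr m_lcomm)
    moreover have "d \<otimes> g \<in> ?M" if "d \<in> I" "g \<in> set gs" for d g
    proof -
      have "g \<in> carrier R" using that gs(1) by blast
      then show ?thesis
        using I_mult[OF that(1), of "u \<otimes> g"] u I_closed(2)[OF that(1)] by (simp add: m_lcomm)
    qed
    ultimately have "Span I gs \<subseteq> ?M" by (rule Span_subsetI)
    then show ?thesis using v by blast
  qed
  then show "ideal (Span I gs) R"
    using submodule_overE[OF S] by (intro submodule_over_carrier_imp_ideal submodule_overI)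
qed

text \<open>If \<open>g \<notin> N\<close>, the functional above and Nakayama's lemma for \<open>I = (N : g)\<close> contradict
  each other.\<close>

lemma epi_ext_line_extension:
  assumes K: "subring K R" and epi: "epi_ext K R"
    and gs: "set gs \<subseteq> carrier R" "carrier R = Span K gs"
    and N: "submodule_over K N" "\<one> \<in> N" and g: "g \<in> carrier R"
    and R: "carrier R = line_extension K g N"
  shows "g \<in> N"
proof -
  let ?I = "{a \<in> K. a \<otimes> g \<in> N}"
  note K_carrier = subring_mem[OF K] and N_closed = submodule_overE[OF N(1)]
  have I: "submodule_over K ?I"
    using subringE[OF K] K_carrier N_closed g
    by (intro submodule_overI) (auto simp: l_distr m_assoc)
  let ?J = "Span ?I gs"
  have J: "ideal ?J R" "?I \<subseteq> ?J" using Span_ideal[OF K I _ gs] by auto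
  interpret J: ideal ?J R by (rule J(1))
  interpret h: ring_hom_cring R "R Quot ?J" "(+>) ?J" by (rule J.rcos_ring_hom_cring[OF is_cring])
  obtain \<phi> where \<phi>: "\<phi> \<in> carrier (linear_maps K R (R Quot ?J) ((+>) ?J))"
      "\<And>v. v \<in> N \<Longrightarrow> \<phi> v = \<zero>\<^bsub>R Quot ?J\<^esub>" "\<phi> g = \<one>\<^bsub>R Quot ?J\<^esub>"
    using line_extension_functional[OF K N(1) g R J] by blast
  have "\<one>\<^bsub>R Quot ?J\<^esub> = \<zero>\<^bsub>R Quot ?J\<^esub>"
    using h.epi_ext_linear_map[OF epi subringE(1)[OF K] \<phi>(1) g] \<phi>(2)[OF N(2)] \<phi>(3) g by simp
  then have "?J +> \<one> = ?J +> \<zero>" using h.hom_one h.hom_zero by simp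
  then have "\<one> \<in> ?J"
    using quotient_eq_iff_same_a_r_cos[OF J(1), of \<one> \<zero>] by (simp add: a_minus_def)
  then have "?J = carrier R" by (rule J.one_imp_carrier)
  then obtain a where a: "a \<in> ?I" "\<forall>b\<in>Span K gs. (\<one> \<ominus> a) \<otimes> b \<in> {\<zero>}"
    using nakayama[OF K I _ submodule_over_zero[OF subringE(1)[OF K]] gs(1)] gs
    by (auto simp: Span_eq_line_extensions)
  have "(\<one> \<ominus> a) \<otimes> g = \<zero>" using a(2) gs(2) g by blast
  moreover have "a \<in> carrier R" using K_carrier a(1) by blast
  then have "g = (\<one> \<ominus> a) \<otimes> g \<oplus> a \<otimes> g" using g by algebra
  ultimately show ?thesis using a(1) \<open>a \<in> carrier R\<close> g by simp
qed

theorem finite_epi_ext_eq: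
  assumes K: "subring K R" and epi: "epi_ext K R"
    and gs: "set gs \<subseteq> carrier R" "carrier R = Span K gs"
  shows "K = carrier R"
proof -
  have "carrier R \<subseteq> K" if "set hs \<subseteq> carrier R" "carrier R = Span K (hs @ [\<one>])" for hs
    using that
  proof (induction hs)
    case Nil
    then show ?case using Span_singleton_one[OF K] by simp
  next
    case (Cons g hs)
    let ?N = "Span K (hs @ [\<one>])"
    have hs: "g \<in> carrier R" "set (hs @ [\<one>]) \<subseteq> carrier R" using Cons.prems(1) by auto
    have N: "submodule_over K ?N"
      by (rule submodule_over_Span[OF K submodule_over_subring[OF K subset_refl] hs(2)])
    have R: "carrier R = line_extension K g ?N" using Cons.prems(2) by simp
    have "g \<in> ?N"
      using Span_incl[OF K hs(2)] hs(1) by (intro epi_ext_line_extension[OF K epi gs N _ _ R]) auto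
    then have "carrier R \<subseteq> ?N"
      unfolding R using submodule_overE(4,5)[OF N] by (auto simp: line_extension_mem_iff)
    then show ?case using Cons.IH hs(2) submodule_overE(1)[OF N] by auto
  qed
  moreover have "carrier R = Span K (gs @ [\<one>])"
  proof
    have gs': "set (gs @ [\<one>]) \<subseteq> carrier R" using gs(1) by simp
    have S: "submodule_over K (Span K (gs @ [\<one>]))"
      by (rule submodule_over_Span[OF K submodule_over_subring[OF K subset_refl] gs'])
    show "carrier R \<subseteq> Span K (gs @ [\<one>])"
      unfolding gs(2) using Span_incl[OF K gs'] by (intro Span_least[OF S]) auto
    show "Span K (gs @ [\<one>]) \<subseteq> carrier R" by (rule submodule_overE(1)[OF S])
  qed
  ultimately show ?thesis using gs(1) subringE(1)[OF K] by blast
qed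

section \<open>Integral elements of Pruefer extensions\<close>

lemma subring_is_cring: "subring K R \<Longrightarrow> cring (R\<lparr>carrier := K\<rparr>)"
  using subcring_iff[OF subringE(1)] subcringI' by blast

lemma subring_of_subring:
  assumes "subring K R" "subring B R" "K \<subseteq> B"
  shows "subring K (R\<lparr>carrier := B\<rparr>)"
  using ring.subring_iff[OF subring_is_ring[OF assms(2)], of K] subring_is_ring[OF assms(1)]
    assms(3)
  by simp

lemma subring_trans:
  assumes "subring T R" "subring V (R\<lparr>carrier := T\<rparr>)"
  shows "subring V R"
proof -
  have V: "V \<subseteq> T" using subringE(1)[OF assms(2)] by simp
  have "ring (R\<lparr>carrier := V\<rparr>)"
    using ring.subring_is_ring[OF subring_is_ring[OF assms(1)] assms(2)] by simp
  then show ?thesis using subring_iff[of V] V subringE(1)[OF assms(1)] by auto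
qed

lemma ring_hom_eq_on_simple_extension:
  assumes U: "subring U R" and t: "t \<in> carrier R"
    and f: "f \<in> ring_hom (R\<lparr>carrier := simple_extension U t\<rparr>) C"
    and g: "g \<in> ring_hom (R\<lparr>carrier := simple_extension U t\<rparr>) C"
    and eq: "\<And>x. x \<in> U \<Longrightarrow> f x = g x" "f t = g t" and x: "x \<in> simple_extension U t"
  shows "f x = g x"
  using x
proof (induction rule: simple_extension.induct)
  case zero
  show ?case using eq(1) subringE(2)[OF U] by blast
next
  case (lin y a)
  note B = simple_extension_subring[OF U t] and gen_mem = simple_extension_mem[OF U t]
  have "y \<otimes> t \<in> simple_extension U t" "a \<in> simple_extension U t"
    using lin gen_mem simple_extension_incl[OF subringE(1)[OF U] t] subringE(6)[OF B] by auto
  then show ?case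
    using lin gen_mem eq ring_hom_add[OF f, of "y \<otimes> t" a] ring_hom_add[OF g, of "y \<otimes> t" a]
      ring_hom_mult[OF f, of y t] ring_hom_mult[OF g, of y t] by simp
qed

lemma epi_ext_simple_extension_mono:
  assumes K: "subring K R" and U: "subring U R" "K \<subseteq> U" and t: "t \<in> carrier R"
    and epi: "epi_ext K (R\<lparr>carrier := simple_extension K t\<rparr>)"
  shows "epi_ext U (R\<lparr>carrier := simple_extension U t\<rparr>)"
  unfolding epi_ext_def
proof (intro allI impI ballI)
  let ?V = "simple_extension K t" and ?B = "simple_extension U t"
  fix C :: "('a \<times> 'a) list ring" and f g x
  assume C: "cring C" and f: "f \<in> ring_hom (R\<lparr>carrier := ?B\<rparr>) C"
    and g: "g \<in> ring_hom (R\<lparr>carrier := ?B\<rparr>) C" and eq: "\<forall>x\<in>U. f x = g x"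
    and x: "x \<in> carrier (R\<lparr>carrier := ?B\<rparr>)"
  have "f \<in> ring_hom (R\<lparr>carrier := ?V\<rparr>) C" "g \<in> ring_hom (R\<lparr>carrier := ?V\<rparr>) C"
    using f g mono_simple_extension[OF U(2), of t] by (auto simp: ring_hom_def subset_iff)
  moreover have "\<forall>x\<in>K. f x = g x" using eq U(2) by blast
  ultimately have ft: "f t = g t"
    using epi C simple_extension_mem[OF K t] unfolding epi_ext_def by auto
  show "f x = g x"
    by (rule ring_hom_eq_on_simple_extension[OF U(1) t f g _ ft]) (use eq x in simp_all)
qed

lemma epi_ext_integral_mem:
  assumes U: "subring U R" and t: "t \<in> carrier R" and int: "integral_over U R t"
    and epi: "epi_ext U (R\<lparr>carrier := simple_extension U t\<rparr>)"
  shows "t \<in> U"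
proof -
  let ?B = "simple_extension U t"
  note B = simple_extension_subring[OF U t]
  have U_subset: "U \<subseteq> ?B" by (rule simple_extension_incl[OF subringE(1)[OF U] t])
  interpret B: cring "R\<lparr>carrier := ?B\<rparr>" by (rule subring_is_cring[OF B])
  obtain m :: nat where m: "?B = Span U (exp_base t m)"
    using int integral_over_iff_poly_span[OF U t] simple_extension_integral[OF U t]
    unfolding poly_span_def by blast
  have "U = carrier (R\<lparr>carrier := ?B\<rparr>)"
  proof (rule B.finite_epi_ext_eq[OF subring_of_subring[OF U B U_subset] epi])
    show "set (exp_base t m) \<subseteq> carrier (R\<lparr>carrier := ?B\<rparr>)"
      using Span_incl[OF U exp_base_closed[OF t]] m by auto
    show "carrier (R\<lparr>carrier := ?B\<rparr>) = B.Span U (exp_base t m)"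
      using m unfolding Span_consistent[OF B] by simp
  qed
  then show ?thesis using simple_extension_mem[OF U t] by simp
qed

lemma pruefer_integral_mem:
  assumes K: "subring K R" and T: "subring T R" "K \<subseteq> T" and pr: "pruefer_ext K (R\<lparr>carrier := T\<rparr>)"
    and U: "subring U R" "K \<subseteq> U" and t: "t \<in> T" and int: "integral_over U R t"
  shows "t \<in> U"
proof -
  let ?V = "simple_extension K t"
  have t_carrier: "t \<in> carrier R" by (rule subring_mem[OF T(1) t])
  have "?V \<in> intermediate_rings K (R\<lparr>carrier := T\<rparr>)"
    unfolding intermediate_rings_def
    using subring_of_subring[OF simple_extension_subring[OF K t_carrier] T(1)
      simple_extension_subring_incl[OF T t]]
      simple_extension_incl[OF subringE(1)[OF K] t_carrier] by blast
  then have "epi_ext K (R\<lparr>carrier := ?V\<rparr>)"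
    using pr unfolding pruefer_ext_def flat_epi_ext_def by auto
  then show ?thesis
    by (rule epi_ext_integral_mem[OF U(1) t_carrier int
      epi_ext_simple_extension_mono[OF K U t_carrier]])
qed

section \<open>Dense denominators\<close>

definition generates_one :: "'a set \<Rightarrow> 'a set \<Rightarrow> bool"
  where "generates_one T J \<longleftrightarrow> (\<forall>H. submodule_over T H \<longrightarrow> J \<subseteq> H \<longrightarrow> \<one> \<in> H)"

definition denominators :: "'a set \<Rightarrow> 'a set \<Rightarrow> 'a \<Rightarrow> 'a set"
  where "denominators K A s = {r \<in> K. r \<otimes> s \<in> A}"

lemma generates_oneD: "generates_one T J \<Longrightarrow> submodule_over T H \<Longrightarrow> J \<subseteq> H \<Longrightarrow> \<one> \<in> H"
  by (simp add: generates_one_def)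

lemma generates_one_mono: "generates_one T J \<Longrightarrow> J \<subseteq> J' \<Longrightarrow> generates_one T J'"
  unfolding generates_one_def by blast

lemma generates_one_if_one_mem: "\<one> \<in> J \<Longrightarrow> generates_one T J"
  unfolding generates_one_def by blast

lemma generates_one_mult:
  assumes "generates_one T J" "generates_one T J'" and T: "T \<subseteq> carrier R"
    and J: "J \<subseteq> carrier R" "J' \<subseteq> carrier R"
  shows "generates_one T {j \<otimes> j' |j j'. j \<in> J \<and> j' \<in> J'}"
  unfolding generates_one_def
proof (intro allI impI)
  fix H assume H: "submodule_over T H" "{j \<otimes> j' |j j'. j \<in> J \<and> j' \<in> J'} \<subseteq> H"
  let ?H' = "{h \<in> carrier R. \<forall>j'\<in>J'. h \<otimes> j' \<in> H}"
  have "submodule_over T ?H'"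
  proof (rule submodule_overI)
    have "k \<otimes> a \<otimes> j' \<in> H" if "k \<in> T" "a \<in> ?H'" "j' \<in> J'" for k a j'
      using that submodule_overE(5)[OF H(1), of k "a \<otimes> j'"] T J by (auto simp: m_assoc subset_iff)
    then show "k \<otimes> a \<in> ?H'" if "k \<in> T" "a \<in> ?H'" for k a using that T by auto
  qed (use submodule_overE[OF H(1)] J(2) in \<open>auto simp: l_distr subset_iff\<close>)
  moreover have "J \<subseteq> ?H'" using H(2) J(1) by blast
  ultimately have "\<one> \<in> ?H'" using generates_oneD[OF assms(1)] by blast
  then have "J' \<subseteq> H" using J(2) l_one by fastforce
  then show "\<one> \<in> H" by (rule generates_oneD[OF assms(2) H(1)])
qed

text \<open>In a relation \<open>a\<^sub>n t\<^sup>n + \<dots> + a\<^sub>0 = 0\<close> the Horner coefficients \<open>b\<^sub>n = a\<^sub>n\<close>,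
  \<open>b\<^sub>i = b\<^sub>i\<^sub>+\<^sub>1 t + a\<^sub>i\<close> are successively seen to be denominators of \<open>t\<close>, as \<open>b\<^sub>i t\<close> is integral.\<close>

lemma integrally_closed_denominators:
  assumes K: "subring K R" and FCP: "FCP K R" and T: "subring T R" "K \<subseteq> T"
    and closed: "integral_closure K \<inter> T \<subseteq> K" and t: "t \<in> T"
  shows "generates_one T (denominators K K t)"
  unfolding generates_one_def
proof (intro allI impI)
  fix H assume H: "submodule_over T H" and den: "denominators K K t \<subseteq> H"
  note K_closed = subringE[OF K] and K_carrier = subring_mem[OF K]
    and H_closed = submodule_overE[OF H]
  have t_carrier: "t \<in> carrier R" by (rule subring_mem[OF T(1) t])
  have coeffs: "set (c # g) \<subseteq> H" if "c \<in> K" "set g \<subseteq> K" "eval (c # g) t = \<zero>" for c g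
    using that
  proof (induction g arbitrary: c)
    case Nil
    then show ?case using K_carrier H_closed(3) by simp
  next
    case (Cons a g)
    have in_carrier: "c \<in> carrier R" "a \<in> carrier R" "set g \<subseteq> carrier R"
      using Cons.prems K_carrier by auto
    have e: "eval (a # g) t \<in> poly_span K t (Suc (length g))"
      using Cons.prems(2)
      by (auto simp: poly_span_eq_eval simp del: eval.simps intro!: exI[of _ "a # g"])
    have "c \<otimes> t [^] Suc (length g) = \<ominus> eval (a # g) t"
      using Cons.prems(3) in_carrier(1) t_carrier poly_span_carrier[OF K t_carrier e]
        sum_zero_eq_neg[of "c \<otimes> t [^] Suc (length g)" "eval (a # g) t"] by simp
    then have "integral_over K R (c \<otimes> t)"
      using poly_span_neg[OF K t_carrier e]
        integral_over_leading_coeff[OF K t_carrier Cons.prems(1)] by metis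
    moreover have "c \<otimes> t \<in> T" using subringE(6)[OF T(1)] Cons.prems(1) T(2) t by blast
    ultimately have ct: "c \<otimes> t \<in> K"
      using closed in_carrier(1) t_carrier by (auto simp: integral_closure_def)
    have c_mem: "c \<in> H" using den Cons.prems(1) ct by (auto simp: denominators_def)
    have "eval ((c \<otimes> t \<oplus> a) # g) t = eval (c # a # g) t"
      using in_carrier t_carrier eval_in_carrier[OF in_carrier(3) t_carrier]
      by (simp add: l_distr r_distr m_ac a_assoc)
    then have "set ((c \<otimes> t \<oplus> a) # g) \<subseteq> H"
      using Cons.prems ct K_closed(7) by (intro Cons.IH) auto
    moreover have "a = (c \<otimes> t \<oplus> a) \<ominus> t \<otimes> c" using in_carrier t_carrier by algebra
    ultimately show ?case
      using c_mem submodule_over_minus(2)[OF T(1) H H_closed(5)[OF t c_mem], of "c \<otimes> t \<oplus> a"] by auto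
  qed
  obtain f where f: "set f \<subseteq> K" "\<ominus> \<one> \<in> set f" "eval f t = \<zero>"
    using FCP_relation[OF K FCP t_carrier] by blast
  then obtain c g where "f = c # g" by (cases f) auto
  then have "\<ominus> \<one> \<in> H" using coeffs[of c g] f by auto
  then show "\<one> \<in> H" using submodule_over_minus(1)[OF T(1) H] by fastforce
qed

definition dense_denominators :: "'a set \<Rightarrow> bool"
  where "dense_denominators K \<longleftrightarrow> (\<forall>s\<in>carrier R. generates_one (carrier R) (denominators K K s))"

lemma dense_denominators_epi:
  assumes K: "subring K R" and dense: "dense_denominators K"
  shows "epi_ext K R"
  unfolding epi_ext_def
proof (intro allI impI ballI)
  fix C :: "('a \<times> 'a) list ring" and f g s
  assume C: "cring C" and f: "f \<in> ring_hom R C" and g: "g \<in> ring_hom R C"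
    and eq: "\<forall>x\<in>K. f x = g x" and s: "s \<in> carrier R"
  interpret C: cring C by fact
  interpret f: ring_hom_cring R C f by unfold_locales (rule f)
  interpret g: ring_hom_cring R C g by unfold_locales (rule g)
  define d where "d = f s \<ominus>\<^bsub>C\<^esub> g s"
  have d: "d \<in> carrier C" using s by (simp add: d_def)
  let ?H = "{h \<in> carrier R. f h \<otimes>\<^bsub>C\<^esub> d = \<zero>\<^bsub>C\<^esub>}"
  have "submodule_over (carrier R) ?H"
    by (rule submodule_overI) (use d in \<open>auto simp: C.l_distr C.m_assoc\<close>)
  moreover have "r \<in> ?H" if r: "r \<in> denominators K K s" for r
  proof -
    have r_carrier: "r \<in> carrier R" and r_mem: "r \<in> K" "r \<otimes> s \<in> K"
      using r subring_mem[OF K] by (auto simp: denominators_def)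
    have "f r \<otimes>\<^bsub>C\<^esub> f s = f r \<otimes>\<^bsub>C\<^esub> g s"
      using r_mem eq r_carrier s f.hom_mult[of r s] g.hom_mult[of r s] by auto
    then show ?thesis
      unfolding d_def using r_carrier s by (simp add: C.r_distr a_minus_def C.r_minus C.r_neg)
  qed
  ultimately have "\<one> \<in> ?H"
    using dense s generates_oneD unfolding dense_denominators_def by blast
  then have "d = \<zero>\<^bsub>C\<^esub>" using d by simp
  then show "f s = g s" using s by (simp add: d_def)
qed

definition dense_ideal :: "'a set \<Rightarrow> 'a set \<Rightarrow> bool"
  where "dense_ideal K J \<longleftrightarrow> submodule_over K J \<and> J \<subseteq> K \<and> generates_one (carrier R) J"

lemma dense_ideal_self: "subring K R \<Longrightarrow> dense_ideal K K"
  unfolding dense_ideal_def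
  by (simp add: submodule_over_subring generates_one_if_one_mem subringE(3))

lemma dense_ideal_Int:
  assumes K: "subring K R" and J: "dense_ideal K J" and J': "dense_ideal K J'"
  shows "dense_ideal K (J \<inter> J')"
proof -
  have J_submodules: "submodule_over K J" "submodule_over K J'" "J \<subseteq> K" "J' \<subseteq> K"
    using J J' by (auto simp: dense_ideal_def)
  have "{j \<otimes> j' |j j'. j \<in> J \<and> j' \<in> J'} \<subseteq> J \<inter> J'"
  proof clarify
    fix j j' assume j: "j \<in> J" "j' \<in> J'"
    then have "j \<otimes> j' = j' \<otimes> j" using J_submodules(3,4) subring_mem[OF K] by (auto intro!: m_comm)
    then show "j \<otimes> j' \<in> J \<inter> J'"
      using submodule_overE(5)[OF J_submodules(1), of j' j]
        submodule_overE(5)[OF J_submodules(2), of j j'] j J_submodules(3,4) by auto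
  qed
  moreover have "generates_one (carrier R) {j \<otimes> j' |j j'. j \<in> J \<and> j' \<in> J'}"
    using J J' J_submodules(3,4) subringE(1)[OF K]
    by (intro generates_one_mult) (auto simp: dense_ideal_def)
  ultimately have "generates_one (carrier R) (J \<inter> J')" using generates_one_mono by blast
  then show ?thesis
    using submodule_over_Int[OF J_submodules(1,2)] J_submodules(3) by (auto simp: dense_ideal_def)
qed

lemma dense_ideal_denominators:
  assumes K: "subring K R" and dense: "dense_denominators K" and s: "s \<in> carrier R"
  shows "dense_ideal K (denominators K K s)"
proof -
  have "submodule_over K (denominators K K s)"
    using subringE[OF K] s subring_mem[OF K]
    by (intro submodule_overI) (auto simp: denominators_def l_distr m_assoc)
  then show ?thesis
    using dense s by (auto simp: dense_ideal_def dense_denominators_def denominators_def)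
qed

lemma dense_ideal_common_denominators:
  assumes K: "subring K R" and dense: "dense_denominators K" and "finite A" "A \<subseteq> carrier R"
  shows "\<exists>J. dense_ideal K J \<and> (\<forall>a\<in>J. \<forall>s\<in>A. a \<otimes> s \<in> K)"
  using assms(3,4)
proof (induction rule: finite_induct)
  case empty
  show ?case using dense_ideal_self[OF K] by auto
next
  case (insert s A)
  then obtain J where "dense_ideal K J" "\<forall>a\<in>J. \<forall>s\<in>A. a \<otimes> s \<in> K" by auto
  then show ?case
    using dense_ideal_Int[OF K _ dense_ideal_denominators[OF K dense, of s], of J] insert.prems
    by (intro exI[of _ "J \<inter> denominators K K s"]) (auto simp: denominators_def)
qed

end

section \<open>Flatness from dense denominators\<close>

lemma free_Abelian_group_hom:
  assumes N: "abelian_group N" and h: "h \<in> hom (free_Abelian_group A) (add_monoid N)"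
  shows "h 0 = \<zero>\<^bsub>N\<^esub>"
    and "Poly_Mapping.keys x \<subseteq> A \<Longrightarrow> h x \<in> carrier N"
    and "Poly_Mapping.keys x \<subseteq> A \<Longrightarrow> Poly_Mapping.keys y \<subseteq> A \<Longrightarrow> h (x + y) = h x \<oplus>\<^bsub>N\<^esub> h y"
    and "Poly_Mapping.keys x \<subseteq> A \<Longrightarrow> h (- x) = \<ominus>\<^bsub>N\<^esub> h x"
    and "Poly_Mapping.keys x \<subseteq> A \<Longrightarrow> Poly_Mapping.keys y \<subseteq> A \<Longrightarrow> h (x - y) = h x \<ominus>\<^bsub>N\<^esub> h y"
proof -
  interpret N: abelian_group N by fact
  interpret h: group_hom "free_Abelian_group A" "add_monoid N" h
    by (simp add: group_hom_def group_hom_axioms_def h N.a_group)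
  show "h 0 = \<zero>\<^bsub>N\<^esub>" using h.hom_one by simp
  show "h x \<in> carrier N" if "Poly_Mapping.keys x \<subseteq> A" for x using h.hom_closed[of x] that by simp
  show add: "h (x + y) = h x \<oplus>\<^bsub>N\<^esub> h y"
    if "Poly_Mapping.keys x \<subseteq> A" "Poly_Mapping.keys y \<subseteq> A" for x y
    using h.hom_mult[of x y] that by simp
  show neg: "h (- x) = \<ominus>\<^bsub>N\<^esub> h x" if "Poly_Mapping.keys x \<subseteq> A" for x
    using h.hom_inv[of x] that by (simp add: a_inv_def)
  show "h (x - y) = h x \<ominus>\<^bsub>N\<^esub> h y" if "Poly_Mapping.keys x \<subseteq> A" "Poly_Mapping.keys y \<subseteq> A"
    using add[of x "- y"] neg[of y] that by (simp add: a_minus_def)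
qed

lemma module_homs_zero:
  assumes "module R M" "module R N" "f \<in> module_homs R M N"
  shows "f \<zero>\<^bsub>M\<^esub> = \<zero>\<^bsub>N\<^esub>"
proof -
  interpret M: module R M by fact
  interpret N: module R N by fact
  show ?thesis
    using module_homsD(2)[OF assms(3), of "\<zero>\<^bsub>M\<^esub>" "\<zero>\<^bsub>M\<^esub>"] module_homsD(1)[OF assms(3), of "\<zero>\<^bsub>M\<^esub>"]
    by simp
qed

lemma module_homs_minus:
  assumes "module R M" "module R N" "f \<in> module_homs R M N" and uv: "u \<in> carrier M" "v \<in> carrier M"
  shows "f (u \<ominus>\<^bsub>M\<^esub> v) = f u \<ominus>\<^bsub>N\<^esub> f v"
proof -
  interpret M: module R M by fact
  interpret N: module R N by fact
  note f = module_homsD[OF assms(3)]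
  have "f u = f (u \<ominus>\<^bsub>M\<^esub> v) \<oplus>\<^bsub>N\<^esub> f v"
    using uv f(2)[of "u \<ominus>\<^bsub>M\<^esub> v" v] by (simp add: a_minus_def M.a_assoc M.l_neg)
  then show ?thesis using uv f(1) by (simp add: a_minus_def N.a_assoc N.r_neg)
qed

lemma ring_module_simps [simp]:
  "carrier (ring_module S) = carrier S" "add (ring_module S) = add S"
  "smult (ring_module S) = monoid.mult S"
  by (simp_all add: ring_module_def)

context cring
begin

lemma ring_module_module:
  assumes "subring K R"
  shows "module (R\<lparr>carrier := K\<rparr>) (ring_module R)"
proof -
  have "abelian_group (ring_module R)"
    by (rule abelian_groupI) (auto simp: ring_module_def a_ac intro: add.l_inv_ex)
  then show ?thesis
    by (rule moduleI[OF subring_is_cring[OF assms]])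
      (auto simp: ring_module_def subring_mem[OF assms] l_distr r_distr m_assoc)
qed

definition frag_map_right :: "'a \<Rightarrow> ('m \<times> 'a \<Rightarrow>\<^sub>0 int) \<Rightarrow> ('m \<times> 'a \<Rightarrow>\<^sub>0 int)"
  where "frag_map_right b = frag_extend (\<lambda>(m, s). frag_of (m, b \<otimes> s))"

lemma frag_map_right_simps [simp]:
  "frag_map_right b 0 = 0"
  "frag_map_right b (frag_of (m, s)) = frag_of (m, b \<otimes> s)"
  "frag_map_right b (x + y) = frag_map_right b x + frag_map_right b y"
  "frag_map_right b (- x) = - frag_map_right b x"
  "frag_map_right b (x - y) = frag_map_right b x - frag_map_right b y"
  by (simp_all add: frag_map_right_def frag_extend_add frag_extend_minus frag_extend_diff)

text \<open>A homomorphism computing \<open>m\<close> from \<open>x\<close> if \<open>a x = m \<otimes> \<one>\<close> in \<open>M \<otimes> R\<close>; its values are prescribed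
  only on those \<open>(m, s)\<close> for which \<open>a\<close> is a denominator of \<open>s\<close>.\<close>

definition scaled_eval ::
    "'a set \<Rightarrow> ('a, 'm, 'e) module_scheme \<Rightarrow> 'a \<Rightarrow> (('m \<times> 'a \<Rightarrow>\<^sub>0 int) \<Rightarrow> 'm) \<Rightarrow> bool"
  where "scaled_eval K M a ev \<longleftrightarrow>
    ev \<in> hom (free_Abelian_group (carrier M \<times> carrier R)) (add_monoid M) \<and>
    (\<forall>m\<in>carrier M. \<forall>s\<in>carrier R. a \<otimes> s \<in> K \<longrightarrow> ev (frag_of (m, s)) = (a \<otimes> s) \<odot>\<^bsub>M\<^esub> m)"

lemma scaled_eval_exists:
  assumes M: "module (R\<lparr>carrier := K\<rparr>) M"
  shows "\<exists>ev. scaled_eval K M a ev"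
proof -
  interpret M: module "R\<lparr>carrier := K\<rparr>" M by fact
  define val where "val = (\<lambda>(m, s). if a \<otimes> s \<in> K then (a \<otimes> s) \<odot>\<^bsub>M\<^esub> m else \<zero>\<^bsub>M\<^esub>)"
  have "val ` (carrier M \<times> carrier R) \<subseteq> carrier (add_monoid M)"
    using M.smult_closed by (auto simp: val_def)
  then obtain ev where "ev \<in> hom (free_Abelian_group (carrier M \<times> carrier R)) (add_monoid M)"
      "\<And>u. u \<in> carrier M \<times> carrier R \<Longrightarrow> ev (frag_of u) = val u"
    using comm_group.free_Abelian_group_universal[OF M.a_comm_group, of val] by metis
  then show ?thesis by (auto simp: scaled_eval_def val_def)
qed

lemma tensor_relators_scaled_eval:
  fixes M :: "('a, 'm, 'e) module_scheme"
  assumes K: "subring K R" and dense: "dense_denominators K" and M: "module (R\<lparr>carrier := K\<rparr>) M"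
    and h: "h \<in> tensor_relators (R\<lparr>carrier := K\<rparr>) M (ring_module R)"
  shows "\<exists>J. dense_ideal K J \<and> (\<forall>a\<in>J. \<forall>ev. scaled_eval K M a ev \<longrightarrow> ev h = \<zero>\<^bsub>M\<^esub>)"
proof -
  interpret M: module "R\<lparr>carrier := K\<rparr>" M by fact
  let ?A = "carrier M \<times> carrier R"
  note K_carrier = subring_mem[OF K] and K_closed = subringE[OF K]
    and den = dense_ideal_denominators[OF K dense]
  have hom: "ev \<in> hom (free_Abelian_group ?A) (add_monoid M)"
    and ev: "m \<in> carrier M \<Longrightarrow> s \<in> carrier R \<Longrightarrow> a \<otimes> s \<in> K \<Longrightarrow> ev (frag_of (m, s)) = (a \<otimes> s) \<odot>\<^bsub>M\<^esub> m"
    if "scaled_eval K M a ev" for a ev m s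
    using that by (auto simp: scaled_eval_def)
  note diff = free_Abelian_group_hom(5)[OF M.abelian_group_axioms hom]
  have keys: "Poly_Mapping.keys (u - v) \<subseteq> ?A"
    if "Poly_Mapping.keys u \<subseteq> ?A" "Poly_Mapping.keys v \<subseteq> ?A" for u v :: "'m \<times> 'a \<Rightarrow>\<^sub>0 int"
    using that keys_diff[of u v] by blast
  from h show ?thesis
  proof (cases rule: tensor_relators_cases)
    case (add_left m m' s)
    have "ev h = \<zero>\<^bsub>M\<^esub>" if "a \<in> denominators K K s" and scaled: "scaled_eval K M a ev" for a ev
      using that(1) add_left
      by (simp add: denominators_def diff[OF scaled] keys ev[OF scaled] M.smult_r_distr a_minus_def
          M.minus_add M.a_ac M.r_neg)
    then show ?thesis using den[of s] add_left by auto
  next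
    case (add_right m s s')
    have "ev h = \<zero>\<^bsub>M\<^esub>"
      if "a \<in> denominators K K s \<inter> denominators K K s'" and scaled: "scaled_eval K M a ev" for a ev
      using that(1) add_right K_carrier K_closed(7)
      by (simp add: denominators_def diff[OF scaled] keys ev[OF scaled] r_distr
          M.smult_l_distr[simplified] a_minus_def M.minus_add M.a_ac M.r_neg)
    then show ?thesis using dense_ideal_Int[OF K den den, of s s'] add_right by auto
  next
    case (smult b m s)
    have "ev h = \<zero>\<^bsub>M\<^esub>" if a: "a \<in> denominators K K s" and scaled: "scaled_eval K M a ev" for a ev
    proof -
      have "a \<otimes> (b \<otimes> s) = (a \<otimes> s) \<otimes> b"
        using a smult K_carrier by (simp add: denominators_def m_ac)
      then show ?thesis
        using a smult K_carrier K_closed(6)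
        by (simp add: denominators_def diff[OF scaled] ev[OF scaled] a_minus_def
          M.smult_assoc1[simplified] M.r_neg)
    qed
    then show ?thesis using den[of s] smult by auto
  qed
qed

lemma tensor_kernel_scaled_eval:
  fixes M :: "('a, 'm, 'e) module_scheme"
  assumes K: "subring K R" and dense: "dense_denominators K" and M: "module (R\<lparr>carrier := K\<rparr>) M"
    and k: "k \<in> tensor_kernel (R\<lparr>carrier := K\<rparr>) M (ring_module R)"
  shows "\<exists>J. dense_ideal K J \<and> (\<forall>a\<in>J. \<forall>ev. scaled_eval K M a ev \<longrightarrow> ev k = \<zero>\<^bsub>M\<^esub>)" (is "?P k")
proof -
  interpret M: module "R\<lparr>carrier := K\<rparr>" M by fact
  let ?A = "carrier M \<times> carrier R"
  note T = ring_module_module[OF K] and rel = tensor_relators_scaled_eval[OF K dense M]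
  have hom: "ev \<in> hom (free_Abelian_group ?A) (add_monoid M)" if "scaled_eval K M a ev" for a ev
    using that by (simp add: scaled_eval_def)
  note ev_hom = free_Abelian_group_hom[OF M.abelian_group_axioms hom]
  have "Poly_Mapping.keys k \<subseteq> ?A \<and> ?P k"
    using M T k
  proof (induction rule: tensor_kernel_induct)
    case zero
    show ?case using dense_ideal_self[OF K] ev_hom(1) by auto
  next
    case (rel h)
    then show ?case
      using tensor_relators_scaled_eval[OF K dense M rel] tensor_relators_keys[OF M T rel] by simp
  next
    case (neg h)
    have keys: "Poly_Mapping.keys h \<subseteq> ?A" using tensor_relators_keys[OF M T neg] by simp
    obtain J where J: "dense_ideal K J" "\<forall>a\<in>J. \<forall>ev. scaled_eval K M a ev \<longrightarrow> ev h = \<zero>\<^bsub>M\<^esub>"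
      using rel[OF neg] by blast
    have "ev (- h) = \<zero>\<^bsub>M\<^esub>" if "a \<in> J" and scaled: "scaled_eval K M a ev" for a ev
    proof -
      have "ev h = \<zero>\<^bsub>M\<^esub>" using J(2) that by blast
      then show ?thesis using ev_hom(4)[OF scaled keys] by simp
    qed
    then show ?case using J(1) keys by auto
  next
    case (add x y)
    then obtain J J' where J: "dense_ideal K J" "\<forall>a\<in>J. \<forall>ev. scaled_eval K M a ev \<longrightarrow> ev x = \<zero>\<^bsub>M\<^esub>"
      and J': "dense_ideal K J'" "\<forall>a\<in>J'. \<forall>ev. scaled_eval K M a ev \<longrightarrow> ev y = \<zero>\<^bsub>M\<^esub>" by blast
    have keys: "Poly_Mapping.keys x \<subseteq> ?A" "Poly_Mapping.keys y \<subseteq> ?A" using add by auto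
    then have "Poly_Mapping.keys (x + y) \<subseteq> ?A" using keys_add[of x y] by blast
    moreover have "ev (x + y) = \<zero>\<^bsub>M\<^esub>" if "a \<in> J \<inter> J'" and scaled: "scaled_eval K M a ev" for a ev
    proof -
      have "ev x = \<zero>\<^bsub>M\<^esub>" "ev y = \<zero>\<^bsub>M\<^esub>" using J(2) J'(2) that by blast+
      then show ?thesis using ev_hom(3)[OF scaled keys] by simp
    qed
    ultimately show ?case using dense_ideal_Int[OF K J(1) J'(1)] by blast
  qed
  then show ?thesis ..
qed

lemma scaled_eval_natural:
  assumes M: "module (R\<lparr>carrier := K\<rparr>) M" and N: "module (R\<lparr>carrier := K\<rparr>) N"
    and f: "f \<in> module_homs (R\<lparr>carrier := K\<rparr>) M N"
    and e: "scaled_eval K M a e" and e': "scaled_eval K N a e'"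
    and x: "Poly_Mapping.keys x \<subseteq> {(m, s). m \<in> carrier M \<and> s \<in> carrier R \<and> a \<otimes> s \<in> K}"
  shows "f (e x) = e' (frag_map_left f x)"
proof -
  interpret M: module "R\<lparr>carrier := K\<rparr>" M by fact
  interpret N: module "R\<lparr>carrier := K\<rparr>" N by fact
  let ?A = "carrier M \<times> carrier R" and ?A' = "carrier N \<times> carrier R"
  have "e \<in> hom (free_Abelian_group ?A) (add_monoid M)"
    "e' \<in> hom (free_Abelian_group ?A') (add_monoid N)"
    using e e' by (auto simp: scaled_eval_def)
  note e_hom = free_Abelian_group_hom[OF M.abelian_group_axioms this(1)]
    and e'_hom = free_Abelian_group_hom[OF N.abelian_group_axioms this(2)]
  have "Poly_Mapping.keys x \<subseteq> ?A \<and> f (e x) = e' (frag_map_left f x) \<and>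
    Poly_Mapping.keys (frag_map_left f x) \<subseteq> ?A'"
    using x
  proof (induction rule: frag_induction)
    case zero
    show ?case using e_hom(1) e'_hom(1) module_homs_zero[OF M N f] by simp
  next
    case (one u)
    then show ?case using e e' module_homsD(1,3)[OF f] by (auto simp: scaled_eval_def)
  next
    case (diff u v)
    then have keys: "Poly_Mapping.keys u \<subseteq> ?A" "Poly_Mapping.keys v \<subseteq> ?A"
      and keys_f: "Poly_Mapping.keys (frag_map_left f u) \<subseteq> ?A'"
        "Poly_Mapping.keys (frag_map_left f v) \<subseteq> ?A'"
      and eq: "f (e u) = e' (frag_map_left f u)" "f (e v) = e' (frag_map_left f v)"
      by auto
    have "f (e (u - v)) = e' (frag_map_left f (u - v))"
      using module_homs_minus[OF M N f e_hom(2)[OF keys(1)] e_hom(2)[OF keys(2)]] eq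
      by (simp add: e_hom(5)[OF keys] e'_hom(5)[OF keys_f])
    then show ?case
      using keys keys_f keys_diff[of u v] keys_diff[of "frag_map_left f u" "frag_map_left f v"]
      by auto
  qed
  then show ?thesis by simp
qed

lemma frag_map_right_kernel:
  assumes K: "subring K R" and M: "module (R\<lparr>carrier := K\<rparr>) M" and b: "b \<in> carrier R"
    and k: "k \<in> tensor_kernel (R\<lparr>carrier := K\<rparr>) M (ring_module R)"
  shows "frag_map_right b k \<in> tensor_kernel (R\<lparr>carrier := K\<rparr>) M (ring_module R)"
proof -
  let ?K = "R\<lparr>carrier := K\<rparr>" and ?T = "ring_module R"
  note T = ring_module_module[OF K]
  note kernel_closed = tensor_kernel_closed[OF M T]
  have rel: "frag_map_right b h \<in> tensor_relators ?K M ?T" if "h \<in> tensor_relators ?K M ?T" for h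
    using that
  proof (cases rule: tensor_relators_cases)
    case (add_left x x' y)
    then show ?thesis
      using tensor_relatorsI(1)[of x M x' "b \<otimes> y" ?T ?K] b by simp
  next
    case (add_right x y y')
    then show ?thesis
      using tensor_relatorsI(2)[of x M "b \<otimes> y" ?T "b \<otimes> y'" ?K] b by (simp add: r_distr)
  next
    case (smult a x y)
    then show ?thesis
      using tensor_relatorsI(3)[of a ?K x M "b \<otimes> y" ?T] b subring_mem[OF K] by (simp add: m_lcomm)
  qed
  show ?thesis using M T k
    by (induction rule: tensor_kernel_induct) (use rel kernel_closed in auto)
qed

lemma frag_map_right_scaled_eval:
  assumes K: "subring K R" and M: "module (R\<lparr>carrier := K\<rparr>) M" and e: "scaled_eval K M a e"
    and x: "Poly_Mapping.keys x \<subseteq> {(m, s). m \<in> carrier M \<and> s \<in> carrier R \<and> a \<otimes> s \<in> K}"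
  shows "frag_map_right a x - frag_of (e x, \<one>) \<in> tensor_kernel (R\<lparr>carrier := K\<rparr>) M (ring_module R)"
proof -
  interpret M: module "R\<lparr>carrier := K\<rparr>" M by fact
  let ?K = "R\<lparr>carrier := K\<rparr>" and ?T = "ring_module R" and ?A = "carrier M \<times> carrier R"
  let ?ker = "tensor_kernel ?K M ?T"
  note kernel_closed = tensor_kernel_closed[OF M ring_module_module[OF K]]
  have "e \<in> hom (free_Abelian_group ?A) (add_monoid M)" using e by (simp add: scaled_eval_def)
  note h = free_Abelian_group_hom[OF M.abelian_group_axioms this]
  have minus: "frag_of (u \<ominus>\<^bsub>M\<^esub> v, \<one>) - frag_of (u, \<one>) + frag_of (v, \<one>) \<in> ?ker"
    if uv: "u \<in> carrier M" "v \<in> carrier M" for u v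
  proof -
    have "u \<ominus>\<^bsub>M\<^esub> v \<oplus>\<^bsub>M\<^esub> v = u" using uv by (simp add: a_minus_def M.a_assoc M.l_neg)
    then have "frag_of (u, \<one>) - frag_of (u \<ominus>\<^bsub>M\<^esub> v, \<one>) - frag_of (v, \<one>) \<in> ?ker"
      using kernel_closed(2)[OF tensor_relatorsI(1)[of "u \<ominus>\<^bsub>M\<^esub> v" M v \<one> ?T ?K]] uv by simp
    from kernel_closed(4)[OF this] show ?thesis by (simp add: algebra_simps)
  qed
  have "Poly_Mapping.keys x \<subseteq> ?A \<and> frag_map_right a x - frag_of (e x, \<one>) \<in> ?ker"
    using x
  proof (induction rule: frag_induction)
    case zero
    show ?case
      using kernel_closed(4)[OF minus[of "\<zero>\<^bsub>M\<^esub>" "\<zero>\<^bsub>M\<^esub>"]] h(1) M.r_neg[OF M.zero_closed]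
      by (simp add: a_minus_def)
  next
    case (one u)
    then obtain m s where u: "u = (m, s)" "m \<in> carrier M" "s \<in> carrier R" "a \<otimes> s \<in> K" by auto
    have "frag_of ((a \<otimes> s) \<odot>\<^bsub>M\<^esub> m, \<one>) - frag_of (m, a \<otimes> s) \<in> ?ker"
      using kernel_closed(2)[OF tensor_relatorsI(3)[of "a \<otimes> s" ?K m M \<one> ?T]] u subring_mem[OF K]
      by simp
    from kernel_closed(4)[OF this] show ?case using u e by (simp add: scaled_eval_def)
  next
    case (diff u v)
    then have keys: "Poly_Mapping.keys u \<subseteq> ?A" "Poly_Mapping.keys v \<subseteq> ?A"
      and ker: "frag_map_right a u - frag_of (e u, \<one>) \<in> ?ker"
        "frag_map_right a v - frag_of (e v, \<one>) \<in> ?ker"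
      by auto
    have "frag_map_right a (u - v) - frag_of (e (u - v), \<one>) \<in> ?ker"
      using kernel_closed(6)[OF kernel_closed(6)[OF ker]
        minus[OF h(2)[OF keys(1)] h(2)[OF keys(2)]]]
      by (simp add: h(5)[OF keys] algebra_simps)
    then show ?case using keys keys_diff[of u v] by auto
  qed
  then show ?thesis ..
qed

lemma submodule_over_frag_annihilator:
  assumes K: "subring K R" and M: "module (R\<lparr>carrier := K\<rparr>) M"
    and x: "Poly_Mapping.keys x \<subseteq> carrier M \<times> carrier R"
  shows "submodule_over (carrier R)
    {b \<in> carrier R. frag_map_right b x \<in> tensor_kernel (R\<lparr>carrier := K\<rparr>) M (ring_module R)}"
    (is "submodule_over _ ?H")
proof (rule submodule_overI)
  let ?ker = "tensor_kernel (R\<lparr>carrier := K\<rparr>) M (ring_module R)"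
  note kernel_closed = tensor_kernel_closed[OF M ring_module_module[OF K]]
  have add: "frag_map_right (a \<oplus> b) x - frag_map_right a x - frag_map_right b x \<in> ?ker"
    if ab_carrier: "a \<in> carrier R" "b \<in> carrier R" for a b
    using x
  proof (induction rule: frag_induction)
    case (one u)
    then obtain m s where u: "u = (m, s)" "m \<in> carrier M" "s \<in> carrier R" by auto
    then show ?case
      using kernel_closed(2)[OF tensor_relatorsI(2)[of m M "a \<otimes> s" "ring_module R" "b \<otimes> s"
        "R\<lparr>carrier := K\<rparr>"]] ab_carrier
      by (simp add: l_distr)
  next
    case (diff u v)
    then show ?case using kernel_closed(6)[OF diff] by (simp add: algebra_simps)
  qed (use kernel_closed(1) in simp)
  have mult: "frag_map_right (a \<otimes> b) x = frag_map_right a (frag_map_right b x)"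
    if "a \<in> carrier R" "b \<in> carrier R" for a b
    using x by (induction rule: frag_induction) (auto simp: that m_assoc)
  show "?H \<subseteq> carrier R" by auto
  show "\<zero> \<in> ?H" using kernel_closed(4)[OF add[of \<zero> \<zero>]] by simp
  show "a \<oplus> b \<in> ?H" if "a \<in> ?H" "b \<in> ?H" for a b
    using that kernel_closed(5)[OF add[of a b]
      kernel_closed(5)[of "frag_map_right a x" "frag_map_right b x"]] by simp
  show "b \<otimes> a \<in> ?H" if "b \<in> carrier R" "a \<in> ?H" for a b
    using that frag_map_right_kernel[OF K M that(1)] by (simp add: mult)
qed

lemma frag_map_right_kernelI:
  assumes K: "subring K R" and M: "module (R\<lparr>carrier := K\<rparr>) M" and N: "module (R\<lparr>carrier := K\<rparr>) N"
    and f: "f \<in> module_homs (R\<lparr>carrier := K\<rparr>) M N" and inj: "inj_on f (carrier M)"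
    and x: "Poly_Mapping.keys x \<subseteq> {(m, s). m \<in> carrier M \<and> s \<in> carrier R \<and> a \<otimes> s \<in> K}"
    and ev: "\<And>ev. scaled_eval K N a ev \<Longrightarrow> ev (frag_map_left f x) = \<zero>\<^bsub>N\<^esub>"
  shows "frag_map_right a x \<in> tensor_kernel (R\<lparr>carrier := K\<rparr>) M (ring_module R)"
proof -
  interpret M: module "R\<lparr>carrier := K\<rparr>" M by fact
  let ?A = "carrier M \<times> carrier R"
  note kernel_closed = tensor_kernel_closed[OF M ring_module_module[OF K]]
  obtain e e' where e: "scaled_eval K M a e" and e': "scaled_eval K N a e'"
    using scaled_eval_exists[OF M] scaled_eval_exists[OF N] by blast
  have "e \<in> hom (free_Abelian_group ?A) (add_monoid M)" using e by (simp add: scaled_eval_def)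
  note e_hom = free_Abelian_group_hom[OF M.abelian_group_axioms this]
  have "f (e x) = f \<zero>\<^bsub>M\<^esub>"
    unfolding scaled_eval_natural[OF M N f e e' x] ev[OF e'] module_homs_zero[OF M N f] ..
  moreover have "e x \<in> carrier M" using x by (intro e_hom(2)) auto
  ultimately have "e x = \<zero>\<^bsub>M\<^esub>" using inj_onD[OF inj] by simp
  moreover have "frag_of (\<zero>\<^bsub>M\<^esub>, \<one>) \<in> tensor_kernel (R\<lparr>carrier := K\<rparr>) M (ring_module R)"
    using kernel_closed(4)[OF frag_map_right_scaled_eval[OF K M e, of 0]] e_hom(1) by simp
  ultimately show ?thesis
    using kernel_closed(5)[OF frag_map_right_scaled_eval[OF K M e x]] by fastforce
qed

lemma dense_denominators_tensor_inj:
  assumes K: "subring K R" and dense: "dense_denominators K"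
    and M: "module (R\<lparr>carrier := K\<rparr>) M" and N: "module (R\<lparr>carrier := K\<rparr>) N"
    and f: "f \<in> module_homs (R\<lparr>carrier := K\<rparr>) M N" and inj: "inj_on f (carrier M)"
  shows "inj_on (tensor_map (R\<lparr>carrier := K\<rparr>) N (ring_module R) f)
    (carrier (tensor_product (R\<lparr>carrier := K\<rparr>) M (ring_module R)))"
  unfolding tensor_map_inj_iff[OF M N ring_module_module[OF K] f]
proof (intro allI impI)
  let ?K = "R\<lparr>carrier := K\<rparr>" and ?T = "ring_module R"
  fix x assume "Poly_Mapping.keys x \<subseteq> carrier M \<times> carrier ?T"
    and fx: "frag_map_left f x \<in> tensor_kernel ?K N ?T"
  then have x: "Poly_Mapping.keys x \<subseteq> carrier M \<times> carrier R" by simp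
  obtain J where J: "dense_ideal K J"
      "\<forall>a\<in>J. \<forall>ev. scaled_eval K N a ev \<longrightarrow> ev (frag_map_left f x) = \<zero>\<^bsub>N\<^esub>"
    using tensor_kernel_scaled_eval[OF K dense N fx] by blast
  have "finite (snd ` Poly_Mapping.keys x)" "snd ` Poly_Mapping.keys x \<subseteq> carrier R" using x by auto
  then obtain J' where J': "dense_ideal K J'" "\<forall>a\<in>J'. \<forall>s\<in>snd ` Poly_Mapping.keys x. a \<otimes> s \<in> K"
    using dense_ideal_common_denominators[OF K dense] by blast
  have "frag_map_right a x \<in> tensor_kernel ?K M ?T" if a: "a \<in> J \<inter> J'" for a
  proof (rule frag_map_right_kernelI[OF K M N f inj])
    show "Poly_Mapping.keys x \<subseteq> {(m, s). m \<in> carrier M \<and> s \<in> carrier R \<and> a \<otimes> s \<in> K}"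
      using x J'(2) a by fastforce
  qed (use J(2) a in blast)
  moreover have "dense_ideal K (J \<inter> J')" by (rule dense_ideal_Int[OF K J(1) J'(1)])
  then have "generates_one (carrier R) (J \<inter> J')" "J \<inter> J' \<subseteq> carrier R"
    using subringE(1)[OF K] by (auto simp: dense_ideal_def)
  ultimately have "frag_map_right \<one> x \<in> tensor_kernel ?K M ?T"
    using generates_oneD[OF _ submodule_over_frag_annihilator[OF K M x]] by blast
  moreover have "frag_map_right \<one> x = x" using x by (induction rule: frag_induction) auto
  ultimately show "x \<in> tensor_kernel ?K M ?T" by simp
qed

theorem dense_denominators_flat_epi:
  assumes K: "subring K R" and dense: "dense_denominators K"
  shows "flat_epi_ext K R"
  unfolding flat_epi_ext_def flat_module_def
  using ring_module_module[OF K] dense_denominators_tensor_inj[OF K dense]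
    dense_denominators_epi[OF K dense]
  by blast

section \<open>The Pruefer hull and the co-integral closure\<close>

theorem pruefer_ext_iff_integrally_closed:
  assumes K: "subring K R" and FCP: "FCP K R" and T: "subring T R" "K \<subseteq> T"
  shows "pruefer_ext K (R\<lparr>carrier := T\<rparr>) \<longleftrightarrow> integral_closure K \<inter> T \<subseteq> K"
proof
  assume "pruefer_ext K (R\<lparr>carrier := T\<rparr>)"
  then show "integral_closure K \<inter> T \<subseteq> K"
    using pruefer_integral_mem[OF K T _ K subset_refl] by (auto simp: integral_closure_def)
next
  assume closed: "integral_closure K \<inter> T \<subseteq> K"
  show "pruefer_ext K (R\<lparr>carrier := T\<rparr>)"
    unfolding pruefer_ext_def
  proof
    fix V assume "V \<in> intermediate_rings K (R\<lparr>carrier := T\<rparr>)"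
    then have V_subring_T: "subring V (R\<lparr>carrier := T\<rparr>)" and K_subset_V: "K \<subseteq> V"
      by (auto simp: intermediate_rings_def)
    have V: "subring V R" by (rule subring_trans[OF T(1) V_subring_T])
    have "V \<subseteq> T" using subringE(1)[OF V_subring_T] by simp
    interpret V: cring "R\<lparr>carrier := V\<rparr>" by (rule subring_is_cring[OF V])
    have "V.generates_one V (V.denominators K K s)" if s: "s \<in> V" for s
    proof -
      have "generates_one V (denominators K K s)"
        using closed \<open>V \<subseteq> T\<close> s by (intro integrally_closed_denominators[OF K FCP V K_subset_V]) auto
      moreover have "submodule_over V H" if "V.submodule_over V H" for H
        using that subringE(1)[OF V] by (auto simp: V.submodule_over_def submodule_over_def)
      ultimately show ?thesis
        by (auto simp: V.generates_one_def generates_one_def V.denominators_def denominators_def)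
    qed
    then have "V.dense_denominators K" by (simp add: V.dense_denominators_def)
    then have "flat_epi_ext K (R\<lparr>carrier := V\<rparr>)"
      by (rule V.dense_denominators_flat_epi[OF subring_of_subring[OF K V K_subset_V]])
    then show "flat_epi_ext K (R\<lparr>carrier := T, carrier := V\<rparr>)" by simp
  qed
qed

lemma generates_one_denominators_if_mult:
  assumes K: "subring K R" and T: "T \<subseteq> carrier R"
    and gen: "generates_one T (denominators K A s)" "generates_one T (denominators K A s')"
    and prod: "\<And>j j'. j \<in> denominators K A s \<Longrightarrow> j' \<in> denominators K A s' \<Longrightarrow> j \<otimes> j' \<otimes> u \<in> A"
  shows "generates_one T (denominators K A u)"
proof (rule generates_one_mono)
  have in_K: "denominators K A v \<subseteq> K" for v by (auto simp: denominators_def)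
  show "generates_one T {j \<otimes> j' |j j'. j \<in> denominators K A s \<and> j' \<in> denominators K A s'}"
    using gen T order_trans[OF in_K subringE(1)[OF K]] by (intro generates_one_mult)
  show "{j \<otimes> j' |j j'. j \<in> denominators K A s \<and> j' \<in> denominators K A s'} \<subseteq> denominators K A u"
  proof clarify
    fix j j' assume j: "j \<in> denominators K A s" "j' \<in> denominators K A s'"
    have "j \<otimes> j' \<in> K" using j in_K by (intro subringE(6)[OF K]) auto
    then show "j \<otimes> j' \<in> denominators K A u" using prod[OF j] by (simp add: denominators_def)
  qed
qed

lemma generates_one_denominators_subring:
  assumes K: "subring K R" and T: "T \<subseteq> carrier R" and A: "subring A R" "K \<subseteq> A"
  shows "subring {s \<in> carrier R. generates_one T (denominators K A s)} R" (is "subring ?G R")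
proof (rule subringI)
  note A_closed = subringE[OF A(1)]
  have den: "j \<in> carrier R" "j \<in> A" "j \<otimes> s \<in> A" if "j \<in> denominators K A s" for j s
    using that subring_mem[OF K] A(2) by (auto simp: denominators_def)
  have mem: "u \<in> ?G" if "s \<in> ?G" "s' \<in> ?G" "u \<in> carrier R"
    "\<And>j j'. j \<in> denominators K A s \<Longrightarrow> j' \<in> denominators K A s' \<Longrightarrow> j \<otimes> j' \<otimes> u \<in> A" for s s' u
    using generates_one_denominators_if_mult[OF K T] that by blast
  show "?G \<subseteq> carrier R" by auto
  have "\<one> \<in> denominators K A \<one>" using subringE(3)[OF K] A_closed(3) by (simp add: denominators_def)
  then show "\<one> \<in> ?G" by (simp add: generates_one_if_one_mem)
  fix s assume s: "s \<in> ?G"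
  then have s_carrier: "s \<in> carrier R" by simp
  show "\<ominus> s \<in> ?G"
  proof (rule mem[OF s s])
    fix j j' assume j: "j \<in> denominators K A s" "j' \<in> denominators K A s"
    have "j \<otimes> j' \<otimes> (\<ominus> s) = \<ominus> (j \<otimes> (j' \<otimes> s))"
      using s_carrier den(1)[OF j(1)] den(1)[OF j(2)] by (simp add: r_minus m_assoc)
    then show "j \<otimes> j' \<otimes> (\<ominus> s) \<in> A" using A_closed(5,6) den[OF j(1)] den[OF j(2)] by simp
  qed (use s_carrier in simp)
  fix s' assume s': "s' \<in> ?G"
  then have s'_carrier: "s' \<in> carrier R" by simp
  show "s \<oplus> s' \<in> ?G"
  proof (rule mem[OF s s'])
    fix j j' assume j: "j \<in> denominators K A s" "j' \<in> denominators K A s'"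
    have "j \<otimes> j' \<otimes> (s \<oplus> s') = j' \<otimes> (j \<otimes> s) \<oplus> j \<otimes> (j' \<otimes> s')"
      using s_carrier s'_carrier den(1)[OF j(1)] den(1)[OF j(2)] by (simp add: r_distr m_ac)
    then show "j \<otimes> j' \<otimes> (s \<oplus> s') \<in> A" using A_closed(6,7) den[OF j(1)] den[OF j(2)] by simp
  qed (use s_carrier s'_carrier in simp)
  show "s \<otimes> s' \<in> ?G"
  proof (rule mem[OF s s'])
    fix j j' assume j: "j \<in> denominators K A s" "j' \<in> denominators K A s'"
    have "j \<otimes> j' \<otimes> (s \<otimes> s') = (j \<otimes> s) \<otimes> (j' \<otimes> s')"
      using s_carrier s'_carrier den(1)[OF j(1)] den(1)[OF j(2)] by (simp add: m_ac)
    then show "j \<otimes> j' \<otimes> (s \<otimes> s') \<in> A" using A_closed(6) den[OF j(1)] den[OF j(2)] by simp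
  qed (use s_carrier s'_carrier in simp)
qed

text \<open>An upper bound consists of the elements whose denominators with respect to \<open>T'\<close> generate the
  unit ideal of \<open>T\<close>.\<close>

lemma integrally_closed_upper_bound:
  assumes K: "subring K R" and FCP: "FCP K R" and T: "subring T R" "K \<subseteq> T"
    and T': "subring T' R" "K \<subseteq> T'"
    and closed: "integral_closure K \<inter> T \<subseteq> K" and closed': "integral_closure K \<inter> T' \<subseteq> K"
  shows "\<exists>G. subring G R \<and> T \<subseteq> G \<and> T' \<subseteq> G \<and> integral_closure K \<inter> G \<subseteq> K"
proof (intro exI conjI)
  let ?G = "{s \<in> carrier R. generates_one T (denominators K T' s)}"
  show "subring ?G R" by (rule generates_one_denominators_subring[OF K subringE(1)[OF T(1)] T'])
  show "T \<subseteq> ?G"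
  proof
    fix s assume s: "s \<in> T"
    have "denominators K K s \<subseteq> denominators K T' s" using T'(2) by (auto simp: denominators_def)
    then show "s \<in> ?G"
      using generates_one_mono[OF integrally_closed_denominators[OF K FCP T closed s]]
        subring_mem[OF T(1) s] by simp
  qed
  show "T' \<subseteq> ?G"
  proof
    fix s assume s: "s \<in> T'"
    have "\<one> \<in> denominators K T' s"
      using s subringE(3)[OF K] subring_mem[OF T'(1) s] by (simp add: denominators_def)
    then show "s \<in> ?G" using subring_mem[OF T'(1) s] by (simp add: generates_one_if_one_mem)
  qed
  show "integral_closure K \<inter> ?G \<subseteq> K"
  proof
    fix s assume "s \<in> integral_closure K \<inter> ?G"
    then have s: "s \<in> carrier R" and int: "integral_over K R s"
      and gen: "generates_one T (denominators K T' s)"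
      by (auto simp: integral_closure_def)
    let ?H = "{h \<in> carrier R. h \<otimes> s \<in> T}"
    have "submodule_over T ?H"
      using subringE[OF T(1)] subring_mem[OF T(1)] s
      by (intro submodule_overI) (auto simp: l_distr m_assoc)
    moreover have "j \<in> ?H" if "j \<in> denominators K T' s" for j
    proof -
      have j: "j \<in> K" "j \<otimes> s \<in> T'" "j \<in> carrier R"
        using that subring_mem[OF K] by (auto simp: denominators_def)
      have "j \<otimes> s \<in> K"
        using closed' integral_over_smult[OF K s j(1) int] j s by (auto simp: integral_closure_def)
      then show ?thesis using j(3) T(2) by auto
    qed
    ultimately have "\<one> \<in> ?H" using generates_oneD[OF gen] by blast
    then have "s \<in> T" using s by simp
    then show "s \<in> K" using closed int s by (auto simp: integral_closure_def)
  qed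
qed

theorem pruefer_hull_pruefer_ext:
  assumes K: "subring K R" and FCP: "FCP K R"
  shows "pruefer_hull K R \<in> intermediate_rings K R"
    "pruefer_ext K (R\<lparr>carrier := pruefer_hull K R\<rparr>)"
proof -
  let ?P = "\<lambda>T. T \<in> intermediate_rings K R \<and> pruefer_ext K (R\<lparr>carrier := T\<rparr>)"
  have P_iff: "?P T \<longleftrightarrow> subring T R \<and> K \<subseteq> T \<and> integral_closure K \<inter> T \<subseteq> K" for T
    unfolding intermediate_rings_def using pruefer_ext_iff_integrally_closed[OF K FCP] by blast
  have "K \<in> Collect ?P" using P_iff[of K] K by simp
  then obtain M where M: "?P M" and max: "\<And>T. ?P T \<Longrightarrow> M \<subseteq> T \<Longrightarrow> T = M"
    using FCP_maximal[OF FCP, of "Collect ?P"] by auto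
  have "T \<subseteq> M" if T: "?P T" for T
  proof -
    obtain G where G: "subring G R" "T \<subseteq> G" "M \<subseteq> G" "integral_closure K \<inter> G \<subseteq> K"
      using integrally_closed_upper_bound[OF K FCP, of T M] T M unfolding P_iff by auto
    then have "?P G" using T unfolding P_iff by auto
    then show ?thesis using max[of G] G(2,3) by simp
  qed
  then have "pruefer_hull K R = M"
    unfolding pruefer_hull_def using M by (intro Greatest_equality) auto
  then show "pruefer_hull K R \<in> intermediate_rings K R"
    "pruefer_ext K (R\<lparr>carrier := pruefer_hull K R\<rparr>)"
    using M by auto
qed

theorem pruefer_hull_subset:
  assumes K: "subring K R" and FCP: "FCP K R" and U: "U \<in> intermediate_rings K R" "integral_ext U R"
  shows "pruefer_hull K R \<subseteq> U"
proof
  fix t assume t: "t \<in> pruefer_hull K R"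
  have P: "subring (pruefer_hull K R) R" "K \<subseteq> pruefer_hull K R"
    using pruefer_hull_pruefer_ext(1)[OF K FCP] by (auto simp: intermediate_rings_def)
  have "integral_over U R t" using U(2) subring_mem[OF P(1) t] by (simp add: integral_ext_def)
  then show "t \<in> U"
    using pruefer_integral_mem[OF K P pruefer_hull_pruefer_ext(2)[OF K FCP] _ _ t] U(1)
    by (simp add: intermediate_rings_def)
qed

theorem FCP_least_integral:
  assumes K: "subring K R" and FCP: "FCP K R"
  obtains T where "T \<in> intermediate_rings K R" "integral_ext T R"
    and "\<And>U. U \<in> intermediate_rings K R \<Longrightarrow> integral_ext U R \<Longrightarrow> T \<subseteq> U"
proof -
  let ?\<A> = "{U \<in> intermediate_rings K R. integral_ext U R}"
  have "integral_ext (carrier R) R"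
    using integral_over_if_nat_pow_mem[OF carrier_is_subring, of _ 0]
    by (simp add: integral_ext_def)
  then have "carrier R \<in> ?\<A>"
    using carrier_is_subring subringE(1)[OF K] by (auto simp: intermediate_rings_def)
  then have "?\<A> \<noteq> {}" by blast
  then obtain T where T: "T \<in> ?\<A>" and min: "\<forall>U\<in>?\<A>. U \<subseteq> T \<longrightarrow> U = T"
    using FCP_minimal[OF FCP, of ?\<A>] by blast
  have "T \<subseteq> U" if "U \<in> intermediate_rings K R" "integral_ext U R" for U
  proof -
    have TU_rings: "subring T R" "K \<subseteq> T" "integral_ext T R" "subring U R" "K \<subseteq> U"
      using T that by (auto simp: intermediate_rings_def)
    have "integral_ext (T \<inter> U) R"
      using FCP_mono[OF FCP, of "T \<inter> U"] TU_rings by (intro integral_ext_Int that(2)) auto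
    then have "T \<inter> U \<in> ?\<A>"
      using subring_inter[OF TU_rings(1,4)] TU_rings(2,5) by (simp add: intermediate_rings_def)
    then have "T \<inter> U = T" using min by simp
    then show ?thesis by blast
  qed
  with T show ?thesis by (intro that[of T]) simp_all
qed

end

theorem theorem3p5:
  fixes S :: "('a, 'b) ring_scheme" and R :: "'a set"
  assumes "cring S" and "subring R S" and "R \<subset> carrier S" and "FCP R S"
  shows "(\<exists>T \<in> intermediate_rings R S. integral_ext T S \<and>
            (\<forall>U \<in> intermediate_rings R S. integral_ext U S \<longrightarrow> T \<subseteq> U)) \<and>
         co_integral_closure R S = \<Inter> {U \<in> intermediate_rings R S. integral_ext U S} \<and>
         pruefer_hull R S \<subseteq> co_integral_closure R S"
proof -
  interpret S: cring S by fact
  obtain T where T: "T \<in> intermediate_rings R S" "integral_ext T S"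
    and least: "\<And>U. U \<in> intermediate_rings R S \<Longrightarrow> integral_ext U S \<Longrightarrow> T \<subseteq> U"
    using S.FCP_least_integral[OF assms(2,4)] by blast
  have "co_integral_closure R S = T"
    unfolding co_integral_closure_def using T least by (intro Least_equality) auto
  moreover have "\<Inter> {U \<in> intermediate_rings R S. integral_ext U S} = T" using T least by blast
  moreover have "pruefer_hull R S \<subseteq> T" by (rule S.pruefer_hull_subset[OF assms(2,4) T])
  ultimately show ?thesis using T least by (intro conjI bexI[of _ T]) simp_all
qed

end
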